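(* Let $(\alpha,\beta)\in\Gamma$ be a point with $\alpha,\beta>0$ such that $f\in C^2[\alpha,L)$ with $f'<0$ and $f''>0$ on $[\alpha,L)$, and $g\in C^2[\beta,M)$ with $g'<0$ and $g''>0$ on $[\beta,M)$. Suppose there is a partition $\alpha=\alpha_0<\alpha_1<\dots<\alpha_m=L$ such that $f''$ is monotonic on each subinterval $(\alpha_i,\alpha_{i+1})$, and a partition $\beta=\beta_0<\beta_1<\dots<\beta_n=M$ such that $g''$ is monotonic on each subinterval $(\beta_i,\beta_{i+1})$. (a) Assume the curve $\Gamma$ does not pass through any integer lattice points. Suppose $\alpha<\lfloor L\rfloor$ and $\beta<\lfloor M\rfloor$, and let $0<\delta<\lfloor L\rfloor-\alpha$ and $0<\epsilon<\lfloor M\rfloor-\beta$. Then the number $N$ of positive-integer lattice points inside $\Gamma$ in the first quadrant satisfies $$\begin{aligned} &\left|N-\operatorname{Area}(\Gamma)+(L+M)/2\right|\\ &\le 6\left(\int_\alpha^L f''(x)^{1/3}\,dx+\int_\beta^M g''(y)^{1/3}\,dy\right)+175\left(\frac{1}{f''(L-\delta)^{1/2}}+\frac{1}{g''(M-\epsilon)^{1/2}}\right)\\ &\quad+525\left(\sum_{i=0}^{m-1}\frac{1}{f''(\alpha_i)^{1/2}}+\sum_{i=0}^{n-1}\frac{1}{g''(\beta_i)^{1/2}}\right)+\frac14\left(\sum_{i=0}^{m-1}|f'(\alpha_i)|+\sum_{i=0}^{n-1}|g'(\beta_i)|\right)\\ &\quad+\frac12(\delta+\epsilon)+3(m+n)+5+\frac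 LM+\frac ML. \end{aligned}$$ (b) Suppose $\alpha<L/2$ and $\beta<M/2$, and let $\delta:(0,\infty)\to(0,L/2-\alpha)$ and $\epsilon:(0,\infty)\to(0,M/2-\beta)$ be functions. The number $N(r,s)$ of positive-integer lattice points lying inside $r\Gamma(s)$ in the first quadrant satisfies, for all $r,s>0$ such that $rs^{-1}L\ge1$ and $rsM\ge1$, $$\begin{aligned} &\left|N(r,s)-r^2\operatorname{Area}(\Gamma)+r(s^{-1}L+sM)/2\right|\\ &\le 6r^{2/3}\left(\int_\alpha^L f''(x)^{1/3}\,dx+\int_\beta^M g''(y)^{1/3}\,dy\right)\\ &\quad+175r^{1/2}\left(\frac{s^{-3/2}}{f''(L-\delta(r))^{1/2}}+\frac{s^{3/2}}{g''(M-\epsilon(r))^{1/2}}\right)\\ &\quad+525r^{1/2}\left(\sum_{i=0}^{m-1}\frac{s^{-3/2}}{f''(\alpha_i)^{1/2}}+\sum_{i=0}^{n-1}\frac{s^{3/2}}{g''(\beta_i)^{1/2}}\right)+\frac14\left(\sum_{i=0}^{m-1}s^2|f'(\alpha_i)|+\sum_{i=0}^{n-1}s^{-2}|g'(\beta_i)|\right)\\ &\quad+\frac12 r\left(s^{-1}\delta(r)+s\,\epsilon(r)\right)+3(m+n)+5+s^{-2}\frac LM+s^2\frac ML. \end{aligned}$$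
   Context: Let $L,M>0$ and let $\Gamma$ be a convex, strictly decreasing curve in the first quadrant with $x$-intercept $L$ and $y$-intercept $M$: $\Gamma$ is the graph of $y=f(x)$, where $f:[0,L]\to[0,M]$ is a continuous, convex, strictly decreasing function with $f(0)=M$ and $f(L)=0$. Let $g:[0,M]\to[0,L]$ be the inverse function of $f$ (also convex and strictly decreasing). $\operatorname{Area}(\Gamma)=\int_0^L f(x)\,dx$ is the area enclosed by $\Gamma$ and the coordinate axes. The curve $\Gamma$ includes its endpoints $(L,0)$ and $(0,M)$, so if it passes through no integer lattice points then $L$ and $M$ are not integers. For $r,s>0$, $r\Gamma(s)$ is the graph of $x\mapsto rs\,f(sx/r)$ on $0\le x\le rL/s$. The number of positive-integer lattice points inside or on $r\Gamma(s)$ is $$N(r,s)=\#\{(j,k)\in\mathbb{N}\times\mathbb{N}: js/r\le L,\ k\le rs\,f(js/r)\},\qquad \mathbb{N}=\{1,2,3,\dots\},$$ and the number $N$ in part (a) is $N=N(1,1)$. *)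

theory Defs
  imports "HOL-Analysis.Analysis"
begin

definition graph_curve :: "(real \<Rightarrow> real) \<Rightarrow> real \<Rightarrow> (real \<times> real) set" where
  "graph_curve f L = {(x, f x) | x. 0 \<le> x \<and> x \<le> L}"

definition area_under :: "(real \<Rightarrow> real) \<Rightarrow> real \<Rightarrow> real" where
  "area_under f L = integral {0..L} f"

(* The scaled curve is the graph of x |-> r s f(s x / r) over [0, r L / s]. *)
definition lattice_count :: "(real \<Rightarrow> real) \<Rightarrow> real \<Rightarrow> real \<Rightarrow> real \<Rightarrow> nat" where
  "lattice_count f L r s =
     card {(j::nat, k::nat). 1 \<le> j \<and> 1 \<le> k \<and>
             real j * s / r \<le> L \<and> real k \<le> r * s * f (real j * s / r)}"

(* Derivatives are taken within S, so at a closed endpoint of an interval they are one-sided. *)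
definition C2_on_with ::
    "real set \<Rightarrow> (real \<Rightarrow> real) \<Rightarrow> (real \<Rightarrow> real) \<Rightarrow> (real \<Rightarrow> real) \<Rightarrow> bool" where
  "C2_on_with S f f' f'' \<longleftrightarrow>
     (\<forall>x\<in>S. (f has_real_derivative f' x) (at x within S)) \<and>
     (\<forall>x\<in>S. (f' has_real_derivative f'' x) (at x within S)) \<and>
     continuous_on S f''"

definition partition_of :: "(nat \<Rightarrow> real) \<Rightarrow> nat \<Rightarrow> real \<Rightarrow> real \<Rightarrow> bool" where
  "partition_of p m a b \<longleftrightarrow> p 0 = a \<and> p m = b \<and> (\<forall>i<m. p i < p (Suc i))"

definition monotonic_on :: "real set \<Rightarrow> (real \<Rightarrow> real) \<Rightarrow> bool" where
  "monotonic_on S h \<longleftrightarrow> mono_on S h \<or> antimono_on S h"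

end

theory Submission
  imports Defs
begin

text \<open>The lattice points split into those with \<open>j > \<alpha>\<close>, counted in columns under \<open>f\<close>, those with \<open>k > \<beta>\<close>,
  counted in rows under \<open>g\<close>, and a rectangle. Euler summation reduces each of the two counts to a sum
  of \<open>sawtooth (f n)\<close>. The average of the sawtooth over an interval of length \<open>1 / (\<pi> H)\<close> has an absolutely
  convergent Fourier series, so van der Corput's second derivative estimate for exponential sums
  (through the Kusmin-Landau inequality) bounds a sum of
  \<open>N\<close> terms by \<open>O(N \<omega> + 1 / sqrt (\<omega>^3))\<close> wherever \<open>f''\<close> is comparable to \<open>\<omega>^3\<close>. As \<open>f''\<close> is monotone, it runs
  through the levels \<open>\<omega> (5/4)^j\<close> in order and the terms \<open>1 / sqrt (\<omega>^3)\<close> form a geometric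
  series. Once \<open>\<omega> \<ge> 1/12\<close>, the trivial bound \<open>1/2\<close> per term is already below \<open>6 f''^(1/3)\<close>.
  Part (b) is the estimate for the rescaled curve.\<close>


subsection \<open>Fourier expansion of the sawtooth\<close>

text \<open>The sawtooth has Fourier coefficients of order \<open>1 / h\<close> while the available
  exponential sum bounds grow like \<open>sqrt h\<close>, so its own series cannot be bounded term
  by term. Averaging over a window of length \<open>\<Delta>\<close> brings the coefficients down to
  order \<open>1 / (\<Delta> * h^2)\<close> for large \<open>h\<close>. Since the sawtooth rises
  with slope 1 and jumps only downward, a window to the left bounds it from above and one to the
  right from below, at a cost of \<open>\<Delta> / 2\<close>. The other obstacle is the far end of
  each arc: \<open>f''\<close> is controlled only on \<open>{\<alpha>..<L}\<close> and may vanish or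
  blow up at \<open>L\<close>. What stays bounded is \<open>f'\<close>, which increases from
  \<open>f' \<alpha>\<close> and remains negative. This makes the cube root of \<open>f''\<close>
  integrable and keeps the Euler summation error below \<open>\<bar>f' \<alpha>\<bar> / 8\<close>.
  The sawtooth sum is cut at \<open>L - \<delta>\<close>, and the integers beyond are estimated
  trivially. The level ratio 5/4 is nearly the largest for which one level fits under the factor 6,
  and 50 satisfies \<open>12 + 50 * (4/5) powr (3/2) \<le> 50\<close>, which lets the levels be
  added by induction.\<close>

definition sawtooth :: "real \<Rightarrow> real" where
  "sawtooth x = frac x - 1 / 2"

text \<open>The second periodic Bernoulli function without its constant 1/6. It is a continuous
  antiderivative of twice the sawtooth, so its difference quotients, halved, are window averages of
  the sawtooth.\<close>

definition bernoulli_parabola :: "real \<Rightarrow> real" where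
  "bernoulli_parabola x = (frac x)\<^sup>2 - frac x"

lemma abs_sawtooth_le: "\<bar>sawtooth x\<bar> \<le> 1 / 2"
  using frac_ge_0[of x] frac_lt_1[of x] unfolding sawtooth_def by linarith

lemma dirichlet_kernel:
  fixes x :: real
  shows "sin (pi * x) * (1 + 2 * (\<Sum>h=1..K. cos (2 * pi * real h * x))) = sin ((2 * real K + 1) * pi * x)"
proof (induction K)
  case (Suc K)
  have "2 * sin (pi * x) * cos (2 * pi * real (Suc K) * x)
      = sin ((2 * real (Suc K) + 1) * pi * x) - sin ((2 * real K + 1) * pi * x)"
  proof -
    have "(2 * real (Suc K) + 1) * pi * x = 2 * pi * real (Suc K) * x + pi * x"
      "(2 * real K + 1) * pi * x = 2 * pi * real (Suc K) * x - pi * x"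
      by (simp_all add: algebra_simps)
    then show ?thesis
      by (simp only: sin_add sin_diff) (simp add: algebra_simps)
  qed
  with Suc show ?case by (simp add: algebra_simps)
qed (simp add: algebra_simps)

text \<open>The error functions below are controlled by moving from 1/2, where they are known, to
  \<open>x\<close>. This makes estimates in terms of \<open>sin (pi * x)\<close> valid on the whole
  segment.\<close>

lemma sin_pi_ge_between:
  fixes x t :: real
  assumes "0 < x" "x < 1" "t \<in> closed_segment x (1/2)"
  shows "sin (pi * x) \<le> sin (pi * t)"
proof (cases "x \<le> 1/2")
  case True
  then have "x \<le> t" "t \<le> 1/2" using assms by (auto simp: closed_segment_eq_real_ivl split: if_splits)
  moreover have "- pi \<le> pi * (x * 2)" using assms pi_gt3 by (simp add: order_trans[of _ 0])
  ultimately show ?thesis using assms True by (intro sin_monotone_2pi_le) (auto simp: field_simps)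
next
  case False
  then have t: "t \<le> x" "t \<ge> 1/2" using assms by (auto simp: closed_segment_eq_real_ivl split: if_splits)
  have "- (pi / 2) \<le> pi * (1 - x)" using pi_gt3 mult_nonneg_nonneg[of pi "1 - x"] assms by linarith
  moreover have "pi * (1 - t) \<le> pi * (1/2)" using t by (intro mult_left_mono) auto
  ultimately have "sin (pi * (1 - x)) \<le> sin (pi * (1 - t))"
    using t by (intro sin_monotone_2pi_le) (auto intro: mult_left_mono)
  then show ?thesis by (simp add: algebra_simps sin_diff)
qed

text \<open>The remainder \<open>R\<close> vanishes at 1/2 and its derivative is the Dirichlet
  kernel \<open>sin (N * pi * t) / sin (pi * t)\<close>, which is not small but oscillates. One
  integration by parts exploits this: adding the boundary term to form \<open>W\<close> cancels the
  kernel and leaves a derivative of size \<open>1 / (N * (sin (pi * t))^2)\<close>.\<close>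

lemma sawtooth_partial_sum_bound:
  fixes x :: real
  assumes x: "0 < x" "x < 1"
  shows "\<bar>(\<Sum>h=1..K. sin (2 * pi * real h * x) / (pi * real h)) + x - 1 / 2\<bar>
     \<le> (1 / (sin (pi * x))\<^sup>2 + 1 / sin (pi * x)) / (2 * real K + 1)"
proof -
  define N where "N = 2 * real K + 1"
  define R where "R = (\<lambda>t. (\<Sum>h=1..K. sin (2 * pi * real h * t) / (pi * real h)) + t - 1 / 2)"
  define W where "W = (\<lambda>t. R t + cos (N * pi * t) / (N * pi * sin (pi * t)))"
  define W' where "W' = (\<lambda>t. - cos (N * pi * t) * cos (pi * t) / (N * (sin (pi * t))\<^sup>2))"
  have N: "N \<ge> 1" by (simp add: N_def)
  have s0: "sin (pi * x) > 0" using x by (intro sin_gt_zero) auto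
  have seg: "sin (pi * t) \<ge> sin (pi * x)" if "t \<in> closed_segment x (1/2)" for t
    using sin_pi_ge_between[OF x that] .
  have R': "(R has_real_derivative sin (N * pi * t) / sin (pi * t)) (at t)" if "sin (pi * t) > 0" for t
  proof -
    have "(R has_real_derivative (\<Sum>h=1..K. cos (2 * pi * real h * t) * (2 * pi * real h) / (pi * real h)) + 1) (at t)"
      unfolding R_def by (auto intro!: derivative_eq_intros sum.cong)
    also have "(\<Sum>h=1..K. cos (2 * pi * real h * t) * (2 * pi * real h) / (pi * real h))
       = 2 * (\<Sum>h=1..K. cos (2 * pi * real h * t))"
      unfolding sum_distrib_left by (intro sum.cong) auto
    also have "2 * (\<Sum>h=1..K. cos (2 * pi * real h * t)) + 1 = sin (N * pi * t) / sin (pi * t)"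
      using dirichlet_kernel[of t K] that by (simp add: eq_divide_eq N_def add.commute mult.commute)
    finally show ?thesis .
  qed
  have W': "(W has_real_derivative W' t) (at t)" if "t \<in> closed_segment x (1/2)" for t
  proof -
    have st: "sin (pi * t) > 0" using seg[OF that] s0 by linarith
    have "(W has_real_derivative sin (N * pi * t) / sin (pi * t) +
        (- sin (N * pi * t) * (N * pi) * (N * pi * sin (pi * t)) - cos (N * pi * t) * (N * pi * (cos (pi * t) * pi)))
        / (N * pi * sin (pi * t))\<^sup>2) (at t)"
      unfolding W_def using st N
      by (auto intro!: derivative_eq_intros R' simp: power2_eq_square)
    moreover have "sin (N * pi * t) / sin (pi * t) +
        (- sin (N * pi * t) * (N * pi) * (N * pi * sin (pi * t)) - cos (N * pi * t) * (N * pi * (cos (pi * t) * pi)))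
        / (N * pi * sin (pi * t))\<^sup>2 = W' t"
      unfolding W'_def using st N by (simp add: field_simps power2_eq_square)
    ultimately show ?thesis by simp
  qed
  have bW': "norm (W' t) \<le> 1 / (N * (sin (pi * x))\<^sup>2)" if "t \<in> closed_segment x (1/2)" for t
  proof -
    have "\<bar>cos (N * pi * t)\<bar> * \<bar>cos (pi * t)\<bar> \<le> 1 * 1" by (intro mult_mono) auto
    moreover have "N * (sin (pi * x))\<^sup>2 \<le> N * (sin (pi * t))\<^sup>2"
      using seg[OF that] s0 N by (intro mult_left_mono power_mono) auto
    moreover have "0 < N * (sin (pi * x))\<^sup>2" using N s0 by simp
    ultimately show ?thesis unfolding W'_def
      using N by (simp add: abs_mult) (intro frac_le; simp)
  qed
  have "norm (W x - W (1/2)) \<le> 1 / (N * (sin (pi * x))\<^sup>2) * norm (x - 1/2)"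
    by (rule field_differentiable_bound[OF convex_closed_segment[of x "1/2"]])
      (auto intro: W'[THEN has_field_derivative_at_within] bW'[unfolded real_norm_def])
  also have "\<dots> \<le> 1 / (N * (sin (pi * x))\<^sup>2) * 1"
    using x N by (intro mult_left_mono) (auto simp: abs_le_iff)
  finally have d: "\<bar>W x - W (1/2)\<bar> \<le> 1 / (N * (sin (pi * x))\<^sup>2)" by simp
  have "R (1/2) = 0" unfolding R_def by (simp add: mult.assoc)
  \<comment> \<open>\<open>N\<close> is odd, so the boundary term contributes nothing at the base
    point.\<close>
  moreover have "cos (N * pi * (1/2)) = 0"
  proof -
    have "N * pi * (1/2) = pi * real K + pi/2" by (simp add: N_def field_simps)
    then show ?thesis by (simp only: cos_add) simp
  qed
  ultimately have "W (1/2) = 0" by (simp add: W_def)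
  have "\<bar>cos (N * pi * x) / (N * pi * sin (pi * x))\<bar> \<le> 1 / (N * sin (pi * x))"
  proof -
    have "1 * (N * sin (pi * x)) \<le> pi * (N * sin (pi * x))"
      using N s0 pi_gt3 by (intro mult_right_mono) auto
    then show ?thesis using N s0 by (simp add: abs_mult) (intro frac_le; simp add: algebra_simps)
  qed
  then have "\<bar>R x\<bar> \<le> 1 / (N * (sin (pi * x))\<^sup>2) + 1 / (N * sin (pi * x))"
    using d \<open>W (1/2) = 0\<close> unfolding W_def by linarith
  also have "\<dots> = (1 / (sin (pi * x))\<^sup>2 + 1 / sin (pi * x)) / N" using N s0 by (simp add: field_simps)
  finally show ?thesis unfolding R_def N_def .
qed

text \<open>The derivative of the partial sum minus the parabola is \<open>- 2 * pi^2\<close> times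
  the remainder of the sine series, which is \<open>O(1 / K)\<close> uniformly on the segment from
  \<open>x\<close> to 1/2. Comparing with the value at 1/2 avoids evaluating the additive constant
  of the series.\<close>

lemma cosine_series_tendsto:
  fixes x :: real
  assumes x: "0 < x" "x < 1"
  shows "(\<lambda>K. \<Sum>h=1..K. (cos (2 * pi * real h * x) - cos (2 * pi * real h * (1/2))) / (real h)\<^sup>2)
          \<longlonglongrightarrow> pi\<^sup>2 * ((x\<^sup>2 - x) - ((1/2)\<^sup>2 - 1/2))"
proof -
  define C where "C = 2 * pi\<^sup>2 * (1 / (sin (pi * x))\<^sup>2 + 1 / sin (pi * x))"
  have s0: "sin (pi * x) > 0" using x by (intro sin_gt_zero) auto
  have key: "\<bar>(\<Sum>h=1..K. (cos (2 * pi * real h * x) - cos (2 * pi * real h * (1/2))) / (real h)\<^sup>2)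
       - pi\<^sup>2 * ((x\<^sup>2 - x) - ((1/2)\<^sup>2 - 1/2))\<bar> \<le> C / (2 * real K + 1)" for K
  proof -
    define E where "E = (\<lambda>t. (\<Sum>h=1..K. cos (2 * pi * real h * t) / (real h)\<^sup>2) - pi\<^sup>2 * (t\<^sup>2 - t))"
    define E' where "E' = (\<lambda>t. - 2 * pi\<^sup>2 * ((\<Sum>h=1..K. sin (2 * pi * real h * t) / (pi * real h)) + t - 1 / 2))"
    have E': "(E has_real_derivative E' t) (at t)" for t
    proof -
      have "(E has_real_derivative (\<Sum>h=1..K. - sin (2 * pi * real h * t) * (2 * pi * real h) / (real h)\<^sup>2)
            - pi\<^sup>2 * (2 * t - 1)) (at t)"
        unfolding E_def by (auto intro!: derivative_eq_intros sum.cong simp: divide_simps)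
      moreover have "(\<Sum>h=1..K. - sin (2 * pi * real h * t) * (2 * pi * real h) / (real h)\<^sup>2)
          = (\<Sum>h=1..K. - 2 * pi\<^sup>2 * (sin (2 * pi * real h * t) / (pi * real h)))"
        by (intro sum.cong) (auto simp: power2_eq_square field_simps)
      ultimately have "(E has_real_derivative - 2 * pi\<^sup>2 * (\<Sum>h=1..K. sin (2 * pi * real h * t) / (pi * real h))
            - pi\<^sup>2 * (2 * t - 1)) (at t)"
        by (simp only: sum_distrib_left)
      then show ?thesis unfolding E'_def
        by (rule DERIV_cong) (simp add: algebra_simps)
    qed
    have b: "norm (E' t) \<le> C / (2 * real K + 1)" if t: "t \<in> closed_segment x (1/2)" for t
    proof -
      have t01: "0 < t" "t < 1" using t x by (auto simp: closed_segment_eq_real_ivl split: if_splits)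
      have le: "sin (pi * x) \<le> sin (pi * t)" using sin_pi_ge_between[OF x t] .
      have "norm (E' t) = 2 * pi\<^sup>2 * \<bar>(\<Sum>h=1..K. sin (2 * pi * real h * t) / (pi * real h)) + t - 1 / 2\<bar>"
        unfolding E'_def by (simp add: abs_mult)
      also have "\<dots> \<le> 2 * pi\<^sup>2 * ((1 / (sin (pi * t))\<^sup>2 + 1 / sin (pi * t)) / (2 * real K + 1))"
        using sawtooth_partial_sum_bound[OF t01] by (intro mult_left_mono) auto
      also have "\<dots> \<le> 2 * pi\<^sup>2 * ((1 / (sin (pi * x))\<^sup>2 + 1 / sin (pi * x)) / (2 * real K + 1))"
        using le s0 by (intro mult_left_mono divide_right_mono add_mono frac_le power_mono) auto
      also have "\<dots> = C / (2 * real K + 1)" by (simp add: C_def)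
      finally show ?thesis .
    qed
    have "norm (E x - E (1/2)) \<le> C / (2 * real K + 1) * norm (x - 1/2)"
      by (rule field_differentiable_bound[OF convex_closed_segment[of x "1/2"]])
        (auto intro: E'[THEN has_field_derivative_at_within] b[unfolded real_norm_def])
    also have "\<dots> \<le> C / (2 * real K + 1) * 1"
      using x s0 by (intro mult_left_mono) (auto simp: abs_le_iff C_def)
    finally have "\<bar>E x - E (1/2)\<bar> \<le> C / (2 * real K + 1)" by simp
    then show ?thesis unfolding E_def
      by (simp add: diff_divide_distrib sum_subtractf algebra_simps)
  qed
  have "(\<lambda>K. C / (2 * real K + 1)) \<longlonglongrightarrow> 0"
  proof (rule real_tendsto_divide_at_top[OF tendsto_const])
    show "filterlim (\<lambda>K. 2 * real K + 1) at_top sequentially"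
      by (rule filterlim_at_top_mono[OF filterlim_real_sequentially]) (auto intro!: always_eventually)
  qed
  then show ?thesis
    by (rule LIM_zero_cancel[OF Lim_null_comparison[rotated]], intro always_eventually allI)
      (simp only: real_norm_def, rule key)
qed

lemma summable_inverse_Suc_squares: "summable (\<lambda>h. 1 / (real (Suc h))\<^sup>2)"
proof -
  have "summable (\<lambda>h. inverse ((real h)\<^sup>2))" by (rule inverse_power_summable) simp
  from summable_Suc_iff[THEN iffD2, OF this] show ?thesis by (simp add: inverse_eq_divide)
qed

lemma cosine_series_eq:
  fixes x :: real
  assumes x: "0 \<le> x" "x < 1"
  shows "(\<Sum>h. cos (2 * pi * real (Suc h) * x) / (real (Suc h))\<^sup>2)
        = pi\<^sup>2 * (x\<^sup>2 - x) + ((\<Sum>h. cos (2 * pi * real (Suc h) * (1/2)) / (real (Suc h))\<^sup>2) + pi\<^sup>2 / 4)"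
proof -
  define S where "S = (\<lambda>x::real. \<Sum>h. cos (2 * pi * real (Suc h) * x) / (real (Suc h))\<^sup>2)"
  have bnd: "norm (cos (2 * pi * real (Suc h) * x) / (real (Suc h))\<^sup>2) \<le> 1 / (real (Suc h))\<^sup>2" for h and x :: real
    by (simp add: divide_right_mono)
  have sm: "summable (\<lambda>h. 1 / (real (Suc h))\<^sup>2)"
    by (rule summable_inverse_Suc_squares)
  have sums: "(\<lambda>h. cos (2 * pi * real (Suc h) * x) / (real (Suc h))\<^sup>2) sums S x" for x
    unfolding S_def by (intro summable_sums summable_comparison_test'[OF sm, of 0] bnd)
  have lim: "(\<lambda>K. \<Sum>h=1..K. cos (2 * pi * real h * x) / (real h)\<^sup>2) \<longlonglongrightarrow> S x" for x
  proof -
    have "(\<lambda>K. \<Sum>h=1..K. cos (2 * pi * real h * x) / (real h)\<^sup>2)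
      = (\<lambda>K. \<Sum>h<K. cos (2 * pi * real (Suc h) * x) / (real (Suc h))\<^sup>2)"
      by (rule ext) (simp add: sum.atLeast1_atMost_eq)
    then show ?thesis using sums[of x] unfolding sums_def by simp
  qed
  have inner: "S x = pi\<^sup>2 * (x\<^sup>2 - x) + (S (1/2) + pi\<^sup>2 / 4)" if x: "0 < x" "x < 1" for x
  proof -
    have "(\<lambda>K. (\<Sum>h=1..K. cos (2 * pi * real h * x) / (real h)\<^sup>2) - (\<Sum>h=1..K. cos (2 * pi * real h * (1/2)) / (real h)\<^sup>2))
       \<longlonglongrightarrow> S x - S (1/2)"
      by (intro tendsto_diff lim)
    then have "S x - S (1/2) = pi\<^sup>2 * ((x\<^sup>2 - x) - ((1/2)\<^sup>2 - 1/2))"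
      using cosine_series_tendsto[OF x] by (simp add: sum_subtractf diff_divide_distrib LIMSEQ_unique)
    then show ?thesis by (simp add: power2_eq_square algebra_simps)
  qed
  have cont: "continuous_on UNIV S"
  proof (rule uniform_limit_theorem)
    show "uniform_limit UNIV (\<lambda>K x. \<Sum>h<K. cos (2 * pi * real (Suc h) * x) / (real (Suc h))\<^sup>2) S sequentially"
      unfolding S_def by (rule Weierstrass_m_test[OF bnd sm])
    have "(real (Suc h))\<^sup>2 \<noteq> 0" for h by simp
    then show "\<forall>\<^sub>F K in sequentially. continuous_on UNIV (\<lambda>x. \<Sum>h<K. cos (2 * pi * real (Suc h) * x) / (real (Suc h))\<^sup>2)"
      by (intro always_eventually allI continuous_intros) blast
  qed simp
  have "S x = pi\<^sup>2 * (x\<^sup>2 - x) + (S (1/2) + pi\<^sup>2 / 4)"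
  proof (cases "x = 0")
    case True
    have "(S \<longlongrightarrow> S 0) (at_right 0)"
      using cont by (auto simp: continuous_on_def intro: filterlim_mono[OF _ order_refl at_le])
    moreover have "((\<lambda>x. pi\<^sup>2 * (x\<^sup>2 - x) + (S (1/2) + pi\<^sup>2 / 4)) \<longlongrightarrow> pi\<^sup>2 * (0\<^sup>2 - 0) + (S (1/2) + pi\<^sup>2 / 4)) (at_right 0)"
      by (intro tendsto_intros)
    then have "(S \<longlongrightarrow> pi\<^sup>2 * (0\<^sup>2 - 0) + (S (1/2) + pi\<^sup>2 / 4)) (at_right 0)"
    proof (rule Lim_transform_eventually)
      show "\<forall>\<^sub>F x in at_right 0. pi\<^sup>2 * (x\<^sup>2 - x) + (S (1/2) + pi\<^sup>2 / 4) = S x"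
        unfolding eventually_at_right_field by (intro exI[of _ 1] conjI allI impI sym[OF inner]) auto
    qed
    ultimately have "S 0 = pi\<^sup>2 * (0\<^sup>2 - 0) + (S (1/2) + pi\<^sup>2 / 4)"
      by (rule tendsto_unique[OF trivial_limit_at_right_real])
    then show ?thesis by (simp only: True)
  qed (use x in \<open>auto intro: inner\<close>)
  then show ?thesis unfolding S_def .
qed

lemma cos_frac: "cos (2 * pi * real k * frac x) = cos (2 * pi * real k * x)"
proof -
  have "2 * pi * real k * x = 2 * pi * real k * frac x + 2 * pi * real_of_int (int k * \<lfloor>x\<rfloor>)"
    by (simp add: frac_def algebra_simps)
  moreover have "cos (2 * pi * real_of_int i) = 1" "sin (2 * pi * real_of_int i) = 0" for i
    by (simp_all add: cos_int_2pin sin_int_2pin)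
  ultimately show ?thesis by (simp only: cos_add)
qed

lemma bernoulli_parabola_fourier:
  "(\<lambda>h. (cos (2 * pi * real (Suc h) * x) - cos (2 * pi * real (Suc h) * y)) / (real (Suc h))\<^sup>2)
     sums (pi\<^sup>2 * (bernoulli_parabola x - bernoulli_parabola y))"
proof -
  have sm: "summable (\<lambda>h. cos (2 * pi * real (Suc h) * x) / (real (Suc h))\<^sup>2)" for x
  proof (rule summable_comparison_test'[where N = 0])
    show "summable (\<lambda>h. 1 / (real (Suc h))\<^sup>2)"
      by (rule summable_inverse_Suc_squares)
  qed (simp add: divide_right_mono)
  have "(\<lambda>h. cos (2 * pi * real (Suc h) * x) / (real (Suc h))\<^sup>2) sums (pi\<^sup>2 * bernoulli_parabola x
      + ((\<Sum>h. cos (2 * pi * real (Suc h) * (1/2)) / (real (Suc h))\<^sup>2) + pi\<^sup>2 / 4))" for x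
    using summable_sums[OF sm, of "frac x"]
    unfolding bernoulli_parabola_def
    by (subst (asm) cosine_series_eq) (auto simp: frac_lt_1 cos_frac simp del: of_nat_Suc)
  from sums_diff[OF this[of x] this[of y]] show ?thesis
    by (simp add: algebra_simps diff_divide_distrib)
qed

section \<open>One-sided window averages of the sawtooth and their Fourier coefficients\<close>

lemma frac_diff_small:
  fixes x \<Delta> :: real
  assumes "0 < \<Delta>" "\<Delta> \<le> 1"
  shows "frac (x - \<Delta>) = (if frac x \<ge> \<Delta> then frac x - \<Delta> else frac x - \<Delta> + 1)"
proof (cases "frac x \<ge> \<Delta>")
  case True
  have "x - \<Delta> - (frac x - \<Delta>) = of_int \<lfloor>x\<rfloor>" by (simp add: frac_def)
  then show ?thesis using True assms frac_lt_1[of x] by (auto simp: frac_unique_iff)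
next
  case False
  have "x - \<Delta> - (frac x - \<Delta> + 1) = of_int (\<lfloor>x\<rfloor> - 1)" by (simp add: frac_def)
  then have "x - \<Delta> - (frac x - \<Delta> + 1) \<in> \<int>" by (simp only: Ints_of_int)
  moreover have "0 \<le> frac x - \<Delta> + 1" using assms frac_ge_0[of x] by linarith
  ultimately show ?thesis using False by (simp add: frac_unique_iff)
qed

text \<open>The quotient is the mean of the sawtooth over the window from
  \<open>x - \<Delta>\<close> to \<open>x\<close>. Without a jump in the window there is equality.
  Before a jump the sawtooth is higher by 1 than the continued line, so a jump can only raise the
  mean.\<close>

lemma sawtooth_le_average:
  assumes "0 < \<Delta>" "\<Delta> \<le> 1"
  shows "sawtooth x \<le> (bernoulli_parabola x - bernoulli_parabola (x - \<Delta>)) / (2 * \<Delta>) + \<Delta> / 2"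
proof (cases "frac x \<ge> \<Delta>")
  case True
  then have e: "frac (x - \<Delta>) = frac x - \<Delta>" using frac_diff_small[OF assms] by simp
  show ?thesis unfolding bernoulli_parabola_def sawtooth_def e
    using assms by (simp add: field_simps power2_eq_square)
next
  case False
  then have e: "frac (x - \<Delta>) = frac x - \<Delta> + 1" using frac_diff_small[OF assms] by simp
  show ?thesis unfolding bernoulli_parabola_def sawtooth_def e
    using assms False by (simp add: field_simps power2_eq_square)
qed

text \<open>The mirror image, with the window to the right of \<open>x\<close>: a jump inside it can
  only lower the mean. Substituting \<open>z = x + \<Delta>\<close> reuses the same case
  distinction.\<close>

lemma sawtooth_ge_average:
  assumes "0 < \<Delta>" "\<Delta> \<le> 1"
  shows "sawtooth x \<ge> (bernoulli_parabola (x + \<Delta>) - bernoulli_parabola x) / (2 * \<Delta>) - \<Delta> / 2"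
proof -
  define z where "z = x + \<Delta>"
  have x: "x = z - \<Delta>" by (simp add: z_def)
  show ?thesis
  proof (cases "frac z \<ge> \<Delta>")
    case True
    then have e: "frac (z - \<Delta>) = frac z - \<Delta>" using frac_diff_small[OF assms] by simp
    show ?thesis unfolding x bernoulli_parabola_def sawtooth_def e
      using assms by (simp add: field_simps power2_eq_square e)
  next
    case False
    then have e: "frac (z - \<Delta>) = frac z - \<Delta> + 1" using frac_diff_small[OF assms] by simp
    have "0 \<le> frac z * (1 - \<Delta>)" using assms by simp
    then show ?thesis unfolding x bernoulli_parabola_def sawtooth_def e
      using assms False by (simp add: field_simps power2_eq_square e)
  qed
qed

lemma norm_one_minus_cis_le: "norm (1 - cis t) \<le> 2" "norm (1 - cis t) \<le> \<bar>t\<bar>"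
proof -
  show "norm (1 - cis t) \<le> 2" using norm_triangle_ineq4[of 1 "cis t"] by simp
  have "(norm (1 - cis t))\<^sup>2 = (1 - cos t)\<^sup>2 + (sin t)\<^sup>2" by (simp add: cmod_power2)
  also have "\<dots> = 2 - 2 * cos t"
    using sin_cos_squared_add[of t] by (simp add: power2_eq_square algebra_simps)
  also have "\<dots> = (2 * sin (t / 2))\<^sup>2" using cos_double_sin[of "t / 2"] by (simp add: power_mult_distrib)
  finally have "norm (1 - cis t) = 2 * \<bar>sin (t / 2)\<bar>"
    by (metis abs_mult abs_norm_cancel abs_numeral power2_eq_iff_nonneg real_sqrt_abs)
  then show "norm (1 - cis t) \<le> \<bar>t\<bar>" using abs_sin_x_le_abs_x[of "t / 2"] by simp
qed

text \<open>Up to the factor \<open>1 / pi\<close>, the weight \<open>w\<close> bounds the Fourier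
  coefficients of a window average with cutoff \<open>H\<close>. In the first sum the range up to
  \<open>H\<close> gives \<open>2 * sqrt H\<close> and the tail \<open>H\<close> times
  \<open>2 / sqrt H\<close>. The second sum converges, with a bound independent of \<open>H\<close>:
  the first term is 1 and the rest telescopes to at most 2.\<close>

lemma fourier_weight_sums:
  fixes H :: nat
  defines "w \<equiv> \<lambda>h::nat. if h \<le> H then 1 / real h else real H / (real h)\<^sup>2"
  assumes H: "H \<ge> 1"
  shows "(\<Sum>h<K. w (Suc h) * sqrt (real (Suc h))) \<le> 4 * sqrt (real H)"
    and "(\<Sum>h<K. w (Suc h) / sqrt (real (Suc h))) \<le> 3"
proof -
  have step: "1 / sqrt (real (Suc k)) \<le> 2 * sqrt (real (Suc k)) - 2 * sqrt (real k)" for k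
  proof -
    have "0 \<le> (sqrt (real (Suc k)) - sqrt (real k))\<^sup>2" by simp
    then have "2 * (sqrt (real k) * sqrt (real (Suc k))) \<le> real k + real (Suc k)"
      by (simp add: power2_diff algebra_simps)
    then show ?thesis by (simp add: field_simps)
  qed
  have step2: "1 / (real (Suc k) * sqrt (real (Suc k))) \<le> 2 / sqrt (real k) - 2 / sqrt (real (Suc k))" if "k \<ge> 1" for k
  proof -
    \<comment> \<open>With \<open>a\<close>, \<open>b\<close> the two square roots, the claim
      amounts to \<open>a \<le> 2 * b^2 * (b - a)\<close>. It follows from
      \<open>(b - a) * (b + a) = 1\<close> and \<open>a \<le> b\<close>.\<close>
    define a b where "a = sqrt (real k)" and "b = sqrt (real (Suc k))"
    have ab: "0 < a" "a \<le> b" "b\<^sup>2 = a\<^sup>2 + 1" using that by (auto simp: a_def b_def)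
    have "a \<le> b * 2 * ((b - a) * b)"
    proof -
      have "(b - a) * (b + a) = 1" using ab by (simp add: power2_eq_square algebra_simps)
      moreover have "(b - a) * (b + a) \<le> (b - a) * (2 * b)" using ab by (intro mult_left_mono) auto
      ultimately have "1 \<le> (b - a) * (2 * b)" by simp
      then have "b * 1 \<le> b * ((b - a) * (2 * b))" using ab by (intro mult_left_mono) auto
      then show ?thesis using ab by (simp add: algebra_simps)
    qed
    then have "a / (a * b * b * b) \<le> (b * 2 * ((b - a) * b)) / (a * b * b * b)"
      using ab by (intro divide_right_mono) auto
    moreover have "a / (a * b * b * b) = 1 / (b\<^sup>2 * b)" "(b * 2 * ((b - a) * b)) / (a * b * b * b) = 2 / a - 2 / b"
      using ab(1,2) by (simp_all add: field_simps power2_eq_square)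
    ultimately have "1 / (b\<^sup>2 * b) \<le> 2 / a - 2 / b" by simp
    then show ?thesis by (simp add: a_def b_def)
  qed
  have w_low: "w (Suc k) * sqrt (real (Suc k)) = 1 / sqrt (real (Suc k))" if "Suc k \<le> H" for k
    using that real_sqrt_mult_self[of "real (Suc k)"] by (simp add: w_def field_simps del: of_nat_Suc)
  have w_high: "w (Suc k) * sqrt (real (Suc k)) = H * (1 / (real (Suc k) * sqrt (real (Suc k))))" if "Suc k > H" for k
    using that real_sqrt_mult_self[of "real (Suc k)"]
    by (simp add: w_def field_simps power2_eq_square del: of_nat_Suc real_sqrt_mult_self)
  have low: "(\<Sum>h<K. w (Suc h) * sqrt (real (Suc h))) \<le> 2 * sqrt (real K)" if "K \<le> H" for K
    using that
  proof (induction K)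
    case (Suc K)
    then show ?case using step[of K] w_low[of K] by simp
  qed simp
  have high: "(\<Sum>h<K. w (Suc h) * sqrt (real (Suc h))) \<le> 4 * sqrt (real H) - H * (2 / sqrt (real K))" if "K \<ge> H" for K
    using that
  proof (induction K rule: dec_induct)
    case base
    have "real H * (2 / sqrt (real H)) = 2 * (real H / sqrt (real H))" by simp
    also have "\<dots> = 2 * sqrt (real H)" by (simp only: real_div_sqrt of_nat_0_le_iff)
    finally have "real H * (2 / sqrt (real H)) = 2 * sqrt (real H)" .
    then show ?case using low[of H] by simp
  next
    case (step k)
    have "real H * (1 / (real (Suc k) * sqrt (real (Suc k)))) \<le> real H * (2 / sqrt (real k) - 2 / sqrt (real (Suc k)))"
      using step2[of k] H step by (intro mult_left_mono) auto
    then show ?case using step w_high[of k] by (simp add: right_diff_distrib del: of_nat_Suc)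
  qed
  show "(\<Sum>h<K. w (Suc h) * sqrt (real (Suc h))) \<le> 4 * sqrt (real H)"
  proof (cases "K \<le> H")
    case True
    then have "sqrt (real K) \<le> sqrt (real H)" by simp
    then show ?thesis using low[OF True] by (smt (verit) real_sqrt_ge_zero of_nat_0_le_iff)
  next
    case False
    then have "0 \<le> H * (2 / sqrt (real K))" by simp
    then show ?thesis using high[of K] False by linarith
  qed
  have w_le: "w (Suc k) / sqrt (real (Suc k)) \<le> 1 / (real (Suc k) * sqrt (real (Suc k)))" for k
  proof -
    have "w (Suc k) \<le> 1 / real (Suc k)"
    proof (cases "Suc k \<le> H")
      case False
      then have "real H * real (Suc k) \<le> real (Suc k) * real (Suc k)" by (intro mult_right_mono) auto
      then have "real H * real (Suc k) / (real (Suc k) * real (Suc k) * real (Suc k))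
          \<le> real (Suc k) * real (Suc k) / (real (Suc k) * real (Suc k) * real (Suc k))"
        by (intro divide_right_mono) auto
      then show ?thesis using False by (simp add: w_def power2_eq_square del: of_nat_Suc)
    qed (simp add: w_def)
    then have "w (Suc k) / sqrt (real (Suc k)) \<le> 1 / real (Suc k) / sqrt (real (Suc k))"
      by (intro divide_right_mono) auto
    then show ?thesis by simp
  qed
  have three: "(\<Sum>h<Suc K. w (Suc h) / sqrt (real (Suc h))) \<le> 3 - 2 / sqrt (real (Suc K))" for K
  proof (induction K)
    case 0
    then show ?case using H by (simp add: w_def)
  next
    case (Suc K)
    then show ?case using step2[of "Suc K"] w_le[of "Suc K"] by (simp del: of_nat_Suc)
  qed
  show "(\<Sum>h<K. w (Suc h) / sqrt (real (Suc h))) \<le> 3"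
  proof (cases K)
    case (Suc k)
    have "0 \<le> 2 / sqrt (real (Suc k))" by simp
    then show ?thesis using three[of k] unfolding Suc by linarith
  qed simp
qed

text \<open>Taking differences multiplies the \<open>h\<close>-th exponential sum by
  \<open>1 - cis (- 2 * pi * h * \<Delta>)\<close>. This factor is at most
  \<open>2 * pi * h * \<Delta>\<close> and at most 2, and the choice of \<open>\<Delta>\<close>
  makes the two bounds meet exactly at \<open>h = H\<close>. That is why the weight changes its form
  there.\<close>

lemma bernoulli_parabola_difference_bound:
  fixes y :: "'a \<Rightarrow> real" and H :: nat
  defines "\<Delta> \<equiv> 1 / (pi * real H)"
  assumes H: "H \<ge> 1"
    and P: "0 \<le> P" and Q: "0 \<le> Q"
    and E: "\<And>h. h \<ge> 1 \<Longrightarrow> norm (\<Sum>n\<in>S. cis (2 * pi * real h * y n)) \<le> P * sqrt (real h) + Q / sqrt (real h)"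
  shows "\<bar>(\<Sum>n\<in>S. bernoulli_parabola (y n) - bernoulli_parabola (y n - \<Delta>)) / (2 * \<Delta>)\<bar>
     \<le> (4 / pi) * sqrt (real H) * P + (3 / pi) * Q"
proof -
  define w where "w = (\<lambda>h::nat. if h \<le> H then 1 / real h else real H / (real h)\<^sup>2)"
  define V where "V = (\<Sum>n\<in>S. bernoulli_parabola (y n) - bernoulli_parabola (y n - \<Delta>))"
  define T where "T = (\<lambda>h::nat. \<Sum>n\<in>S. cos (2 * pi * real h * y n) - cos (2 * pi * real h * (y n - \<Delta>)))"
  have \<Delta>: "\<Delta> > 0" using H by (simp add: \<Delta>_def)
  have "(\<lambda>h. \<Sum>n\<in>S. (cos (2 * pi * real (Suc h) * y n) - cos (2 * pi * real (Suc h) * (y n - \<Delta>))) / (real (Suc h))\<^sup>2)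
      sums (\<Sum>n\<in>S. pi\<^sup>2 * (bernoulli_parabola (y n) - bernoulli_parabola (y n - \<Delta>)))"
    by (intro sums_sum bernoulli_parabola_fourier)
  then have "(\<lambda>h. T (Suc h) / (real (Suc h))\<^sup>2) sums (pi\<^sup>2 * V)"
    unfolding T_def V_def sum_distrib_left sum_divide_distrib .
  from sums_divide[OF this, of "2 * pi\<^sup>2 * \<Delta>"]
  have sums: "(\<lambda>h. T (Suc h) / (real (Suc h))\<^sup>2 / (2 * pi\<^sup>2 * \<Delta>)) sums (V / (2 * \<Delta>))"
    by (simp add: field_simps)
  have T: "\<bar>T h / (real h)\<^sup>2 / (2 * pi\<^sup>2 * \<Delta>)\<bar> \<le> w h / pi * (P * sqrt (real h) + Q / sqrt (real h))" if h: "h \<ge> 1" for h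
  proof -
    define a where "a = 2 * pi * real h"
    define B where "B = P * sqrt (real h) + Q / sqrt (real h)"
    have B: "norm (\<Sum>n\<in>S. cis (a * y n)) \<le> B" using E[OF h] by (simp add: a_def B_def)
    then have B0: "0 \<le> B" using norm_ge_zero order_trans by blast
    \<comment> \<open>The difference of cosines is the real part of the exponential sum times a
      factor that does not depend on \<open>n\<close>.\<close>
    have "T h = Re ((1 - cis (- a * \<Delta>)) * (\<Sum>n\<in>S. cis (a * y n)))"
      unfolding sum_distrib_left T_def a_def[symmetric] left_diff_distrib cis_mult Re_sum
      by (intro sum.cong refl) (simp add: algebra_simps)
    then have "\<bar>T h\<bar> \<le> norm (1 - cis (- a * \<Delta>)) * norm (\<Sum>n\<in>S. cis (a * y n))"
      by (metis abs_Re_le_cmod norm_mult)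
    also have "\<dots> \<le> norm (1 - cis (- a * \<Delta>)) * B" using B by (intro mult_left_mono) auto
    finally have T1: "\<bar>T h\<bar> \<le> norm (1 - cis (- a * \<Delta>)) * B" .
    have "norm (1 - cis (- a * \<Delta>)) \<le> 2 * pi * \<Delta> * (real h)\<^sup>2 * w h"
    proof (cases "h \<le> H")
      case True
      have "norm (1 - cis (- a * \<Delta>)) \<le> a * \<Delta>"
        using norm_one_minus_cis_le(2)[of "- a * \<Delta>"] \<Delta> by (simp add: a_def abs_mult)
      also have "a * \<Delta> = 2 * pi * \<Delta> * (real h)\<^sup>2 * w h"
        using True h by (simp add: a_def w_def power2_eq_square)
      finally show ?thesis .
    next
      case False
      have "2 * pi * \<Delta> * (real h)\<^sup>2 * w h = 2" using False H by (simp add: \<Delta>_def w_def)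
      then show ?thesis using norm_one_minus_cis_le(1)[of "- a * \<Delta>"] by simp
    qed
    then have "\<bar>T h\<bar> \<le> (2 * pi * \<Delta> * (real h)\<^sup>2 * w h) * B" using T1 B0 mult_right_mono order_trans by blast
    then have "\<bar>T h\<bar> / ((real h)\<^sup>2 * (2 * pi\<^sup>2 * \<Delta>)) \<le> ((2 * pi * \<Delta> * (real h)\<^sup>2 * w h) * B) / ((real h)\<^sup>2 * (2 * pi\<^sup>2 * \<Delta>))"
      using \<Delta> by (intro divide_right_mono) auto
    also have "\<dots> = w h / pi * B" using h \<Delta> by (simp add: power2_eq_square)
    finally show ?thesis using \<Delta> by (simp add: B_def abs_mult)
  qed
  have part: "\<bar>\<Sum>h<K. T (Suc h) / (real (Suc h))\<^sup>2 / (2 * pi\<^sup>2 * \<Delta>)\<bar> \<le> (4 / pi) * sqrt (real H) * P + (3 / pi) * Q" for K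
  proof -
    have "\<bar>\<Sum>h<K. T (Suc h) / (real (Suc h))\<^sup>2 / (2 * pi\<^sup>2 * \<Delta>)\<bar>
       \<le> (\<Sum>h<K. w (Suc h) / pi * (P * sqrt (real (Suc h)) + Q / sqrt (real (Suc h))))"
      by (rule order_trans[OF sum_abs sum_mono[OF T]]) simp
    also have "\<dots> = P / pi * (\<Sum>h<K. w (Suc h) * sqrt (real (Suc h))) + Q / pi * (\<Sum>h<K. w (Suc h) / sqrt (real (Suc h)))"
      unfolding sum_distrib_left sum.distrib[symmetric] by (intro sum.cong refl) (simp add: field_simps)
    also have "\<dots> \<le> P / pi * (4 * sqrt (real H)) + Q / pi * 3"
      unfolding w_def using fourier_weight_sums[OF H] P Q by (intro add_mono mult_left_mono) auto
    finally show ?thesis by (simp add: mult.commute)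
  qed
  have "(\<lambda>K. \<bar>\<Sum>h<K. T (Suc h) / (real (Suc h))\<^sup>2 / (2 * pi\<^sup>2 * \<Delta>)\<bar>) \<longlonglongrightarrow> \<bar>V / (2 * \<Delta>)\<bar>"
    using sums unfolding sums_def by (rule tendsto_rabs)
  then show ?thesis unfolding V_def
    by (rule LIMSEQ_le_const2) (use part in auto)
qed

text \<open>The upper bound uses left windows at \<open>x n\<close>. The lower bound uses right
  windows, which are left windows at the translates \<open>x n + \<Delta>\<close>; a common
  translation multiplies an exponential sum by a unit, so the same hypothesis applies. The term with
  \<open>card S\<close> is the total cost \<open>\<Delta> / 2\<close> per summand.\<close>

lemma sawtooth_sum_le_exponential_sums:
  fixes x :: "'a \<Rightarrow> real" and H :: nat
  assumes H: "H \<ge> 1" and P: "0 \<le> P" and Q: "0 \<le> Q"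
    and E: "\<And>h. h \<ge> 1 \<Longrightarrow> norm (\<Sum>n\<in>S. cis (2 * pi * real h * x n)) \<le> P * sqrt (real h) + Q / sqrt (real h)"
  shows "\<bar>\<Sum>n\<in>S. sawtooth (x n)\<bar>
     \<le> real (card S) / (2 * pi * real H) + (4 / pi) * sqrt (real H) * P + (3 / pi) * Q"
proof -
  define \<Delta> where "\<Delta> = 1 / (pi * real H)"
  define D where "D = (\<lambda>z. (bernoulli_parabola z - bernoulli_parabola (z - \<Delta>)) / (2 * \<Delta>))"
  have "1 \<le> pi * real H" using H pi_gt3 mult_mono[of 1 pi 1 "real H"] by simp
  then have \<Delta>: "0 < \<Delta>" "\<Delta> \<le> 1" by (simp_all add: \<Delta>_def)
  have "norm (\<Sum>n\<in>S. cis (2 * pi * real h * (x n + \<Delta>))) = norm (\<Sum>n\<in>S. cis (2 * pi * real h * x n))" for h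
  proof -
    have "(\<Sum>n\<in>S. cis (2 * pi * real h * (x n + \<Delta>))) = cis (2 * pi * real h * \<Delta>) * (\<Sum>n\<in>S. cis (2 * pi * real h * x n))"
      unfolding sum_distrib_left cis_mult by (simp add: algebra_simps)
    then show ?thesis by (simp add: norm_mult)
  qed
  then have E': "norm (\<Sum>n\<in>S. cis (2 * pi * real h * (x n + \<Delta>))) \<le> P * sqrt (real h) + Q / sqrt (real h)" if "h \<ge> 1" for h
    using E[OF that] by simp
  have up: "(\<Sum>n\<in>S. D (x n)) \<le> (4 / pi) * sqrt (real H) * P + (3 / pi) * Q"
    using bernoulli_parabola_difference_bound[OF H P Q E, folded \<Delta>_def]
    unfolding D_def sum_divide_distrib by (simp add: abs_le_iff)
  have lo: "- (\<Sum>n\<in>S. D (x n + \<Delta>)) \<le> (4 / pi) * sqrt (real H) * P + (3 / pi) * Q"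
    using bernoulli_parabola_difference_bound[OF H P Q E', folded \<Delta>_def]
    unfolding D_def sum_divide_distrib by (simp add: abs_le_iff)
  have "(\<Sum>n\<in>S. sawtooth (x n)) \<le> (\<Sum>n\<in>S. D (x n) + \<Delta> / 2)"
    unfolding D_def by (intro sum_mono sawtooth_le_average \<Delta>)
  moreover have "(\<Sum>n\<in>S. sawtooth (x n)) \<ge> (\<Sum>n\<in>S. D (x n + \<Delta>) - \<Delta> / 2)"
    unfolding D_def using sawtooth_ge_average[OF \<Delta>] by (intro sum_mono) simp
  moreover have "real (card S) * (\<Delta> / 2) = real (card S) / (2 * pi * real H)" by (simp add: \<Delta>_def)
  ultimately show ?thesis using up lo by (simp add: sum.distrib sum_subtractf abs_le_iff)
qed

subsection \<open>Exponential sums\<close>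

text \<open>Jordan's inequality: the sine is concave on the quarter period and lies above its
  chord.\<close>

lemma sin_pi_ge_twice:
  fixes t :: real
  assumes "0 \<le> t" "t \<le> 1/2"
  shows "2 * t \<le> sin (pi * t)"
proof -
  have "convex_on {0..pi/2} (\<lambda>x. - sin x)"
  proof (rule convex_on_realI[where f' = "\<lambda>x. - cos x"])
    show "((\<lambda>x. - sin x) has_real_derivative - cos x) (at x)" for x :: real
      by (auto intro!: derivative_eq_intros)
    show "- cos x \<le> - cos y" if "x \<in> {0..pi/2}" "y \<in> {0..pi/2}" "x \<le> y" for x y :: real
      using that by (auto intro: cos_monotone_0_pi_le)
  qed auto
  from convex_onD[OF this, of "2 * t" 0 "pi / 2"] assms show ?thesis by (simp add: mult.commute)
qed

lemma inverse_cis_minus_one: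
  assumes "0 < d" "d < 1"
  shows "(cis (2 * pi * d) - 1) * Complex (- 1 / 2) (- cot (pi * d) / 2) = 1"
proof -
  have s: "sin (pi * d) \<noteq> 0" using sin_gt_zero[of "pi * d"] assms by simp
  define s c where "s = sin (pi * d)" and "c = cos (pi * d)"
  have sc: "s\<^sup>2 + c\<^sup>2 = 1" by (simp add: s_def c_def)
  have "cos (2 * pi * d) = 1 - 2 * s\<^sup>2" "sin (2 * pi * d) = 2 * s * c"
    using cos_double_sin[of "pi * d"] sin_double[of "pi * d"] by (simp_all add: mult.assoc s_def c_def)
  moreover have "cot (pi * d) = c / s" by (simp add: cot_def s_def c_def)
  moreover have "s * s + c * c = 1" "s \<noteq> 0" using s sc by (auto simp: s_def power2_eq_square)
  then have "c * c = 1 - s * s" by simp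
  ultimately show ?thesis using \<open>s \<noteq> 0\<close>
    by (simp add: complex_eq_iff power2_eq_square)
qed

text \<open>By the subtraction formula the difference of the cotangents is
  \<open>sin (pi * (y - x))\<close> over a product of positive sines.\<close>

lemma cot_pi_antimono:
  fixes x y :: real
  assumes "0 < x" "x \<le> y" "y < 1"
  shows "cot (pi * y) \<le> cot (pi * x)"
proof -
  have "sin (pi * x) > 0" "sin (pi * y) > 0" using assms by (auto intro!: sin_gt_zero)
  moreover have "sin (pi * (y - x)) \<ge> 0" using assms by (intro sin_ge_zero) auto
  then have "sin (pi * y) * cos (pi * x) - cos (pi * y) * sin (pi * x) \<ge> 0"
    by (simp add: right_diff_distrib sin_diff)
  ultimately show ?thesis by (simp add: cot_def field_simps)
qed

text \<open>With \<open>g = 1 / (cis (2 * pi * d) - 1)\<close> each summand is \<open>g\<close> times a difference of consecutive terms;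
  summation by parts leaves the total variation of \<open>g\<close>, whose real part is constantly \<open>- 1 / 2\<close>
  and whose imaginary part is monotone.\<close>

lemma kusmin_landau:
  fixes x d :: "nat \<Rightarrow> real"
  assumes \<theta>: "0 < \<theta>" and d: "\<And>n. i \<le> n \<Longrightarrow> n < j \<Longrightarrow> x (Suc n) = x n + real_of_int \<nu> + d n"
    and range: "\<And>n. i \<le> n \<Longrightarrow> n < j \<Longrightarrow> \<theta> \<le> d n \<and> d n \<le> 1 - \<theta>"
    and mono: "\<And>n. i \<le> n \<Longrightarrow> Suc n < j \<Longrightarrow> d n \<le> d (Suc n)"
  shows "norm (\<Sum>n=i..<j. cis (2 * pi * x n)) \<le> 1 / \<theta>"
proof (cases "i < j")
  case True
  define g where "g = (\<lambda>n. Complex (- 1 / 2) (- cot (pi * d n) / 2))"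
  define e where "e = (\<lambda>n. cis (2 * pi * x n))"
  have d01: "0 < d n" "d n < 1" if "i \<le> n" "n < j" for n using range[OF that] \<theta> by auto
  have e: "e n = g n * (e (Suc n) - e n)" if n: "i \<le> n" "n < j" for n
  proof -
    have "e (Suc n) = e n * cis (2 * pi * real_of_int \<nu>) * cis (2 * pi * d n)"
      unfolding e_def d[OF n] cis_mult by (simp add: algebra_simps)
    also have "cis (2 * pi * real_of_int \<nu>) = 1" by (simp add: cis_multiple_2pi)
    finally have "e (Suc n) - e n = e n * (cis (2 * pi * d n) - 1)" by (simp add: algebra_simps)
    then show ?thesis using inverse_cis_minus_one[OF d01[OF n]] unfolding g_def
      by (simp add: algebra_simps)
  qed
  have g: "norm (g n) \<le> 1 / (4 * \<theta>)" "\<bar>cot (pi * d n)\<bar> \<le> 1 / (2 * \<theta>)" if n: "i \<le> n" "n < j" for n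
  proof -
    have s: "2 * \<theta> \<le> sin (pi * d n)"
    proof (cases "d n \<le> 1/2")
      case True
      then show ?thesis using sin_pi_ge_twice[of "d n"] d01[OF n] range[OF n] by simp
    next
      case False
      then have "2 * (1 - d n) \<le> sin (pi * (1 - d n))" using sin_pi_ge_twice[of "1 - d n"] d01[OF n] by simp
      then show ?thesis using range[OF n] by (simp add: right_diff_distrib sin_diff)
    qed
    have "\<bar>cot (pi * d n)\<bar> = \<bar>cos (pi * d n)\<bar> / sin (pi * d n)" using s \<theta> by (simp add: cot_def)
    also have "\<dots> \<le> 1 / (2 * \<theta>)" using s \<theta> by (intro frac_le) auto
    finally show "\<bar>cot (pi * d n)\<bar> \<le> 1 / (2 * \<theta>)" .
    have "(norm (g n))\<^sup>2 = (1 / (2 * sin (pi * d n)))\<^sup>2"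
    proof -
      have "(norm (g n))\<^sup>2 = 1/4 * (1 + (cot (pi * d n))\<^sup>2)" by (simp add: g_def cmod_power2 power_divide)
      also have "1 + (cot (pi * d n))\<^sup>2 = 1 / (sin (pi * d n))\<^sup>2"
        using s \<theta> sin_cos_squared_add[of "pi * d n"] by (simp add: cot_def power_divide divide_simps)
      finally show ?thesis by (simp add: power_divide power_mult_distrib)
    qed
    then have "norm (g n) = 1 / (2 * sin (pi * d n))" using s \<theta> by (subst (asm) power2_eq_iff_nonneg) auto
    also have "\<dots> \<le> 1 / (4 * \<theta>)" using s \<theta> by (intro frac_le) auto
    finally show "norm (g n) \<le> 1 / (4 * \<theta>)" .
  qed
  \<comment> \<open>As \<open>d\<close> increases, the cotangents decrease, so the total variation
    of \<open>g\<close> telescopes and the induction can carry a signed difference. At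
    \<open>k = Suc i\<close> both sides are zero, by the identity \<open>e\<close> for a single
    term.\<close>
  have parts: "norm ((\<Sum>n=i..<k. e n) - g (k - 1) * e k + g i * e i) \<le> (cot (pi * d i) - cot (pi * d (k - 1))) / 2"
    if "Suc i \<le> k" "k \<le> j" for k
    using that
  proof (induction k rule: dec_induct)
    case base
    then show ?case using e[of i] by (simp add: algebra_simps)
  next
    case (step k)
    then obtain k' where k': "k = Suc k'" "i \<le> k'" by (metis Suc_le_D Suc_le_mono)
    have "(\<Sum>n=i..<Suc k. e n) - g k * e (Suc k) + g i * e i
       = ((\<Sum>n=i..<k. e n) - g (k - 1) * e k + g i * e i) + (g k' - g k) * e k"
      using e[of k] step k' by (simp add: algebra_simps)
    moreover have "norm ((g k' - g k) * e k) = (cot (pi * d k') - cot (pi * d k)) / 2"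
    proof -
      have "cot (pi * d k) \<le> cot (pi * d k')"
        using mono[of k'] d01[of k'] d01[of k] k' step by (intro cot_pi_antimono) auto
      moreover have "norm (g k' - g k) = \<bar>(cot (pi * d k') - cot (pi * d k)) / 2\<bar>"
        by (simp add: g_def complex_diff cmod_def) (simp flip: diff_divide_distrib)
      ultimately show ?thesis by (simp add: norm_mult e_def)
    qed
    moreover have "norm ((\<Sum>n=i..<k. e n) - g (k - 1) * e k + g i * e i) \<le> (cot (pi * d i) - cot (pi * d (k - 1))) / 2"
      using step by simp
    ultimately have "norm ((\<Sum>n=i..<Suc k. e n) - g k * e (Suc k) + g i * e i)
      \<le> (cot (pi * d i) - cot (pi * d (k - 1))) / 2 + (cot (pi * d k') - cot (pi * d k)) / 2"
      using norm_triangle_mono by (metis order_refl)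
    then show ?case using k' by (simp add: field_simps)
  qed
  have "norm (\<Sum>n=i..<j. e n) \<le> norm ((\<Sum>n=i..<j. e n) - g (j - 1) * e j + g i * e i) + norm (g (j - 1) * e j) + norm (g i * e i)"
  proof -
    have "norm (p + q - r) \<le> norm p + norm q + norm r" for p q r :: complex
      using norm_triangle_ineq4[of "p + q" r] norm_triangle_ineq[of p q] by linarith
    from this[of "(\<Sum>n=i..<j. e n) - g (j - 1) * e j + g i * e i" "g (j - 1) * e j" "g i * e i"]
    show ?thesis by simp
  qed
  \<comment> \<open>The variation contributes \<open>1 / (2 * \<theta>)\<close> and each of the two
    boundary terms \<open>1 / (4 * \<theta>)\<close>.\<close>
  also have "\<dots> \<le> (cot (pi * d i) - cot (pi * d (j - 1))) / 2 + 1 / (4 * \<theta>) + 1 / (4 * \<theta>)"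
    using parts[of j] True g(1)[of i] g(1)[of "j - 1"] by (intro add_mono) (auto simp: norm_mult e_def)
  also have "\<dots> \<le> 1 / (2 * \<theta>) + 1 / (4 * \<theta>) + 1 / (4 * \<theta>)"
  proof -
    have "\<bar>cot (pi * d i)\<bar> \<le> 1 / (2 * \<theta>)" "\<bar>cot (pi * d (j - 1))\<bar> \<le> 1 / (2 * \<theta>)" using True g(2) by auto
    moreover have "(p - q) / 2 \<le> c" if "\<bar>p\<bar> \<le> c" "\<bar>q\<bar> \<le> c" for p q c :: real
      using that abs_triangle_ineq4[of p q] by simp
    ultimately show ?thesis by (intro add_right_mono)
  qed
  also have "\<dots> = 1 / \<theta>" by (simp add: field_simps)
  finally show ?thesis by (simp add: e_def)
qed (use \<theta> in simp)

lemma sum_cis_bound_card: "finite A \<Longrightarrow> norm (\<Sum>n\<in>A. cis (t n)) \<le> card A"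
  using norm_sum[of "\<lambda>n. cis (t n)" A] by simp

text \<open>Since \<open>d\<close> grows at rate at least \<open>\<mu>\<close> along
  \<open>A\<close>, the first and last index in a window of length \<open>r\<close> are at most
  \<open>r / \<mu>\<close> apart.\<close>

lemma card_separated_le:
  fixes d :: "nat \<Rightarrow> real"
  assumes \<mu>: "0 < \<mu>" and A: "finite A"
    and sep: "\<And>m n. m \<in> A \<Longrightarrow> n \<in> A \<Longrightarrow> m \<le> n \<Longrightarrow> \<mu> * (real n - real m) \<le> d n - d m"
    and range: "\<And>n. n \<in> A \<Longrightarrow> a \<le> d n \<and> d n \<le> a + r" and r: "0 \<le> r"
  shows "real (card A) \<le> r / \<mu> + 1"
proof (cases "A = {}")
  case False
  define p q where "p = Min A" and "q = Max A"
  have pq: "p \<in> A" "q \<in> A" "p \<le> q" using A False by (auto simp: p_def q_def)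
  have "A \<subseteq> {p..q}" using A by (auto simp: p_def q_def)
  then have "card A \<le> card {p..q}" by (intro card_mono) auto
  then have "real (card A) \<le> real q - real p + 1" using pq by simp
  moreover have "real q - real p \<le> r / \<mu>"
    using sep[OF pq] range[OF pq(1)] range[OF pq(2)] \<mu> by (simp add: field_simps)
  ultimately show ?thesis by linarith
qed (use \<mu> r in simp)

text \<open>The indices are grouped by the integer part of \<open>d n\<close>, which takes at most
  \<open>D + 2\<close> values. Within a group, the indices with \<open>d n\<close> near an integer
  are few, because \<open>d\<close> grows, and are counted trivially. The others are consecutive and
  fall under Kusmin-Landau.\<close>

lemma van_der_corput_second_difference:
  fixes x d :: "nat \<Rightarrow> real"
  assumes \<mu>: "0 < \<mu>" and K: "K \<ge> 1"
    and d: "\<And>n. n < K \<Longrightarrow> x (Suc n) = x n + d n"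
    and conv: "\<And>n. Suc n < K \<Longrightarrow> d n + \<mu> \<le> d (Suc n)"
    and D: "d (K - 1) - d 0 \<le> D"
  shows "norm (\<Sum>n<K. cis (2 * pi * x n)) \<le> 5 * (D + 2) / sqrt \<mu> + 1"
proof -
  have sep: "\<mu> * (real n - real m) \<le> d n - d m" if "m \<le> n" "n < K" for m n
    using that
  proof (induction n rule: dec_induct)
    case (step n)
    then show ?case using conv[of n] by (simp add: algebra_simps)
  qed simp
  have dmono: "d m \<le> d n" if "m \<le> n" "n < K" for m n
    using sep[OF that] mult_nonneg_nonneg[of \<mu> "real n - real m"] \<mu> that by linarith
  have D0: "0 \<le> D" using dmono[of 0 "K - 1"] K D by simp
  have drange: "d 0 \<le> d n \<and> d n \<le> d 0 + D" if "n < K" for n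
    using dmono[of 0 n] dmono[of n "K - 1"] that D by force
  show ?thesis
  proof (cases "\<mu> \<ge> 1")
    \<comment> \<open>For \<open>\<mu> \<ge> 1\<close> the values \<open>d n\<close> are so far
      apart that counting the terms suffices. This case produces the additive 1 in the
      conclusion.\<close>
    case True
    have "real (card {..<K}) \<le> D / \<mu> + 1"
      by (rule card_separated_le[where d = d and a = "d 0"]) (use \<mu> sep drange D0 in auto)
    also have "D / \<mu> \<le> 5 * (D + 2) / sqrt \<mu>"
      using True D0 sqrt_le_D[of \<mu> \<mu>] by (intro frac_le) (auto intro: real_le_lsqrt simp: self_le_power)
    finally show ?thesis using sum_cis_bound_card[of "{..<K}" "\<lambda>n. 2 * pi * x n"] by simp
  next
    case False
    \<comment> \<open>This order of magnitude balances the trivial count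
      \<open>2 * \<theta> / \<mu>\<close> with \<open>1 / \<theta>\<close>. Since
      \<open>\<mu> = 4 * \<theta>^2\<close>, the group total is
      \<open>3 / (2 * \<theta>) + 2\<close>, and \<open>\<theta> < 1/2\<close> absorbs the 2 into
      \<open>5 / (2 * \<theta>) = 5 / sqrt \<mu>\<close>.\<close>
    define \<theta> where "\<theta> = sqrt \<mu> / 2"
    have \<theta>: "0 < \<theta>" "\<theta> < 1/2" "\<mu> = 4 * \<theta>\<^sup>2" using \<mu> False by (auto simp: \<theta>_def power_divide real_less_lsqrt)
    define N where "N = {\<lfloor>d 0\<rfloor>..\<lfloor>d (K - 1)\<rfloor>}"
    have fl: "\<lfloor>d n\<rfloor> \<in> N" if "n < K" for n
      using dmono[of 0 n] dmono[of n "K - 1"] that by (auto simp: N_def intro!: floor_mono)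
    have group: "norm (\<Sum>n\<in>{n\<in>{..<K}. \<lfloor>d n\<rfloor> = \<nu>}. cis (2 * pi * x n)) \<le> 5 / sqrt \<mu>" for \<nu>
    proof -
      define A where "A = {n\<in>{..<K}. \<lfloor>d n\<rfloor> = \<nu>}"
      define A1 where "A1 = {n\<in>A. d n < \<nu> + \<theta>}"
      define A2 where "A2 = {n\<in>A. \<nu> + \<theta> \<le> d n \<and> d n \<le> \<nu> + 1 - \<theta>}"
      define A3 where "A3 = {n\<in>A. \<nu> + 1 - \<theta> < d n}"
      have fin: "finite A" "finite A1" "finite A2" "finite A3" by (auto simp: A_def A1_def A2_def A3_def)
      have fld: "\<nu> \<le> d n" "d n < \<nu> + 1" if "n \<in> A" for n using that by (auto simp: A_def)
      have sepA: "\<mu> * (real q - real p) \<le> d q - d p" if "p \<in> A" "q \<in> A" "p \<le> q" for p q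
        using sep[OF that(3)] that(2) by (simp add: A_def)
      have "real (card A1) \<le> \<theta> / \<mu> + 1"
      proof (rule card_separated_le[where d = d and a = "real_of_int \<nu>"])
        show "real_of_int \<nu> \<le> d n \<and> d n \<le> real_of_int \<nu> + \<theta>" if "n \<in> A1" for n
          using that fld[of n] by (simp add: A1_def)
      qed (use \<mu> \<theta> fin sepA in \<open>simp_all add: A1_def\<close>)
      then have b1: "norm (\<Sum>n\<in>A1. cis (2 * pi * x n)) \<le> \<theta> / \<mu> + 1"
        by (rule order_trans[OF sum_cis_bound_card[OF fin(2)]])
      have "real (card A3) \<le> \<theta> / \<mu> + 1"
      proof (rule card_separated_le[where d = d and a = "real_of_int \<nu> + 1 - \<theta>"])
        show "real_of_int \<nu> + 1 - \<theta> \<le> d n \<and> d n \<le> real_of_int \<nu> + 1 - \<theta> + \<theta>" if "n \<in> A3" for n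
          using that fld[of n] by (simp add: A3_def)
      qed (use \<mu> \<theta> fin sepA in \<open>simp_all add: A3_def\<close>)
      then have b3: "norm (\<Sum>n\<in>A3. cis (2 * pi * x n)) \<le> \<theta> / \<mu> + 1"
        by (rule order_trans[OF sum_cis_bound_card[OF fin(4)]])
      have b2: "norm (\<Sum>n\<in>A2. cis (2 * pi * x n)) \<le> 1 / \<theta>"
      proof (cases "A2 = {}")
        case False
        define i j where "i = Min A2" and "j = Suc (Max A2)"
        have ij: "i \<in> A2" "Max A2 \<in> A2" using fin False by (auto simp: i_def)
        \<comment> \<open>Monotonicity of \<open>d\<close> makes \<open>A2\<close> an interval of
          indices, as Kusmin-Landau requires.\<close>
        have in2: "n \<in> A2" if "i \<le> n" "n < j" for n
        proof -
          have nK: "n < K" "n \<le> Max A2" "Max A2 < K" using that ij by (auto simp: j_def A2_def A_def)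
          have "\<nu> + \<theta> \<le> d n" "d n \<le> \<nu> + 1 - \<theta>"
            using dmono[of i n] dmono[of n "Max A2"] that nK ij by (auto simp: A2_def)
          moreover from this \<theta> have "\<lfloor>d n\<rfloor> = \<nu>" by (auto simp: floor_eq_iff)
          ultimately show ?thesis using nK by (auto simp: A2_def A_def)
        qed
        have "A2 = {i..<j}" using in2 fin by (auto simp: i_def j_def less_Suc_eq_le)
        moreover have "norm (\<Sum>n=i..<j. cis (2 * pi * x n)) \<le> 1 / \<theta>"
        proof (rule kusmin_landau[where d = "\<lambda>n. d n - \<nu>" and \<nu> = \<nu>])
          show "x (Suc n) = x n + real_of_int \<nu> + (d n - real_of_int \<nu>)" if "i \<le> n" "n < j" for n
            using d[of n] in2[OF that] by (simp add: A2_def A_def)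
          show "\<theta> \<le> d n - real_of_int \<nu> \<and> d n - real_of_int \<nu> \<le> 1 - \<theta>" if "i \<le> n" "n < j" for n
            using in2[OF that] by (auto simp: A2_def)
          show "d n - real_of_int \<nu> \<le> d (Suc n) - real_of_int \<nu>" if "i \<le> n" "Suc n < j" for n
            using in2[of "Suc n"] that dmono[of n "Suc n"] by (auto simp: A2_def A_def)
        qed (rule \<theta>)
        ultimately show ?thesis by simp
      qed (use \<theta> in simp)
      have "A = A1 \<union> A2 \<union> A3" by (auto simp: A1_def A2_def A3_def)
      moreover have "A1 \<inter> A2 = {}" "(A1 \<union> A2) \<inter> A3 = {}" using \<theta> by (auto simp: A1_def A2_def A3_def)
      ultimately have "(\<Sum>n\<in>A. cis (2 * pi * x n)) = (\<Sum>n\<in>A1. cis (2 * pi * x n)) + (\<Sum>n\<in>A2. cis (2 * pi * x n)) + (\<Sum>n\<in>A3. cis (2 * pi * x n))"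
        using fin by (simp add: sum.union_disjoint)
      then have "norm (\<Sum>n\<in>A. cis (2 * pi * x n)) \<le> (\<theta> / \<mu> + 1) + 1 / \<theta> + (\<theta> / \<mu> + 1)"
        using b1 b2 b3 by (metis add_mono norm_triangle_mono)
      also have "\<dots> \<le> 5 / (2 * \<theta>)"
        unfolding \<theta>(3) using \<theta> by (simp add: field_simps power2_eq_square)
      also have "2 * \<theta> = sqrt \<mu>" by (simp add: \<theta>_def)
      finally show ?thesis by (simp add: A_def)
    qed
    have "(\<Sum>n<K. cis (2 * pi * x n)) = (\<Sum>\<nu>\<in>N. \<Sum>n\<in>{n\<in>{..<K}. \<lfloor>d n\<rfloor> = \<nu>}. cis (2 * pi * x n))"
      using fl by (intro sum.group[symmetric]) (auto simp: N_def)
    then have "norm (\<Sum>n<K. cis (2 * pi * x n)) \<le> (\<Sum>\<nu>\<in>N. 5 / sqrt \<mu>)"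
      using sum_norm_le[of N, OF group] by simp
    also have "\<dots> = card N * (5 / sqrt \<mu>)" by simp
    also have "\<dots> \<le> (D + 2) * (5 / sqrt \<mu>)"
    proof (intro mult_right_mono)
      have "real (card N) = real_of_int (\<lfloor>d (K - 1)\<rfloor> - \<lfloor>d 0\<rfloor> + 1)"
        using dmono[of 0 "K - 1"] K floor_mono[of "d 0" "d (K - 1)"] by (simp add: N_def)
      then show "real (card N) \<le> D + 2" using D by linarith
    qed (use \<mu> in simp)
    finally show ?thesis by (simp add: mult.commute)
  qed
qed

subsection \<open>Sawtooth sums over a curve with monotone second derivative\<close>

text \<open>The index set \<open>{\<lfloor>u\<rfloor><..\<lfloor>v\<rfloor>}\<close> consists of the
  integers in the half-open interval from \<open>u\<close> (excluded) to \<open>v\<close>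
  (included). With this convention adjacent pieces fit together even when a cut point is an
  integer.\<close>

lemma floor_interval_split:
  fixes h :: "int \<Rightarrow> 'a::comm_monoid_add"
  assumes "u \<le> w" "w \<le> (v::real)"
  shows "(\<Sum>n\<in>{\<lfloor>u\<rfloor><..\<lfloor>v\<rfloor>}. h n) = (\<Sum>n\<in>{\<lfloor>u\<rfloor><..\<lfloor>w\<rfloor>}. h n) + (\<Sum>n\<in>{\<lfloor>w\<rfloor><..\<lfloor>v\<rfloor>}. h n)"
proof -
  have "{\<lfloor>u\<rfloor><..\<lfloor>v\<rfloor>} = {\<lfloor>u\<rfloor><..\<lfloor>w\<rfloor>} \<union> {\<lfloor>w\<rfloor><..\<lfloor>v\<rfloor>}"
    using floor_mono[OF assms(1)] floor_mono[OF assms(2)] by auto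
  then show ?thesis by (simp add: sum.union_disjoint)
qed

lemma card_floor_interval_le:
  "u \<le> v \<Longrightarrow> real (card {\<lfloor>u\<rfloor><..\<lfloor>v::real\<rfloor>}) \<le> v - u + 1"
  using floor_mono[of u v] by simp linarith

lemma sawtooth_sum_trivial:
  assumes "u \<le> v"
  shows "\<bar>\<Sum>n\<in>{\<lfloor>u\<rfloor><..\<lfloor>v\<rfloor>}. sawtooth (f (of_int n))\<bar> \<le> (v - u + 1) / 2"
proof -
  have "\<bar>\<Sum>n\<in>{\<lfloor>u\<rfloor><..\<lfloor>v\<rfloor>}. sawtooth (f (of_int n))\<bar> \<le> (\<Sum>n\<in>{\<lfloor>u\<rfloor><..\<lfloor>v\<rfloor>}. 1 / 2)"
    by (rule order_trans[OF sum_abs sum_mono]) (rule abs_sawtooth_le)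
  also have "\<dots> \<le> (v - u + 1) / 2" using card_floor_interval_le[OF assms] by simp
  finally show ?thesis .
qed

lemma C2_on_with_subset: "C2_on_with S f f' f'' \<Longrightarrow> T \<subseteq> S \<Longrightarrow> C2_on_with T f f' f''"
  unfolding C2_on_with_def by (blast intro: DERIV_subset continuous_on_subset)

lemma C2_on_with_interior:
  assumes "C2_on_with {u..v} f f' f''" "u < x" "x < v"
  shows "(f has_real_derivative f' x) (at x)" "(f' has_real_derivative f'' x) (at x)"
  using assms unfolding C2_on_with_def by (simp_all add: at_within_Icc_at[symmetric])

lemma C2_on_with_continuous:
  assumes "C2_on_with S f f' f''"
  shows "continuous_on S f" "continuous_on S f'" "continuous_on S f''"
  using assms unfolding C2_on_with_def
  by (auto intro: DERIV_continuous_on)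

lemma C2_on_with_integral:
  assumes "C2_on_with {u..v} f f' f''" "u \<le> v"
  shows "(f'' has_integral (f' v - f' u)) {u..v}"
  by (rule fundamental_theorem_of_calculus)
    (use assms in \<open>auto simp: C2_on_with_def has_real_derivative_iff_has_vector_derivative[symmetric]\<close>)

lemma MVT_open:
  fixes f f' :: "real \<Rightarrow> real"
  assumes "a < b" "continuous_on {a..b} f"
    and der: "\<And>x. a < x \<Longrightarrow> x < b \<Longrightarrow> (f has_real_derivative f' x) (at x)"
  obtains z where "a < z" "z < b" "f b - f a = (b - a) * f' z"
proof -
  obtain l z where "a < z" "z < b" "(f has_real_derivative l) (at z)" "f b - f a = (b - a) * l"
    using MVT[OF assms(1,2)] der real_differentiable_def by blast
  with der[of z] that[of z] show thesis by (metis DERIV_unique)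
qed

text \<open>By the mean value theorem the first differences of \<open>f\<close> at consecutive
  integers are values of \<open>f'\<close>, hence lie between \<open>f' u\<close> and
  \<open>f' v\<close>, and the second differences are values of \<open>f''\<close>, hence are at
  least \<open>\<mu>\<close>. These are the hypotheses of the discrete estimate.\<close>

lemma exponential_sum_second_derivative:
  assumes uv: "u \<le> v" and C2: "C2_on_with {u..v} f f' f''"
    and \<mu>: "0 < \<mu>" and ge: "\<And>x. x \<in> {u..v} \<Longrightarrow> \<mu> \<le> f'' x"
  shows "norm (\<Sum>n\<in>{\<lfloor>u\<rfloor><..\<lfloor>v\<rfloor>}. cis (2 * pi * f (of_int n))) \<le> 5 * (f' v - f' u + 2) / sqrt \<mu> + 2"
proof -
  define K where "K = nat (\<lfloor>v\<rfloor> - \<lfloor>u\<rfloor>)"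
  define y where "y = (\<lambda>k::nat. real_of_int (\<lfloor>u\<rfloor> + 1 + int k))"
  define x where "x = (\<lambda>k. f (y k))"
  have f'_mono: "f' s \<le> f' t" if "u \<le> s" "s \<le> t" "t \<le> v" for s t
  proof -
    have "C2_on_with {s..t} f f' f''" using C2_on_with_subset[OF C2] that by auto
    from C2_on_with_integral[OF this \<open>s \<le> t\<close>] show ?thesis
      using has_integral_nonneg[of f'' "f' t - f' s" "{s..t}"] ge \<mu> that by (smt (verit) atLeastAtMost_iff)
  qed
  have B0: "0 \<le> 5 * (f' v - f' u + 2) / sqrt \<mu>" using f'_mono[of u v] uv \<mu> by simp
  have sum_eq: "(\<Sum>n\<in>{\<lfloor>u\<rfloor><..\<lfloor>v\<rfloor>}. cis (2 * pi * f (of_int n))) = (\<Sum>k<K. cis (2 * pi * x k))"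
    by (rule sum.reindex_bij_witness[where i = "\<lambda>k. \<lfloor>u\<rfloor> + 1 + int k" and j = "\<lambda>n. nat (n - \<lfloor>u\<rfloor> - 1)"])
      (auto simp: K_def x_def y_def)
  show ?thesis
  proof (cases "K \<ge> 2")
    case False
    have "norm (\<Sum>k<K. cis (2 * pi * x k)) \<le> real K"
      using sum_cis_bound_card[of "{..<K}"] by simp
    then show ?thesis using False B0 unfolding sum_eq by simp
  next
    case True
    then obtain J where J: "K = Suc J" "J \<ge> 1" by (cases K) auto
    define d where "d = (\<lambda>k. x (Suc k) - x k)"
    have y: "u < y k" "y k \<le> v" "y (Suc k) = y k + 1" if "k < K" for k
      using that unfolding K_def y_def by (simp_all add: zless_nat_eq_int_zless) linarith+
    have yS: "y (Suc k) \<le> v" if "k < J" for k using y(2)[of "Suc k"] that J by simp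
    have contf: "continuous_on {s..t} f" if "u \<le> s" "t \<le> v" for s t
      using that by (intro continuous_on_subset[OF C2_on_with_continuous(1)[OF C2]]) auto
    have d_slope: "f' u \<le> d k \<and> d k \<le> f' v" if k: "k < J" for k
    proof -
      have k': "k < K" using k J by simp
      have lt: "y k < y k + 1" by simp
      obtain z where z: "y k < z" "z < y k + 1" "f (y k + 1) - f (y k) = (y k + 1 - y k) * f' z"
        by (rule MVT_open[OF lt contf, of f'])
          (use y[OF k'] yS[OF k] in \<open>auto intro: C2_on_with_interior(1)[OF C2]\<close>)
      then have "d k = f' z" unfolding d_def x_def y(3)[OF k'] by simp
      then show ?thesis using f'_mono[of u z] f'_mono[of z v] z y[OF k'] yS[OF k] by simp
    qed
    \<comment> \<open>The mean value theorem is used twice: on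
      \<open>t \<mapsto> f (t + 1) - f t\<close>, which turns the second difference into
      \<open>f' (z + 1) - f' z\<close>, and then on \<open>f'\<close>.\<close>
    have d_step: "d k + \<mu> \<le> d (Suc k)" if k: "Suc k < J" for k
    proof -
      have k': "k < K" "Suc k < K" using k J by simp_all
      have y2: "y k + 2 \<le> v" using yS[OF k] y(3)[OF k'(1)] y(3)[OF k'(2)] by simp
      have uy: "u < y k" using y(1)[OF k'(1)] .
      have lt: "y k < y k + 1" by simp
      obtain z where z: "y k < z" "z < y k + 1"
        "(f (y k + 1 + 1) - f (y k + 1)) - (f (y k + 1) - f (y k)) = (y k + 1 - y k) * (f' (z + 1) - f' z)"
      proof (rule MVT_open[OF lt, of "\<lambda>t. f (t + 1) - f t" "\<lambda>t. f' (t + 1) - f' t"])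
        show "continuous_on {y k..y k + 1} (\<lambda>t. f (t + 1) - f t)"
          using uy y2 by (intro continuous_on_diff contf continuous_on_compose2[OF contf[of "y k + 1" "y k + 2"]] continuous_intros) auto
        show "((\<lambda>t. f (t + 1) - f t) has_real_derivative f' (t + 1) - f' t) (at t)" if "y k < t" "t < y k + 1" for t
          using that uy y2 by (intro DERIV_diff DERIV_shift[THEN iffD1] C2_on_with_interior(1)[OF C2]) auto
      qed auto
      have "continuous_on {z..z + 1} f'"
        using z uy y2 by (intro continuous_on_subset[OF C2_on_with_continuous(2)[OF C2]]) auto
      then obtain w where w: "z < w" "w < z + 1" "f' (z + 1) - f' z = (z + 1 - z) * f'' w"
        by (rule MVT_open[of z "z + 1" f' f'', rotated])
          (use z uy y2 in \<open>auto intro: C2_on_with_interior(2)[OF C2]\<close>)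
      have "\<mu> \<le> f'' w" using ge[of w] w z uy y2 by simp
      then show ?thesis using z w y(3)[OF k'(1)] y(3)[OF k'(2)] by (simp add: d_def x_def)
    qed
    have "norm (\<Sum>k<J. cis (2 * pi * x k)) \<le> 5 * ((f' v - f' u) + 2) / sqrt \<mu> + 1"
    proof (rule van_der_corput_second_difference[OF \<mu> J(2), of x d])
      show "d (J - 1) - d 0 \<le> f' v - f' u" using d_slope[of "J - 1"] d_slope[of 0] J by auto
    qed (use d_step in \<open>auto simp: d_def\<close>)
    \<comment> \<open>\<open>K\<close> points have only \<open>J = K - 1\<close> differences; the
      last point is estimated by 1, whence the 2 in the conclusion.\<close>
    moreover have "norm (\<Sum>k<K. cis (2 * pi * x k)) \<le> norm (\<Sum>k<J. cis (2 * pi * x k)) + 1"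
      using norm_triangle_ineq[of "\<Sum>k<J. cis (2 * pi * x k)" "cis (2 * pi * x J)"] unfolding J by simp
    ultimately show ?thesis unfolding sum_eq by simp
  qed
qed

text \<open>The choice \<open>H = \<lceil>1 / (12 * \<omega>)\<rceil>\<close> balances \<open>1 / H\<close> against \<open>sqrt (H * \<omega> ^ 3)\<close>.\<close>

lemma sawtooth_sum_level:
  assumes uv: "u \<le> v" and C2: "C2_on_with {u..v} f f' f''"
    and \<omega>: "0 < \<omega>" "\<omega> \<le> 1 / 12"
    and range: "\<And>x. x \<in> {u..v} \<Longrightarrow> \<omega> ^ 3 \<le> f'' x \<and> f'' x \<le> (5 / 4 * \<omega>) ^ 3"
  shows "\<bar>\<Sum>n\<in>{\<lfloor>u\<rfloor><..\<lfloor>v\<rfloor>}. sawtooth (f (of_int n))\<bar>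
     \<le> 6 * integral {u..v} (\<lambda>x. f'' x powr (1/3)) + 12 / sqrt (\<omega> ^ 3)"
proof -
  define H where "H = nat \<lceil>1 / (12 * \<omega>)\<rceil>"
  define I where "I = f' v - f' u"
  define A where "A = 1 / sqrt (\<omega> ^ 3)"
  have one: "1 \<le> 1 / (12 * \<omega>)" using \<omega> by simp
  have Hpos: "0 < 1 / (12 * \<omega>)" using \<omega> by simp
  have H1: "H \<ge> 1" unfolding H_def using one by linarith
  have H2: "1 / (12 * \<omega>) \<le> real H" unfolding H_def by linarith
  have H3: "real H \<le> 1 / (6 * \<omega>)"
  proof -
    have "real H \<le> 1 / (12 * \<omega>) + 1" unfolding H_def using Hpos by linarith
    also have "\<dots> \<le> 1 / (12 * \<omega>) + 1 / (12 * \<omega>)" using one by simp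
    finally show ?thesis by simp
  qed
  have \<omega>3: "0 < \<omega> ^ 3" using \<omega> by simp
  have A: "A > 0" using \<omega> by (simp add: A_def)
  have I: "(f'' has_integral I) {u..v}" unfolding I_def by (rule C2_on_with_integral[OF C2 uv])
  have I0: "0 \<le> I" using range \<omega>3 by (intro has_integral_nonneg[OF I]) (meson less_imp_le less_le_trans)
  \<comment> \<open>The estimate for \<open>h * f\<close> with lower bound
    \<open>h * \<omega>^3\<close> has exactly the shape \<open>P * sqrt h + Q / sqrt h\<close>: its
    main term splits according to \<open>h * I + 2\<close>, and the additive 2 is at most
    \<open>2 * sqrt h\<close>.\<close>
  have E: "norm (\<Sum>n\<in>{\<lfloor>u\<rfloor><..\<lfloor>v\<rfloor>}. cis (2 * pi * real h * f (of_int n)))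
      \<le> (2 + 5 * I * A) * sqrt (real h) + (10 * A) / sqrt (real h)" if h: "h \<ge> 1" for h
  proof -
    have "C2_on_with {u..v} (\<lambda>x. real h * f x) (\<lambda>x. real h * f' x) (\<lambda>x. real h * f'' x)"
      using C2 unfolding C2_on_with_def by (auto intro!: DERIV_cmult continuous_intros)
    from exponential_sum_second_derivative[OF uv this, of "real h * \<omega> ^ 3"]
    have "norm (\<Sum>n\<in>{\<lfloor>u\<rfloor><..\<lfloor>v\<rfloor>}. cis (2 * pi * (real h * f (of_int n))))
       \<le> 5 * (real h * f' v - real h * f' u + 2) / sqrt (real h * \<omega> ^ 3) + 2"
      using range h \<omega>3 by (auto intro: mult_left_mono)
    also have "5 * (real h * f' v - real h * f' u + 2) / sqrt (real h * \<omega> ^ 3)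
       = 5 * I * A * (real h / sqrt (real h)) + (10 * A) / sqrt (real h)"
      using h \<omega>3 by (simp add: real_sqrt_mult A_def I_def field_simps)
    also have "real h / sqrt (real h) = sqrt (real h)" by (simp only: real_div_sqrt of_nat_0_le_iff)
    also have "5 * I * A * sqrt (real h) + 10 * A / sqrt (real h) + 2
       \<le> (2 + 5 * I * A) * sqrt (real h) + (10 * A) / sqrt (real h)"
      using h by (simp add: algebra_simps)
    finally show ?thesis by (simp add: mult.assoc)
  qed
  have "\<bar>\<Sum>n\<in>{\<lfloor>u\<rfloor><..\<lfloor>v\<rfloor>}. sawtooth (f (of_int n))\<bar>
    \<le> real (card {\<lfloor>u\<rfloor><..\<lfloor>v\<rfloor>}) / (2 * pi * real H) + (4 / pi) * sqrt (real H) * (2 + 5 * I * A) + (3 / pi) * (10 * A)"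
    by (rule sawtooth_sum_le_exponential_sums[OF H1 _ _ E]) (use I0 A in auto)
  \<comment> \<open>The first bracket uses \<open>H \<ge> 1 / (12 * \<omega>)\<close> and
    \<open>H \<ge> 1\<close>. The second uses \<open>H \<le> 1 / (6 * \<omega>)\<close>: since
    \<open>sqrt 6 \<ge> 2.44\<close>, the factor \<open>(4 / pi) * sqrt H\<close> is at most
    \<open>14/25\<close> over \<open>sqrt \<omega>\<close>, and \<open>14/5\<close> is 5 times
    that.\<close>
  also have "\<dots> \<le> (2 * \<omega> * (v - u) + 1/6) + (A / 6 + 14/5 * (I / \<omega>\<^sup>2)) + 10 * A"
  proof (intro add_mono)
    have "real (card {\<lfloor>u\<rfloor><..\<lfloor>v\<rfloor>}) / (2 * pi * real H) \<le> (v - u + 1) / (2 * pi * real H)"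
      by (intro divide_right_mono card_floor_interval_le uv) auto
    also have "\<dots> = (v - u) * (1 / (2 * pi * real H)) + 1 / (2 * pi * real H)" by (simp add: add_divide_distrib)
    also have "\<dots> \<le> (v - u) * (2 * \<omega>) + 1 / 6"
    proof (intro add_mono mult_left_mono)
      have "1 / (2 * pi * real H) \<le> 1 / (2 * 3 * (1 / (12 * \<omega>)))"
        using H2 Hpos H1 pi_gt3 \<omega> by (intro divide_left_mono mult_mono) auto
      then show "1 / (2 * pi * real H) \<le> 2 * \<omega>" using \<omega> by simp
      have "1 / (2 * pi * real H) \<le> 1 / (2 * 3 * 1)"
        using H1 pi_gt3 by (intro divide_left_mono mult_mono) auto
      then show "1 / (2 * pi * real H) \<le> 1 / 6" by simp
    qed (use uv in simp)
    finally show "real (card {\<lfloor>u\<rfloor><..\<lfloor>v\<rfloor>}) / (2 * pi * real H) \<le> 2 * \<omega> * (v - u) + 1/6" by (simp add: algebra_simps)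
    have sqrt6: "244 / 100 \<le> sqrt 6" by (rule real_le_rsqrt) (simp add: power2_eq_square)
    have s\<omega>: "sqrt (\<omega> ^ 3) = \<omega> * sqrt \<omega>" using \<omega> by (simp add: power3_eq_cube real_sqrt_mult)
    have "(4 / pi) * sqrt (real H) \<le> (4 / 3) * (1 / (sqrt 6 * sqrt \<omega>))"
    proof (intro mult_mono)
      have "sqrt (real H) \<le> sqrt (1 / (6 * \<omega>))" using H3 by simp
      then show "sqrt (real H) \<le> 1 / (sqrt 6 * sqrt \<omega>)" by (simp add: real_sqrt_divide real_sqrt_mult)
      show "4 / pi \<le> 4 / 3" using pi_gt3 by (intro divide_left_mono) auto
    qed auto
    also have "\<dots> \<le> (4 / 3) * (1 / ((244 / 100) * sqrt \<omega>))"
      using sqrt6 \<omega> by (intro mult_left_mono divide_left_mono mult_right_mono) auto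
    also have "\<dots> \<le> 14 / 25 * (1 / sqrt \<omega>)" using \<omega> by (simp add: divide_simps)
    finally have c: "(4 / pi) * sqrt (real H) \<le> 14 / 25 * (1 / sqrt \<omega>)" .
    have "(4 / pi) * sqrt (real H) * (2 + 5 * I * A) \<le> 14 / 25 * (1 / sqrt \<omega>) * (2 + 5 * I * A)"
      using I0 A by (intro mult_right_mono c) auto
    also have "\<dots> = 28 / 25 * (1 / sqrt \<omega>) + 14 / 5 * (I * (A / sqrt \<omega>))" by (simp add: distrib_left add_divide_distrib)
    also have "A / sqrt \<omega> = 1 / \<omega>\<^sup>2" using \<omega> unfolding A_def s\<omega> by (simp add: power2_eq_square)
    also have "28 / 25 * (1 / sqrt \<omega>) = 28 / 25 * (\<omega> * A)" using \<omega> by (simp add: A_def s\<omega>)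
    also have "\<dots> \<le> A / 6"
    proof -
      have "\<omega> * A \<le> 1 / 12 * A" using \<omega> A by (intro mult_right_mono) auto
      then show ?thesis using A by simp
    qed
    finally show "(4 / pi) * sqrt (real H) * (2 + 5 * I * A) \<le> A / 6 + 14/5 * (I / \<omega>\<^sup>2)" by simp
    have "3 / pi \<le> 1" using pi_gt3 by simp
    then show "(3 / pi) * (10 * A) \<le> 10 * A" using A mult_right_mono[of "3 / pi" 1 "10 * A"] by simp
  qed
  also have "\<dots> \<le> (2 * \<omega> * (v - u) + 14/5 * (I / \<omega>\<^sup>2)) + 12 * A"
  proof -
    have "\<omega> ^ 3 \<le> 1 ^ 3" using \<omega> by (intro power_mono) auto
    then have "1 \<le> A" using \<omega> by (simp add: A_def)
    then show ?thesis by simp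
  qed
  also have "2 * \<omega> * (v - u) + 14/5 * (I / \<omega>\<^sup>2) \<le> integral {u..v} (\<lambda>x. 6 * f'' x powr (1/3))"
  proof (rule has_integral_le)
    show "((\<lambda>x. 2 * \<omega> + 14/5 * (f'' x / \<omega>\<^sup>2)) has_integral (2 * \<omega> * (v - u) + 14/5 * (I / \<omega>\<^sup>2))) {u..v}"
      using has_integral_add[OF has_integral_const_real[of "2 * \<omega>" u v] has_integral_mult_right[OF has_integral_divide[OF I, of "\<omega>\<^sup>2"], of "14/5"]] uv
      by (simp add: mult.commute)
    have "continuous_on {u..v} (\<lambda>x. 6 * f'' x powr (1/3))"
      using range \<omega>3 C2_on_with_continuous(3)[OF C2] by (intro continuous_intros) force+
    then show "((\<lambda>x. 6 * f'' x powr (1/3)) has_integral integral {u..v} (\<lambda>x. 6 * f'' x powr (1/3))) {u..v}"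
      by (intro integrable_integral integrable_continuous_real)
    show "2 * \<omega> + 14/5 * (f'' x / \<omega>\<^sup>2) \<le> 6 * f'' x powr (1/3)" if x: "x \<in> {u..v}" for x
    proof -
      have pos: "0 < f'' x" using range[OF x] \<omega>3 by linarith
      \<comment> \<open>Dividing by \<open>\<omega>\<close> normalises the level to
        \<open>1 \<le> s \<le> 5/4\<close>, and the pointwise claim becomes
        \<open>2 + 14/5 * s^3 \<le> 6 * s\<close>.\<close>
      define s where "s = f'' x powr (1/3) / \<omega>"
      have s3: "f'' x = (s * \<omega>) ^ 3" using pos \<omega> by (simp add: s_def powr_power)
      have s0: "0 < s" using pos \<omega> by (simp add: s_def)
      have "1 * \<omega> \<le> s * \<omega>" "s * \<omega> \<le> 5 / 4 * \<omega>"
        using range[OF x] s0 \<omega> unfolding s3 by (auto intro: power_le_imp_le_base[of _ 2])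
      then have s: "1 \<le> s" "s \<le> 5/4" using \<omega> by (simp_all only: mult_le_cancel_right_pos)
      \<comment> \<open>This says that the cube lies below its chord over the interval from 1 to
        5/4, so only the ends matter. At \<open>s = 5/4\<close> the sides are 7.46875 and 7.5, which
        leaves hardly any room for a larger level ratio.\<close>
      have "0 \<le> (s - 1) * (5/4 - s) * (s + 9/4)" using s by (intro mult_nonneg_nonneg) auto
      also have "(s - 1) * (5/4 - s) * (s + 9/4) = 61/16 * s - 45/16 - s ^ 3"
        by (simp add: field_simps power3_eq_cube)
      finally have "2 + 14/5 * s ^ 3 \<le> 6 * s" using s by linarith
      then have "\<omega> * (2 + 14/5 * s ^ 3) \<le> \<omega> * (6 * s)" using \<omega> by (intro mult_left_mono) auto
      moreover have "f'' x / \<omega>\<^sup>2 = \<omega> * s ^ 3" using \<omega> unfolding s3 by (simp add: power_mult_distrib power2_eq_square power3_eq_cube)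
      moreover have "f'' x powr (1/3) = \<omega> * s" using \<omega> by (simp add: s_def)
      ultimately show ?thesis by (simp add: algebra_simps)
    qed
  qed
  finally show ?thesis by (simp add: A_def)
qed

text \<open>Induction on the number of factors 5/4 that lift \<open>\<omega>\<close> to 1/12. By
  monotonicity the points with \<open>f'' x \<le> (5/4 * \<omega>)^3\<close> form an end piece of
  the interval, cut off at a point supplied by the intermediate value theorem. That piece costs
  \<open>12 / sqrt (\<omega>^3)\<close> and the rest, by induction, at most
  \<open>38 / sqrt (\<omega>^3)\<close>. The additive 1/2 arises only in the trivial estimate at the
  top level, so it does not accumulate.\<close>

lemma sawtooth_sum_monotone:
  assumes "u \<le> v" "C2_on_with {u..v} f f' f''" "monotonic_on {u..v} f''"
    and "0 < \<omega>" "\<And>x. x \<in> {u..v} \<Longrightarrow> \<omega> ^ 3 \<le> f'' x"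
  shows "\<bar>\<Sum>n\<in>{\<lfloor>u\<rfloor><..\<lfloor>v\<rfloor>}. sawtooth (f (of_int n))\<bar>
     \<le> 6 * integral {u..v} (\<lambda>x. f'' x powr (1/3)) + 50 / sqrt (\<omega> ^ 3) + 1 / 2"
proof -
  define B where "B = (\<lambda>(u::real) v::real. 6 * integral {u..v} (\<lambda>x. f'' x powr (1/3)))"
  define Z where "Z = (\<lambda>(u::real) v::real. \<Sum>n\<in>{\<lfloor>u\<rfloor><..\<lfloor>v\<rfloor>}. sawtooth (f (of_int n)))"
  have cont: "continuous_on {u..v} (\<lambda>x. f'' x powr (1/3))" and pos: "\<And>x. x \<in> {u..v} \<Longrightarrow> 0 < f'' x"
    if "C2_on_with {u..v} f f' f''" "0 < \<omega>" "\<And>x. x \<in> {u..v} \<Longrightarrow> \<omega> ^ 3 \<le> f'' x" for u v \<omega>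
  proof -
    show pos: "0 < f'' x" if "x \<in> {u..v}" for x
      using \<open>\<And>x. x \<in> {u..v} \<Longrightarrow> \<omega> ^ 3 \<le> f'' x\<close>[OF that] \<open>0 < \<omega>\<close> by (smt (verit) zero_less_power)
    show "continuous_on {u..v} (\<lambda>x. f'' x powr (1/3))"
      using C2_on_with_continuous(3)[OF that(1)] pos by (intro continuous_intros) force+
  qed
  have split: "B u v = B u w + B w v"
    if "C2_on_with {u..v} f f' f''" "0 < \<omega>" "\<And>x. x \<in> {u..v} \<Longrightarrow> \<omega> ^ 3 \<le> f'' x" "u \<le> w" "w \<le> v" for u v w \<omega>
    using Henstock_Kurzweil_Integration.integral_combine[OF that(4,5) integrable_continuous_real[OF cont[OF that(1-3)]]]
    by (simp add: B_def)
  have trivial: "\<bar>Z u v\<bar> \<le> B u v + 1 / 2"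
    if uv: "u \<le> v" and C2: "C2_on_with {u..v} f f' f''" and \<omega>: "1 / 12 \<le> \<omega>"
      and ge: "\<And>x. x \<in> {u..v} \<Longrightarrow> \<omega> ^ 3 \<le> f'' x" for u v \<omega>
  proof -
    have "((\<lambda>x. 1 / 12) has_integral (1 / 12 * (v - u))) {u..v}"
      using has_integral_const_real[of "1 / 12 :: real" u v] uv by (simp add: mult.commute)
    moreover have "((\<lambda>x. f'' x powr (1/3)) has_integral integral {u..v} (\<lambda>x. f'' x powr (1/3))) {u..v}"
      by (rule integrable_integral[OF integrable_continuous_real[OF cont[OF C2 _ ge]]]) (use \<omega> in auto)
    ultimately have "1 / 12 * (v - u) \<le> integral {u..v} (\<lambda>x. f'' x powr (1/3))"
    proof (rule has_integral_le)
      show "1 / 12 \<le> f'' x powr (1/3)" if "x \<in> {u..v}" for x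
      proof -
        have "(\<omega> ^ 3) powr (1/3) \<le> f'' x powr (1/3)" using ge[OF that] \<omega> by (intro powr_mono2) auto
        moreover have "(\<omega> ^ 3) powr (1/3) = \<omega>" using powr_powr[of \<omega> 3 "1/3"] \<omega> by simp
        ultimately show ?thesis using \<omega> by simp
      qed
    qed
    then show ?thesis using sawtooth_sum_trivial[OF uv, of f] by (simp add: B_def Z_def)
  qed
  \<comment> \<open>Raising the level by 5/4 shrinks the error term from 50 to at most 38, which
    leaves room for the 12 of the current level. It suffices that the square of 50/38 is below the
    cube of 5/4.\<close>
  have sqrt_54: "50 / sqrt ((5/4 * \<omega>) ^ 3) \<le> 38 / sqrt (\<omega> ^ 3)" if "0 < \<omega>" for \<omega> :: real
  proof -
    have "(50/38)\<^sup>2 * \<omega> ^ 3 \<le> (5/4 * \<omega>) ^ 3"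
      using that by (simp add: power_mult_distrib power2_eq_square power3_eq_cube)
    then have "sqrt ((50/38)\<^sup>2 * \<omega> ^ 3) \<le> sqrt ((5/4 * \<omega>) ^ 3)" by simp
    then have "50/38 * sqrt (\<omega> ^ 3) \<le> sqrt ((5/4 * \<omega>) ^ 3)" by (simp add: real_sqrt_mult)
    then have "50 / sqrt ((5/4 * \<omega>) ^ 3) \<le> 50 / (50/38 * sqrt (\<omega> ^ 3))"
      using that by (intro divide_left_mono) auto
    then show ?thesis by simp
  qed
  have main: "\<bar>Z u v\<bar> \<le> B u v + 50 / sqrt (\<omega> ^ 3) + 1 / 2"
    if "u \<le> v" "C2_on_with {u..v} f f' f''" "monotonic_on {u..v} f''" "0 < \<omega>"
      "\<And>x. x \<in> {u..v} \<Longrightarrow> \<omega> ^ 3 \<le> f'' x" "1 / 12 \<le> \<omega> * (5/4) ^ j" for u v \<omega> and j :: nat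
    using that
  proof (induction j arbitrary: u v \<omega>)
    case 0
    have "0 \<le> 50 / sqrt (\<omega> ^ 3)" using 0 by simp
    moreover have "\<bar>Z u v\<bar> \<le> B u v + 1 / 2" using 0 by (intro trivial[of u v \<omega>]) auto
    ultimately show ?case by linarith
  next
    case (Suc j)
    note uv = Suc.prems(1) and C2 = Suc.prems(2) and mono = Suc.prems(3) and \<omega> = Suc.prems(4) and ge = Suc.prems(5)
    define T where "T = (5/4 * \<omega>) ^ 3"
    have A0: "0 \<le> 50 / sqrt (\<omega> ^ 3)" "0 \<le> 38 / sqrt (\<omega> ^ 3)" using \<omega> by simp_all
    have high: "\<bar>Z s t\<bar> \<le> B s t + 38 / sqrt (\<omega> ^ 3) + 1 / 2"
      if st: "u \<le> s" "s \<le> t" "t \<le> v" and geT: "\<And>x. x \<in> {s..t} \<Longrightarrow> T \<le> f'' x" for s t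
    proof -
      have "monotonic_on {s..t} f''"
        using mono st unfolding monotonic_on_def by (auto simp: monotone_on_def)
      moreover have "C2_on_with {s..t} f f' f''" using st by (intro C2_on_with_subset[OF C2]) auto
      ultimately have "\<bar>Z s t\<bar> \<le> B s t + 50 / sqrt ((5/4 * \<omega>) ^ 3) + 1 / 2"
        using st \<omega> Suc.prems(6) geT unfolding T_def by (intro Suc.IH) auto
      then show ?thesis using sqrt_54[OF \<omega>] by linarith
    qed
    have low: "\<bar>Z s t\<bar> \<le> B s t + 12 / sqrt (\<omega> ^ 3)"
      if st: "u \<le> s" "s \<le> t" "t \<le> v" and "\<omega> \<le> 1 / 12" and leT: "\<And>x. x \<in> {s..t} \<Longrightarrow> f'' x \<le> T" for s t
      unfolding Z_def B_def
      by (rule sawtooth_sum_level[OF st(2) C2_on_with_subset[OF C2]]) (use that \<omega> ge in \<open>auto simp: T_def\<close>)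
    show ?case
    proof (cases "1 / 12 \<le> \<omega>")
      case True
      then show ?thesis using trivial[OF uv C2 True ge] A0 by linarith
    next
      case False
      then have \<omega>': "\<omega> \<le> 1 / 12" by simp
      have glue: ?thesis if w: "u \<le> w" "w \<le> v" "\<bar>Z u w\<bar> + \<bar>Z w v\<bar> \<le> B u w + B w v + 50 / sqrt (\<omega> ^ 3) + 1 / 2" for w
      proof -
        have "Z u v = Z u w + Z w v" unfolding Z_def by (rule floor_interval_split[OF w(1,2)])
        moreover have "B u v = B u w + B w v" by (rule split[OF C2 \<omega> ge w(1,2)])
        ultimately show ?thesis using w(3) by linarith
      qed
      have contf: "continuous_on {u..v} f''" by (rule C2_on_with_continuous(3)[OF C2])
      consider "\<forall>x\<in>{u..v}. f'' x \<le> T" | "\<forall>x\<in>{u..v}. T \<le> f'' x"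
        | "mono_on {u..v} f''" "f'' u \<le> T" "T \<le> f'' v" | "antimono_on {u..v} f''" "T \<le> f'' u" "f'' v \<le> T"
      proof (cases "mono_on {u..v} f''")
        case True
        then have "f'' u \<le> f'' x" "f'' x \<le> f'' v" if "x \<in> {u..v}" for x using that by (auto simp: monotone_on_def)
        then show ?thesis using that True by (meson linear order_trans)
      next
        case False
        then have anti: "antimono_on {u..v} f''" using mono by (simp add: monotonic_on_def)
        then have "f'' u \<ge> f'' x" "f'' x \<ge> f'' v" if "x \<in> {u..v}" for x using that by (auto simp: monotone_on_def)
        then show ?thesis using that anti by (meson linear order_trans)
      qed
      then show ?thesis
      proof cases
        case 1
        then have "\<bar>Z u v\<bar> \<le> B u v + 12 / sqrt (\<omega> ^ 3)" using uv \<omega>' by (intro low) auto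
        also have "\<dots> \<le> B u v + 50 / sqrt (\<omega> ^ 3) + 1 / 2" using \<omega> by (simp add: divide_right_mono add_increasing2)
        finally show ?thesis .
      next
        case 2
        then have "\<bar>Z u v\<bar> \<le> B u v + 38 / sqrt (\<omega> ^ 3) + 1 / 2" using uv by (intro high) auto
        also have "\<dots> \<le> B u v + 50 / sqrt (\<omega> ^ 3) + 1 / 2" using \<omega> by (simp add: divide_right_mono)
        finally show ?thesis .
      next
        case 3
        obtain w where w: "u \<le> w" "w \<le> v" "f'' w = T" using IVT'[OF 3(2,3) uv contf] by blast
        have "\<bar>Z u w\<bar> \<le> B u w + 12 / sqrt (\<omega> ^ 3)"
          using 3(1) w by (intro low \<omega>') (auto simp: monotone_on_def)
        moreover have "\<bar>Z w v\<bar> \<le> B w v + 38 / sqrt (\<omega> ^ 3) + 1 / 2"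
          using 3(1) w by (intro high) (auto simp: monotone_on_def)
        ultimately show ?thesis by (intro glue[OF w(1,2)]) simp
      next
        case 4
        obtain w where w: "u \<le> w" "w \<le> v" "f'' w = T" using IVT2'[OF 4(3,2) uv contf] by blast
        have "\<bar>Z w v\<bar> \<le> B w v + 12 / sqrt (\<omega> ^ 3)"
          using 4(1) w by (intro low \<omega>') (auto simp: monotone_on_def)
        moreover have "\<bar>Z u w\<bar> \<le> B u w + 38 / sqrt (\<omega> ^ 3) + 1 / 2"
          using 4(1) w by (intro high) (auto simp: monotone_on_def)
        ultimately show ?thesis by (intro glue[OF w(1,2)]) simp
      qed
    qed
  qed
  obtain j :: nat where "1 / 12 / \<omega> < (5/4) ^ j" using real_arch_pow[of "5/4" "1 / 12 / \<omega>"] by auto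
  then have "1 / 12 \<le> \<omega> * (5/4) ^ j" using assms(4) by (simp add: field_simps)
  from main[OF assms this] show ?thesis by (simp add: Z_def B_def)
qed

section \<open>From one monotone piece to the whole arc\<close>

text \<open>The partition gives monotonicity on open subintervals only, while the estimate above
  works on closed ones. Continuity carries the inequality to the right end with the left point fixed
  inside, and then to the left end.\<close>

lemma mono_on_closed_interval:
  fixes h :: "real \<Rightarrow> real"
  assumes cont: "continuous_on {p..q} h" and mono: "mono_on {p<..<q} h"
  shows "mono_on {p..q} h"
proof (rule mono_onI)
  fix x y assume xy: "x \<in> {p..q}" "y \<in> {p..q}" "x \<le> y"
  have right: "h t \<le> h y" if t: "p < t" "t < q" "y \<in> {t..q}" for t y
  proof (rule continuous_ge_on_closure[where S = "{t<..<q}" and f = h and x = y])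
    show "continuous_on (closure {t<..<q}) h" "y \<in> closure {t<..<q}"
      using t by (auto intro: continuous_on_subset[OF cont])
    show "h t \<le> h z" if "z \<in> {t<..<q}" for z
      using that t by (intro mono_onD[OF mono]) auto
  qed
  show "h x \<le> h y"
  proof (cases "x < y")
    case True
    show ?thesis
    proof (rule continuous_le_on_closure[where S = "{x<..<y}" and f = h and x = x])
      show "continuous_on (closure {x<..<y}) h" "x \<in> closure {x<..<y}"
        using xy True by (auto intro: continuous_on_subset[OF cont])
      show "h t \<le> h y" if "t \<in> {x<..<y}" for t using that xy by (intro right) auto
    qed
  qed (use xy in simp)
qed

lemma monotonic_on_closed_interval:
  fixes h :: "real \<Rightarrow> real"
  assumes "continuous_on {p..q} h" "monotonic_on {p<..<q} h"
  shows "monotonic_on {p..q} h"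
proof -
  have neg: "antimono_on S h \<longleftrightarrow> mono_on S (\<lambda>x. - h x)" for S by (simp add: monotone_on_def)
  have "continuous_on {p..q} (\<lambda>x. - h x)" using assms(1) by (rule continuous_on_minus)
  then show ?thesis
    using assms mono_on_closed_interval[of p q h] mono_on_closed_interval[of p q "\<lambda>x. - h x"]
    unfolding monotonic_on_def neg by blast
qed

text \<open>A monotone \<open>f''\<close> has its minimum at an end of the interval, so
  \<open>\<omega>^3\<close> may be taken as the smaller endpoint value. Adding the terms of both
  ends makes the bound independent of the direction of monotonicity.\<close>

lemma sawtooth_sum_monotone_endpoints:
  assumes uv: "u \<le> v" and C2: "C2_on_with {u..v} f f' f''" and mono: "monotonic_on {u<..<v} f''"
    and pos: "\<And>x. x \<in> {u..v} \<Longrightarrow> 0 < f'' x"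
  shows "\<bar>\<Sum>n\<in>{\<lfloor>u\<rfloor><..\<lfloor>v\<rfloor>}. sawtooth (f (of_int n))\<bar>
     \<le> 6 * integral {u..v} (\<lambda>x. f'' x powr (1/3)) + 50 * (1 / sqrt (f'' u) + 1 / sqrt (f'' v)) + 1 / 2"
proof -
  define c where "c = min (f'' u) (f'' v)"
  define \<omega> where "\<omega> = c powr (1/3)"
  have c: "0 < c" using pos uv by (simp add: c_def)
  have \<omega>: "0 < \<omega>" "\<omega> ^ 3 = c" using c by (simp_all add: \<omega>_def powr_power)
  have mono': "monotonic_on {u..v} f''"
    by (rule monotonic_on_closed_interval[OF C2_on_with_continuous(3)[OF C2] mono])
  have "c \<le> f'' x" if "x \<in> {u..v}" for x
    using mono' that unfolding monotonic_on_def monotone_on_def c_def by (auto simp: min_le_iff_disj)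
  then have "\<bar>\<Sum>n\<in>{\<lfloor>u\<rfloor><..\<lfloor>v\<rfloor>}. sawtooth (f (of_int n))\<bar>
     \<le> 6 * integral {u..v} (\<lambda>x. f'' x powr (1/3)) + 50 / sqrt (\<omega> ^ 3) + 1 / 2"
    by (intro sawtooth_sum_monotone[OF uv C2 mono' \<omega>(1)]) (simp add: \<omega>)
  moreover have "50 / sqrt (\<omega> ^ 3) \<le> 50 * (1 / sqrt (f'' u) + 1 / sqrt (f'' v))"
    unfolding \<omega>(2) using pos[of u] pos[of v] uv by (auto simp: c_def min_def)
  ultimately show ?thesis by linarith
qed

text \<open>The cube root of \<open>f''\<close> is at most \<open>1 + f''\<close>, and over
  \<open>{a..c k}\<close> the integral of \<open>f''\<close> is \<open>f' (c k) - f' a\<close>,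
  which is at most \<open>- f' a\<close> because \<open>f'\<close> is negative. So the integrals up
  to \<open>c k < b\<close> stay bounded and monotone convergence applies. Without integrability the
  integral in the final bound would be the default value 0.\<close>

lemma integrable_cube_root_second_derivative:
  assumes C2: "C2_on_with {a..<b} f f' f''"
    and sign: "\<And>x. x \<in> {a..<b} \<Longrightarrow> f' x < 0 \<and> f'' x > 0"
  shows "(\<lambda>x. f'' x powr (1/3)) integrable_on {a..<b}"
proof (cases "a < b")
  case True
  define h where "h = (\<lambda>x. f'' x powr (1/3))"
  define c where "c = (\<lambda>k::nat. b - (b - a) / real (Suc k))"
  have c: "a \<le> c k" "c k < b" for k
  proof -
    have "(b - a) / real (Suc k) \<le> (b - a) / 1" using True by (intro divide_left_mono) auto
    then show "a \<le> c k" by (simp add: c_def)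
    show "c k < b" using True by (simp add: c_def)
  qed
  have C2c: "C2_on_with {a..c k} f f' f''" for k
    using c[of k] by (intro C2_on_with_subset[OF C2]) auto
  have hcont: "continuous_on {a..c k} h" for k
    unfolding h_def using C2_on_with_continuous(3)[OF C2c] sign c[of k]
    by (intro continuous_intros) (auto simp: less_imp_neq[symmetric] dest: order_le_less_trans)
  have inter: "{..c k} \<inter> {a..<b} = {a..c k}" for k using c[of k] by auto
  have int: "(\<lambda>x. if x \<in> {..c k} then h x else 0) integrable_on {a..<b}" for k
    unfolding integrable_restrict_Int inter by (rule integrable_continuous_real[OF hcont])
  have val: "integral {a..<b} (\<lambda>x. if x \<in> {..c k} then h x else 0) = integral {a..c k} h" for k
    unfolding integral_restrict_Int inter ..
  have bound: "\<bar>integral {a..c k} h\<bar> \<le> (b - a) - f' a" for k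
  proof -
    have "integral {a..c k} h \<le> (c k - a) * 1 + (f' (c k) - f' a)"
    proof (rule has_integral_le[OF integrable_integral[OF integrable_continuous_real[OF hcont]]])
      show "((\<lambda>x. 1 + f'' x) has_integral (c k - a) * 1 + (f' (c k) - f' a)) {a..c k}"
        using has_integral_add[OF has_integral_const_real[of "1::real" a "c k"] C2_on_with_integral[OF C2c c(1)]] c[of k] by simp
      show "h x \<le> 1 + f'' x" if "x \<in> {a..c k}" for x
      proof -
        have pos: "f'' x > 0" using sign[of x] that c[of k] by auto
        show ?thesis
        proof (cases "f'' x \<le> 1")
          case True
          then have "h x \<le> 1 powr (1/3)" unfolding h_def using pos by (intro powr_mono2) auto
          then show ?thesis using pos by simp
        next
          case False
          then have "h x \<le> f'' x powr 1" unfolding h_def by (intro powr_mono) auto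
          then show ?thesis using pos by simp
        qed
      qed
    qed
    moreover have "0 \<le> integral {a..c k} h" by (rule integral_nonneg[OF integrable_continuous_real[OF hcont]]) (simp add: h_def)
    ultimately show ?thesis using sign[of "c k"] c[of k] by simp
  qed
  have "h integrable_on {a..<b} \<and> (\<lambda>k. integral {a..<b} (\<lambda>x. if x \<in> {..c k} then h x else 0)) \<longlonglongrightarrow> integral {a..<b} h"
  proof (rule monotone_convergence_increasing[OF int])
    show "(if x \<in> {..c k} then h x else 0) \<le> (if x \<in> {..c (Suc k)} then h x else 0)" for k x
    proof -
      have "c k \<le> c (Suc k)" using True unfolding c_def by (intro diff_left_mono divide_left_mono) auto
      then show ?thesis by (auto simp: h_def)
    qed
    show "(\<lambda>k. if x \<in> {..c k} then h x else 0) \<longlonglongrightarrow> h x" if x: "x \<in> {a..<b}" for x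
    proof (rule tendsto_eventually)
      have "(\<lambda>k. (b - a) / real (Suc k)) \<longlonglongrightarrow> 0"
        by (intro LIMSEQ_Suc lim_const_over_n)
      then have "(\<lambda>k. b - (b - a) / real (Suc k)) \<longlonglongrightarrow> b - 0" by (intro tendsto_diff tendsto_const)
      then have "\<forall>\<^sub>F k in sequentially. x < c k" unfolding c_def using x by (intro order_tendstoD(1)) auto
      then show "\<forall>\<^sub>F k in sequentially. (if x \<in> {..c k} then h x else 0) = h x" by eventually_elim auto
    qed
    show "bounded (range (\<lambda>k. integral {a..<b} (\<lambda>x. if x \<in> {..c k} then h x else 0)))"
      unfolding val bounded_iff using bound by (auto simp only: real_norm_def)
  qed
  then show ?thesis by (simp add: h_def)
next
  case False
  then have "{a..<b} = {}" by simp
  then show ?thesis by (simp only: integrable_on_empty)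
qed

lemma partition_of_less:
  assumes "partition_of a m l r" "i < j" "j \<le> m"
  shows "a i < a j"
  using assms(2,3)
proof (induction j)
  case (Suc j)
  then have "a j < a (Suc j)" using assms(1) by (simp add: partition_of_def)
  then show ?case using Suc by (cases "i = j") auto
qed simp

lemma partition_of_locate:
  assumes P: "partition_of a m l r" and c: "l \<le> c" "c < r"
  obtains k where "k < m" "a k \<le> c" "c < a (Suc k)"
proof -
  define k where "k = (LEAST k. c < a (Suc k))"
  have m: "c < a m" "a 0 \<le> c" using P c by (auto simp: partition_of_def)
  then obtain m' where m': "m = Suc m'" by (cases m) auto
  then have "c < a (Suc m')" using m by simp
  then have k: "c < a (Suc k)" "k \<le> m'" unfolding k_def by (auto intro: LeastI Least_le)
  have "a k \<le> c"
  proof (cases k)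
    case (Suc k')
    then have "\<not> c < a (Suc k')" using not_less_Least[of k' "\<lambda>k. c < a (Suc k)"] by (simp add: k_def)
    then show ?thesis using Suc by simp
  qed (use m in simp)
  then show thesis using that[of k] k m' by simp
qed

text \<open>The pieces are the full partition intervals before \<open>c = L - \<delta>\<close> and
  the part of the next one up to \<open>c\<close>, at most \<open>m\<close> in all, each costing
  1/2. A partition point is an end of at most two pieces, which turns 50 into 100; \<open>c\<close>
  is an end of only one. The sum beyond \<open>c\<close> is trivially at most
  \<open>(\<delta> + 1) / 2\<close>.\<close>

lemma sawtooth_sum_partition:
  assumes C2: "C2_on_with {\<alpha>..<L} f f' f''"
    and sign: "\<And>x. x \<in> {\<alpha>..<L} \<Longrightarrow> f' x < 0 \<and> f'' x > 0"
    and P: "partition_of a m \<alpha> L"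
    and mono: "\<And>i. i < m \<Longrightarrow> monotonic_on {a i<..<a (Suc i)} f''"
    and \<delta>: "0 < \<delta>" "\<delta> < L - \<alpha>"
  shows "\<bar>\<Sum>n\<in>{\<lfloor>\<alpha>\<rfloor><..\<lfloor>L\<rfloor>}. sawtooth (f (of_int n))\<bar>
     \<le> 6 * integral {\<alpha>..<L} (\<lambda>x. f'' x powr (1/3)) + 50 / sqrt (f'' (L - \<delta>))
       + 100 * (\<Sum>i<m. 1 / sqrt (f'' (a i))) + real m / 2 + (\<delta> + 1) / 2"
proof -
  define h where "h = (\<lambda>x. f'' x powr (1/3))"
  define Z where "Z = (\<lambda>(u::real) v::real. \<Sum>n\<in>{\<lfloor>u\<rfloor><..\<lfloor>v\<rfloor>}. sawtooth (f (of_int n)))"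
  define s where "s = (\<lambda>x. 1 / sqrt (f'' x))"
  define c where "c = L - \<delta>"
  have c: "\<alpha> \<le> c" "c < L" using \<delta> by (auto simp: c_def)
  have hint: "h integrable_on {\<alpha>..<L}" unfolding h_def by (rule integrable_cube_root_second_derivative[OF C2 sign])
  have hsub: "h integrable_on {p..q}" if "\<alpha> \<le> p" "q < L" for p q
    using that by (intro integrable_on_subinterval[OF hint]) auto
  have s0: "0 \<le> s x" if "\<alpha> \<le> x" "x < L" for x using sign[of x] that by (simp add: s_def)
  have a0: "a 0 = \<alpha>" "a m = L" using P by (auto simp: partition_of_def)
  have a_range: "\<alpha> \<le> a i \<and> a i < L" if "i < m" for i
    using partition_of_less[OF P, of 0 i] partition_of_less[OF P, of i m] a0 that by (cases "i = 0") auto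
  have piece: "\<bar>Z p q\<bar> \<le> 6 * integral {p..q} h + 50 * (s p + s q) + 1 / 2"
    if i: "i < m" and pq: "a i \<le> p" "p \<le> q" "q \<le> a (Suc i)" "q < L" for i p q
    unfolding Z_def h_def s_def
  proof (rule sawtooth_sum_monotone_endpoints[OF pq(2)])
    have "\<alpha> \<le> p" using a_range[OF i] pq by simp
    then have sub: "{p..q} \<subseteq> {\<alpha>..<L}" using pq by auto
    show "C2_on_with {p..q} f f' f''" by (rule C2_on_with_subset[OF C2 sub])
    show "0 < f'' x" if "x \<in> {p..q}" for x using sign that sub by auto
    show "monotonic_on {p<..<q} f''"
      using mono[OF i] pq unfolding monotonic_on_def by (auto simp: monotone_on_def)
  qed
  have combine: "6 * integral {\<alpha>..q} h = 6 * integral {\<alpha>..p} h + 6 * integral {p..q} h"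
    "Z \<alpha> q = Z \<alpha> p + Z p q" if "\<alpha> \<le> p" "p \<le> q" "q < L" for p q
    using Henstock_Kurzweil_Integration.integral_combine[OF that(1,2) hsub[OF order_refl that(3)]]
      floor_interval_split[OF that(1,2)] unfolding Z_def by simp_all
  have full: "\<bar>Z \<alpha> (a k)\<bar> \<le> 6 * integral {\<alpha>..a k} h + 50 * (\<Sum>i<k. s (a i) + s (a (Suc i))) + real k / 2"
    if "k < m" for k
    using that
  proof (induction k)
    case (Suc k)
    have "\<bar>Z (a k) (a (Suc k))\<bar> \<le> 6 * integral {a k..a (Suc k)} h + 50 * (s (a k) + s (a (Suc k))) + 1 / 2"
      using Suc.prems a_range[of "Suc k"] partition_of_less[OF P, of k "Suc k"] by (intro piece[of k]) auto
    moreover have "\<alpha> \<le> a k" "a k \<le> a (Suc k)" "a (Suc k) < L"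
      using Suc.prems a_range[of "Suc k"] a_range[of k] partition_of_less[OF P, of k "Suc k"] by auto
    from combine[OF this] have "Z \<alpha> (a (Suc k)) = Z \<alpha> (a k) + Z (a k) (a (Suc k))"
      "6 * integral {\<alpha>..a (Suc k)} h = 6 * integral {\<alpha>..a k} h + 6 * integral {a k..a (Suc k)} h" by simp_all
    moreover have "\<bar>Z \<alpha> (a k)\<bar> \<le> 6 * integral {\<alpha>..a k} h + 50 * (\<Sum>i<k. s (a i) + s (a (Suc i))) + real k / 2"
      using Suc by simp
    moreover have "real (Suc k) / 2 = real k / 2 + 1 / 2" by (simp add: field_simps)
    ultimately show ?case unfolding sum.lessThan_Suc distrib_left by linarith
  qed (simp add: a0 Z_def)
  obtain k where k: "k < m" "a k \<le> c" "c < a (Suc k)" using partition_of_locate[OF P c] .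
  have "\<bar>Z (a k) c\<bar> \<le> 6 * integral {a k..c} h + 50 * (s (a k) + s c) + 1 / 2"
    using k c by (intro piece[of k]) auto
  moreover have "\<alpha> \<le> a k" using a_range k by simp
  from combine[OF this k(2) c(2)] have "Z \<alpha> c = Z \<alpha> (a k) + Z (a k) c"
    "6 * integral {\<alpha>..c} h = 6 * integral {\<alpha>..a k} h + 6 * integral {a k..c} h" by simp_all
  moreover note full[OF k(1)]
  \<comment> \<open>Left ends and right ends are compared separately with the full sum over the
    partition points.\<close>
  moreover have "50 * (\<Sum>i<k. s (a i) + s (a (Suc i))) + 50 * (s (a k) + s c) \<le> 50 * s c + 100 * (\<Sum>i<m. s (a i))"
  proof -
    have "(\<Sum>i<k. s (a i)) + s (a k) = (\<Sum>i<Suc k. s (a i))" by simp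
    also have "\<dots> \<le> (\<Sum>i<m. s (a i))" using k a_range s0 by (intro sum_mono2) auto
    finally have 1: "(\<Sum>i<k. s (a i)) + s (a k) \<le> (\<Sum>i<m. s (a i))" .
    have "(\<Sum>i<k. s (a (Suc i))) = (\<Sum>i\<in>Suc ` {..<k}. s (a i))" by (simp add: sum.reindex)
    also have "\<dots> \<le> (\<Sum>i<m. s (a i))" using k a_range s0 by (intro sum_mono2) auto
    finally show ?thesis using 1 by (simp add: sum.distrib)
  qed
  moreover have "real k / 2 + 1 / 2 \<le> real m / 2" using k by simp
  ultimately have Zc: "\<bar>Z \<alpha> c\<bar> \<le> 6 * integral {\<alpha>..c} h + (50 * s c + 100 * (\<Sum>i<m. s (a i))) + real m / 2"
    by linarith
  have "integral {\<alpha>..c} h \<le> integral {\<alpha>..<L} h"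
    using c hint hsub[OF order_refl c(2)] by (intro integral_subset_le) (auto simp: h_def)
  moreover have "Z \<alpha> L = Z \<alpha> c + Z c L" unfolding Z_def using c by (intro floor_interval_split) auto
  moreover have "\<bar>Z c L\<bar> \<le> (\<delta> + 1) / 2" using sawtooth_sum_trivial[of c L f] c by (simp add: Z_def c_def)
  ultimately have "\<bar>Z \<alpha> L\<bar> \<le> 6 * integral {\<alpha>..<L} h + 50 * s c + 100 * (\<Sum>i<m. s (a i)) + real m / 2 + (\<delta> + 1) / 2"
    using Zc by linarith
  then show ?thesis by (simp add: Z_def h_def s_def c_def)
qed

subsection \<open>Euler summation and the lattice point count\<close>

text \<open>Between two consecutive integers the periodic Bernoulli functions are polynomials.
  \<open>F\<close> is built so that its derivative is \<open>f - p * f''\<close>, where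
  \<open>p\<close> has derivative \<open>t - N - 1/2\<close> and lies between -1/8 and 0. The sign
  of \<open>f''\<close> then yields both inequalities.\<close>

lemma euler_summation_cell:
  fixes N :: int
  assumes C2: "C2_on_with {x..y} f f' f''" and sign: "\<forall>t\<in>{x..y}. f'' t \<ge> 0"
    and xy: "x \<le> y" "real_of_int N \<le> x" "y \<le> real_of_int N + 1"
  defines "F \<equiv> \<lambda>t::real. (t - N - 1/2) * f t - ((t - N)\<^sup>2 - (t - N)) / 2 * f' t"
  shows "integral {x..y} f \<le> F y - F x" "F y - F x \<le> integral {x..y} f + (f' y - f' x) / 8"
proof -
  define p where "p = (\<lambda>t::real. ((t - N)\<^sup>2 - (t - N)) / 2)"
  have p: "- (1/8) \<le> p t" "p t \<le> 0" if "t \<in> {x..y}" for t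
  proof -
    have "p t = ((t - N - 1/2)\<^sup>2) / 2 - 1/8" by (simp add: p_def power2_eq_square field_simps)
    then show "- (1/8) \<le> p t" by simp
    have "(t - N) * (1 - (t - N)) \<ge> 0" using that xy by (intro mult_nonneg_nonneg) auto
    then show "p t \<le> 0" by (simp add: p_def power2_eq_square algebra_simps)
  qed
  have f: "(f has_integral integral {x..y} f) {x..y}"
    by (intro integrable_integral integrable_continuous_real C2_on_with_continuous(1)[OF C2])
  have F: "((\<lambda>t. f t - p t * f'' t) has_integral (F y - F x)) {x..y}"
  proof (rule fundamental_theorem_of_calculus[OF xy(1)])
    fix t assume t: "t \<in> {x..y}"
    have "(f has_real_derivative f' t) (at t within {x..y})" "(f' has_real_derivative f'' t) (at t within {x..y})"
      using C2 t by (auto simp: C2_on_with_def)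
    then have "(F has_real_derivative f t - p t * f'' t) (at t within {x..y})"
      unfolding F_def p_def
      by (auto intro!: derivative_eq_intros simp: field_simps power2_eq_square)
    then show "(F has_vector_derivative f t - p t * f'' t) (at t within {x..y})"
      by (simp add: has_real_derivative_iff_has_vector_derivative)
  qed
  show "integral {x..y} f \<le> F y - F x"
    by (rule has_integral_le[OF f F]) (use p sign in \<open>auto simp: mult_nonpos_nonneg\<close>)
  have "((\<lambda>t. f t + f'' t / 8) has_integral (integral {x..y} f + (f' y - f' x) / 8)) {x..y}"
    by (intro has_integral_add f has_integral_divide C2_on_with_integral[OF C2 xy(1)])
  then show "F y - F x \<le> integral {x..y} f + (f' y - f' x) / 8"
  proof (rule has_integral_le[OF F])
    show "f t - p t * f'' t \<le> f t + f'' t / 8" if "t \<in> {x..y}" for t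
      using mult_right_mono[OF p(1)[OF that] sign[rule_format, OF that]] by simp
  qed
qed

lemma euler_summation_bound:
  assumes C2: "C2_on_with {\<alpha>..<L} f f' f''"
    and sign: "\<And>x. x \<in> {\<alpha>..<L} \<Longrightarrow> f' x < 0 \<and> f'' x > 0"
    and cont: "continuous_on {\<alpha>..L} f" and L: "\<alpha> < L" "f L = 0"
  shows "\<bar>(\<Sum>n\<in>{\<lfloor>\<alpha>\<rfloor><..\<lfloor>L\<rfloor>}. f (of_int n)) - integral {\<alpha>..L} f - sawtooth \<alpha> * f \<alpha>\<bar> \<le> \<bar>f' \<alpha>\<bar> / 8"
proof -
  define S where "S = (\<lambda>N::int. \<Sum>n\<in>{\<lfloor>\<alpha>\<rfloor><..N}. f (of_int n))"
  define p where "p = (\<lambda>(N::int) t::real. ((t - N)\<^sup>2 - (t - N)) / 2)"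
  define V where "V = (\<lambda>(N::int) b::real. S N - integral {\<alpha>..b} f + (b - of_int N - 1/2) * f b - p N b * f' b)"
  define V0 where "V0 = V \<lfloor>\<alpha>\<rfloor> \<alpha>"
  have cell: "0 \<le> V N b - V N c \<and> V N b - V N c \<le> (f' b - f' c) / 8"
    if "\<alpha> \<le> c" "c \<le> b" "b < L" "real_of_int N \<le> c" "b \<le> real_of_int N + 1" for N b c
  proof -
    have C2': "C2_on_with {c..b} f f' f''" using that by (intro C2_on_with_subset[OF C2]) auto
    have pos: "\<forall>t\<in>{c..b}. f'' t \<ge> 0" using sign \<open>\<alpha> \<le> c\<close> \<open>b < L\<close> by (auto intro: less_imp_le)
    have "f integrable_on {\<alpha>..b}"
      using that by (intro integrable_continuous_real continuous_on_subset[OF cont]) auto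
    from Henstock_Kurzweil_Integration.integral_combine[OF that(1,2) this]
    have "integral {\<alpha>..b} f = integral {\<alpha>..c} f + integral {c..b} f" by simp
    then show ?thesis
      using euler_summation_cell[OF C2' pos that(2,4,5)] unfolding V_def p_def by argo
  qed
  have V: "0 \<le> V N b - V0 \<and> V N b - V0 \<le> (f' b - f' \<alpha>) / 8"
    if "\<lfloor>\<alpha>\<rfloor> \<le> N" "\<alpha> \<le> b" "b < L" "real_of_int N \<le> b" "b \<le> real_of_int N + 1" for N b
    using that
  proof (induction N arbitrary: b rule: int_ge_induct)
    case base
    then show ?case using cell[of \<alpha> b "\<lfloor>\<alpha>\<rfloor>"] by (simp add: V0_def)
  next
    case (step N)
    have \<alpha>N: "\<alpha> \<le> real_of_int (N + 1)" using step.hyps by linarith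
    have "{\<lfloor>\<alpha>\<rfloor><..N + 1} = insert (N + 1) {\<lfloor>\<alpha>\<rfloor><..N}" using step.hyps by auto
    \<comment> \<open>On entering the next cell the sum gains \<open>f (N + 1)\<close> while the
      weight of \<open>f b\<close> falls from 1/2 to -1/2, and \<open>p\<close> vanishes on both
      sides.\<close>
    then have "V (N + 1) (of_int (N + 1)) = V N (of_int (N + 1))"
      by (simp add: V_def S_def p_def algebra_simps)
    moreover have "0 \<le> V N (of_int (N + 1)) - V0 \<and> V N (of_int (N + 1)) - V0 \<le> (f' (of_int (N + 1)) - f' \<alpha>) / 8"
      using step.prems \<alpha>N by (intro step.IH) auto
    moreover have "0 \<le> V (N + 1) b - V (N + 1) (of_int (N + 1)) \<and>
        V (N + 1) b - V (N + 1) (of_int (N + 1)) \<le> (f' b - f' (of_int (N + 1))) / 8"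
      using step.prems \<alpha>N by (intro cell) auto
    ultimately show ?case by argo
  qed
  have p_range: "- (1/8) \<le> p N t" "p N t \<le> 0" if "real_of_int N \<le> t" "t \<le> real_of_int N + 1" for N t
  proof -
    have "p N t = ((t - N - 1/2)\<^sup>2) / 2 - 1/8" by (simp add: p_def power2_eq_square field_simps)
    then show "- (1/8) \<le> p N t" by simp
    have "(t - N) * (1 - (t - N)) \<ge> 0" using that by (intro mult_nonneg_nonneg) auto
    then show "p N t \<le> 0" by (simp add: p_def power2_eq_square algebra_simps)
  qed
  \<comment> \<open>The ceiling keeps \<open>N\<close> strictly below \<open>L\<close>, so the last
    cell has interior points even when \<open>L\<close> is an integer. In that case the omitted term
    is \<open>f L = 0\<close>.\<close>
  define N where "N = \<lceil>L\<rceil> - 1"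
  define W where "W = (\<lambda>b::real. S N - integral {\<alpha>..b} f + (b - of_int N - 1/2) * f b - sawtooth \<alpha> * f \<alpha>)"
  have N: "real_of_int N < L" "L \<le> real_of_int N + 1" "\<lfloor>\<alpha>\<rfloor> \<le> N"
    using L unfolding N_def by linarith+
  have fin: "f integrable_on {\<alpha>..L}" by (rule integrable_continuous_real[OF cont])
  have W_bound: "\<bar>W b\<bar> \<le> \<bar>f' \<alpha>\<bar> / 8" if b: "max \<alpha> (of_int N) < b" "b < L" for b
  proof -
    have Vb: "0 \<le> V N b - V0" "V N b - V0 \<le> (f' b - f' \<alpha>) / 8" using V[OF N(3), of b] b N by auto
    have neg: "f' b < 0" "f' \<alpha> < 0" using sign[of b] sign[of \<alpha>] b L by auto
    have V0: "V0 = sawtooth \<alpha> * f \<alpha> - p \<lfloor>\<alpha>\<rfloor> \<alpha> * f' \<alpha>"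
      by (simp add: V0_def V_def S_def sawtooth_def frac_def)
    \<comment> \<open>The bound \<open>(f' b - f' \<alpha>) / 8\<close> on the first term and
      \<open>- f' b / 8\<close> on the second add up to \<open>- f' \<alpha> / 8\<close>, so no
      control of \<open>f' b\<close> near \<open>L\<close> enters.\<close>
    have "W b = (V N b - V0) + p N b * f' b - p \<lfloor>\<alpha>\<rfloor> \<alpha> * f' \<alpha>" by (simp add: V0 W_def V_def)
    moreover have "0 \<le> p N b * f' b" "p N b * f' b \<le> - (f' b / 8)"
      using p_range[of N b] b N neg mult_right_mono_neg[of "- (1/8)" "p N b" "f' b"]
      by (auto simp: mult_nonpos_nonpos)
    moreover have "0 \<le> p \<lfloor>\<alpha>\<rfloor> \<alpha> * f' \<alpha>" "p \<lfloor>\<alpha>\<rfloor> \<alpha> * f' \<alpha> \<le> - (f' \<alpha> / 8)"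
      using p_range[of "\<lfloor>\<alpha>\<rfloor>" \<alpha>] neg mult_right_mono_neg[of "- (1/8)" "p \<lfloor>\<alpha>\<rfloor> \<alpha>" "f' \<alpha>"]
      by (auto simp: mult_nonpos_nonpos)
    ultimately show ?thesis using Vb neg by (simp add: abs_le_iff)
  qed
  have Wcont: "continuous_on {\<alpha>..L} W"
    unfolding W_def by (intro continuous_intros cont indefinite_integral_continuous_1 fin)
  have "\<bar>W L\<bar> \<le> \<bar>f' \<alpha>\<bar> / 8"
  proof (rule continuous_le_on_closure[where f = "\<lambda>b. \<bar>W b\<bar>" and S = "{max \<alpha> (of_int N)<..<L}" and x = L])
    have "max \<alpha> (of_int N) < L" using L N by simp
    then have cl: "closure {max \<alpha> (of_int N)<..<L} = {max \<alpha> (of_int N)..L}" by simp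
    show "continuous_on (closure {max \<alpha> (of_int N)<..<L}) (\<lambda>b. \<bar>W b\<bar>)"
      unfolding cl by (intro continuous_intros continuous_on_subset[OF Wcont]) auto
    show "L \<in> closure {max \<alpha> (of_int N)<..<L}"
      unfolding cl using L N by simp
  qed (use W_bound in auto)
  moreover have "S N = S \<lfloor>L\<rfloor>"
  proof (cases "L \<in> \<int>")
    case True
    then obtain l where l: "L = of_int l" by (auto elim: Ints_cases)
    then have "{\<lfloor>\<alpha>\<rfloor><..\<lfloor>L\<rfloor>} = insert l {\<lfloor>\<alpha>\<rfloor><..N}" "l \<notin> {\<lfloor>\<alpha>\<rfloor><..N}" using N by (auto simp: N_def)
    then show ?thesis using L l by (simp add: S_def)
  next
    case False
    then have "\<lfloor>L\<rfloor> = N" by (simp add: N_def ceiling_altdef) (metis Ints_of_int)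
    then show ?thesis by simp
  qed
  ultimately show ?thesis using L by (simp add: W_def S_def)
qed

lemma floor_sum_bound:
  assumes C2: "C2_on_with {\<alpha>..<L} f f' f''"
    and sign: "\<And>x. x \<in> {\<alpha>..<L} \<Longrightarrow> f' x < 0 \<and> f'' x > 0"
    and cont: "continuous_on {\<alpha>..L} f" and L: "f L = 0"
    and P: "partition_of a m \<alpha> L"
    and mono: "\<And>i. i < m \<Longrightarrow> monotonic_on {a i<..<a (Suc i)} f''"
    and \<delta>: "0 < \<delta>" "\<delta> < L - \<alpha>"
  shows "\<bar>(\<Sum>n\<in>{\<lfloor>\<alpha>\<rfloor><..\<lfloor>L\<rfloor>}. real_of_int \<lfloor>f (of_int n)\<rfloor>)
       - (integral {\<alpha>..L} f + sawtooth \<alpha> * f \<alpha> - (real_of_int \<lfloor>L\<rfloor> - real_of_int \<lfloor>\<alpha>\<rfloor>) / 2)\<bar>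
     \<le> 6 * integral {\<alpha>..<L} (\<lambda>x. f'' x powr (1/3)) + 50 / sqrt (f'' (L - \<delta>))
       + 100 * (\<Sum>i<m. 1 / sqrt (f'' (a i))) + real m / 2 + (\<delta> + 1) / 2 + \<bar>f' \<alpha>\<bar> / 8"
proof -
  have \<alpha>L: "\<alpha> < L" using \<delta> by simp
  have "\<lfloor>y\<rfloor> = y - sawtooth y - 1/2" for y :: real by (simp add: sawtooth_def frac_def)
  then have "(\<Sum>n\<in>{\<lfloor>\<alpha>\<rfloor><..\<lfloor>L\<rfloor>}. real_of_int \<lfloor>f (of_int n)\<rfloor>)
    = (\<Sum>n\<in>{\<lfloor>\<alpha>\<rfloor><..\<lfloor>L\<rfloor>}. f (of_int n)) - (\<Sum>n\<in>{\<lfloor>\<alpha>\<rfloor><..\<lfloor>L\<rfloor>}. sawtooth (f (of_int n)))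
      - real (card {\<lfloor>\<alpha>\<rfloor><..\<lfloor>L\<rfloor>}) * (1/2)"
    by (simp add: sum_subtractf)
  moreover have "real (card {\<lfloor>\<alpha>\<rfloor><..\<lfloor>L\<rfloor>}) = real_of_int \<lfloor>L\<rfloor> - real_of_int \<lfloor>\<alpha>\<rfloor>"
    using floor_mono[of \<alpha> L] \<alpha>L by simp
  moreover have "\<bar>(\<Sum>n\<in>{\<lfloor>\<alpha>\<rfloor><..\<lfloor>L\<rfloor>}. f (of_int n)) - integral {\<alpha>..L} f - sawtooth \<alpha> * f \<alpha>\<bar> \<le> \<bar>f' \<alpha>\<bar> / 8"
    by (rule euler_summation_bound[OF C2 sign cont \<alpha>L L])
  moreover have "\<bar>\<Sum>n\<in>{\<lfloor>\<alpha>\<rfloor><..\<lfloor>L\<rfloor>}. sawtooth (f (of_int n))\<bar>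
     \<le> 6 * integral {\<alpha>..<L} (\<lambda>x. f'' x powr (1/3)) + 50 / sqrt (f'' (L - \<delta>))
       + 100 * (\<Sum>i<m. 1 / sqrt (f'' (a i))) + real m / 2 + (\<delta> + 1) / 2"
    by (rule sawtooth_sum_partition[OF C2 sign P mono \<delta>])
  ultimately show ?thesis by argo
qed

section \<open>Area, lattice points and the estimate for the unscaled curve\<close>

text \<open>The area identity behind Young's inequality: the region under \<open>f\<close> up to
  \<open>\<alpha>\<close> is a rectangle together with the region under \<open>g\<close> above
  height \<open>\<beta>\<close>. In \<open>\<Theta>\<close> the derivative \<open>y * g' y\<close>
  of \<open>J (g y)\<close> and the derivative of the second integral cancel against that of
  \<open>y * g y\<close>, so \<open>\<Theta>\<close> is constant.\<close>

lemma area_split_by_inverse: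
  fixes f g :: "real \<Rightarrow> real"
  assumes cf: "continuous_on {0..L} f" and cg: "continuous_on {\<beta>..M} g"
    and \<alpha>: "0 < \<alpha>" "\<alpha> \<le> L" and \<beta>: "\<beta> < M"
    and gf: "g \<beta> = \<alpha>" "g M = 0"
    and fg: "\<And>y. y \<in> {\<beta>..M} \<Longrightarrow> g y \<in> {0..L} \<and> f (g y) = y"
    and C2: "C2_on_with {\<beta>..<M} g g' g''" and sign: "\<And>y. y \<in> {\<beta>..<M} \<Longrightarrow> g' y < 0"
    and inner: "\<And>y. \<beta> < y \<Longrightarrow> y < M \<Longrightarrow> 0 < g y \<and> g y < L"
  shows "integral {0..\<alpha>} f = \<alpha> * \<beta> + integral {\<beta>..M} g"
proof -
  define J where "J = (\<lambda>x. integral {0..x} f)"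
  define \<Theta> where "\<Theta> = (\<lambda>y. J (g y) + integral {\<beta>..y} g - y * g y)"
  have Jc: "continuous_on {0..L} J"
    unfolding J_def by (intro indefinite_integral_continuous_1 integrable_continuous_real cf)
  have "\<Theta> M = \<Theta> \<beta>"
  proof (rule DERIV_isconst_end[OF \<beta>])
    show "continuous_on {\<beta>..M} \<Theta>"
      unfolding \<Theta>_def
      by (intro continuous_intros continuous_on_compose2[OF Jc cg] cg indefinite_integral_continuous_1 integrable_continuous_real)
        (use fg in auto)
    show "(\<Theta> has_real_derivative 0) (at y)" if y: "\<beta> < y" "y < M" for y
    proof -
      have "(J has_real_derivative f (g y)) (at (g y) within {0..L})"
        unfolding J_def using inner[OF y] by (intro integral_has_real_derivative cf) auto
      then have J': "(J has_real_derivative y) (at (g y))"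
        using inner[OF y] fg[of y] y by (simp add: at_within_Icc_at)
      have "((\<lambda>y. integral {\<beta>..y} g) has_real_derivative g y) (at y within {\<beta>..M})"
        using y by (intro integral_has_real_derivative cg) auto
      then have I': "((\<lambda>y. integral {\<beta>..y} g) has_real_derivative g y) (at y)"
        using y by (simp add: at_within_Icc_at)
      \<comment> \<open>A closed interval with \<open>y\<close> in its interior on which
        \<open>g\<close> is still twice differentiable turns the derivative within the half-open
        interval into an ordinary one.\<close>
      define c where "c = (y + M) / 2"
      have "C2_on_with {\<beta>..c} g g' g''" using y by (intro C2_on_with_subset[OF C2]) (auto simp: c_def field_simps)
      then have g': "(g has_real_derivative g' y) (at y)"
        by (rule C2_on_with_interior(1)) (use y in \<open>auto simp: c_def field_simps\<close>)
      have "(\<Theta> has_real_derivative y * g' y + g y - (1 * g y + g' y * y)) (at y)"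
        unfolding \<Theta>_def by (intro DERIV_diff DERIV_add DERIV_mult DERIV_ident I' g' DERIV_chain2[OF J' g'])
      then show ?thesis by (simp add: mult.commute)
    qed
  qed
  then show ?thesis by (simp add: \<Theta>_def gf J_def mult.commute)
qed

lemma le_nat_floor_iff: "0 \<le> x \<Longrightarrow> j \<le> nat \<lfloor>x\<rfloor> \<longleftrightarrow> real j \<le> x"
  by (simp add: le_nat_iff le_floor_iff)

lemma sum_nat_floor_interval:
  fixes h :: "real \<Rightarrow> real"
  assumes "0 \<le> u" and h: "\<And>n. u < real n \<Longrightarrow> real n \<le> v \<Longrightarrow> 0 \<le> h (real n)"
  shows "real (\<Sum>n\<in>{nat \<lfloor>u\<rfloor><..nat \<lfloor>v\<rfloor>}. nat \<lfloor>h (real n)\<rfloor>) = (\<Sum>n\<in>{\<lfloor>u\<rfloor><..\<lfloor>v\<rfloor>}. real_of_int \<lfloor>h (of_int n)\<rfloor>)"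
proof -
  have "real (\<Sum>n\<in>{nat \<lfloor>u\<rfloor><..nat \<lfloor>v\<rfloor>}. nat \<lfloor>h (real n)\<rfloor>) = (\<Sum>n\<in>{nat \<lfloor>u\<rfloor><..nat \<lfloor>v\<rfloor>}. real_of_int \<lfloor>h (real n)\<rfloor>)"
    unfolding of_nat_sum
  proof (intro sum.cong refl)
    fix n assume n: "n \<in> {nat \<lfloor>u\<rfloor><..nat \<lfloor>v\<rfloor>}"
    then have "\<lfloor>u\<rfloor> < int n" "int n \<le> \<lfloor>v\<rfloor>" using assms(1) by (simp_all add: nat_less_iff le_nat_iff) linarith
    then have "0 \<le> h (real n)" by (intro h) (simp_all add: floor_less_iff le_floor_iff)
    then show "real (nat \<lfloor>h (real n)\<rfloor>) = real_of_int \<lfloor>h (real n)\<rfloor>" by simp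
  qed
  also have "\<dots> = (\<Sum>n\<in>{\<lfloor>u\<rfloor><..\<lfloor>v\<rfloor>}. real_of_int \<lfloor>h (of_int n)\<rfloor>)"
  proof (rule sum.reindex_bij_witness[where i = nat and j = int])
    have "0 \<le> \<lfloor>u\<rfloor>" using assms(1) by simp
    then show "int n \<in> {\<lfloor>u\<rfloor><..\<lfloor>v\<rfloor>}" if "n \<in> {nat \<lfloor>u\<rfloor><..nat \<lfloor>v\<rfloor>}" for n using that by auto
    show "int (nat n) = n" "nat n \<in> {nat \<lfloor>u\<rfloor><..nat \<lfloor>v\<rfloor>}" if "n \<in> {\<lfloor>u\<rfloor><..\<lfloor>v\<rfloor>}" for n
      using that \<open>0 \<le> \<lfloor>u\<rfloor>\<close> by (auto simp del: zero_le_floor)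
  qed auto
  finally show ?thesis .
qed

text \<open>Everything rests on \<open>y \<le> f x \<longleftrightarrow> x \<le> g y\<close>, which
  lets a point be tested by column or by row. A counted point with \<open>k > \<beta>\<close> has
  \<open>j < \<alpha>\<close>, so columns and rows do not overlap. The other counted points lie in
  the rectangle, all of which is under the curve because \<open>f\<close> decreases to
  \<open>\<beta>\<close> at \<open>\<alpha>\<close>.\<close>

lemma lattice_count_decompose:
  fixes f g :: "real \<Rightarrow> real"
  assumes ff: "f \<in> {0..L} \<rightarrow> {0..M}" and gg: "g \<in> {0..M} \<rightarrow> {0..L}"
    and anti: "strict_antimono_on {0..L} f" and fg: "\<forall>y\<in>{0..M}. f (g y) = y"
    and \<alpha>: "\<alpha> \<in> {0..L}" "f \<alpha> = \<beta>"
  shows "real (lattice_count f L 1 1) = (\<Sum>n\<in>{\<lfloor>\<alpha>\<rfloor><..\<lfloor>L\<rfloor>}. real_of_int \<lfloor>f (of_int n)\<rfloor>)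
      + (\<Sum>n\<in>{\<lfloor>\<beta>\<rfloor><..\<lfloor>M\<rfloor>}. real_of_int \<lfloor>g (of_int n)\<rfloor>) + real_of_int \<lfloor>\<alpha>\<rfloor> * real_of_int \<lfloor>\<beta>\<rfloor>"
proof -
  have frange: "0 \<le> f x" "f x \<le> M" if "0 \<le> x" "x \<le> L" for x using ff that by (auto simp: Pi_iff)
  have grange: "0 \<le> g y" "g y \<le> L" if "0 \<le> y" "y \<le> M" for y using gg that by (auto simp: Pi_iff)
  have f_le: "f x \<le> f z \<longleftrightarrow> z \<le> x" if "0 \<le> x" "x \<le> L" "0 \<le> z" "z \<le> L" for x z
    using anti that unfolding monotone_on_def by (metis atLeastAtMost_iff linorder_not_less order_less_le order_refl)
  have le_iff: "y \<le> f x \<longleftrightarrow> x \<le> g y" if "0 \<le> x" "x \<le> L" "0 \<le> y" "y \<le> M" for x y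
    using f_le[of "g y" x] grange[of y] fg that by simp
  have \<alpha>0: "0 \<le> \<alpha>" "\<alpha> \<le> L" and \<beta>0: "0 \<le> \<beta>" "\<beta> \<le> M" using \<alpha> frange[of \<alpha>] by auto
  define S where "S = {(j::nat, k::nat). 1 \<le> j \<and> 1 \<le> k \<and> real j \<le> L \<and> real k \<le> f (real j)}"
  define S1 where "S1 = (SIGMA j:{nat \<lfloor>\<alpha>\<rfloor><..nat \<lfloor>L\<rfloor>}. {1..nat \<lfloor>f (real j)\<rfloor>})"
  define S2 where "S2 = (SIGMA k:{nat \<lfloor>\<beta>\<rfloor><..nat \<lfloor>M\<rfloor>}. {1..nat \<lfloor>g (real k)\<rfloor>})"
  define S3 where "S3 = {1..nat \<lfloor>\<alpha>\<rfloor>} \<times> {1..nat \<lfloor>\<beta>\<rfloor>}"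
  have S1: "(j, k) \<in> S1 \<longleftrightarrow> \<alpha> < real j \<and> real j \<le> L \<and> 1 \<le> k \<and> real k \<le> f (real j)" for j k
    unfolding S1_def using \<alpha>0 frange[of "real j"]
    by (auto simp: le_nat_floor_iff not_le[symmetric] simp del: not_le)
  have S2: "(k, j) \<in> S2 \<longleftrightarrow> \<beta> < real k \<and> real k \<le> M \<and> 1 \<le> j \<and> real j \<le> g (real k)" for j k
    unfolding S2_def using \<beta>0 grange[of "real k"]
    by (auto simp: le_nat_floor_iff not_le[symmetric] simp del: not_le)
  have S3: "(j, k) \<in> S3 \<longleftrightarrow> 1 \<le> j \<and> 1 \<le> k \<and> real j \<le> \<alpha> \<and> real k \<le> \<beta>" for j k
    unfolding S3_def using \<alpha>0 \<beta>0 by (auto simp: le_nat_floor_iff)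
  have g_less: "real j < \<alpha>" if "(k, j) \<in> S2" for j k
    using that le_iff[of \<alpha> "real k"] \<alpha> \<alpha>0 \<beta>0 unfolding S2 by auto
  have "S = S1 \<union> prod.swap ` S2 \<union> S3"
  proof (intro set_eqI iffI)
    fix x assume "x \<in> S"
    then obtain j k where x: "x = (j, k)" and jk: "1 \<le> j" "1 \<le> k" "real j \<le> L" "real k \<le> f (real j)"
      by (auto simp: S_def)
    show "x \<in> S1 \<union> prod.swap ` S2 \<union> S3"
    proof (cases "\<alpha> < real j")
      case True
      then show ?thesis using jk by (simp add: x S1)
    next
      case False
      show ?thesis
      proof (cases "real k \<le> \<beta>")
        case True
        then show ?thesis using jk False by (simp add: x S3)
      next
        case kb: False
        have "(k, j) \<in> S2" using jk kb le_iff[of "real j" "real k"] frange[of "real j"] by (simp add: S2)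
        then show ?thesis unfolding x by (metis UnI1 UnI2 image_eqI swap_simp)
      qed
    qed
  next
    fix x assume "x \<in> S1 \<union> prod.swap ` S2 \<union> S3"
    then consider "x \<in> S1" | "x \<in> prod.swap ` S2" | "x \<in> S3" by blast
    then show "x \<in> S"
    proof cases
      case 1
      then obtain j k where x: "x = (j, k)" and m: "(j, k) \<in> S1" by (cases x) auto
      have "1 \<le> j" using m \<alpha>0 by (cases j) (auto simp: S1)
      then show ?thesis using m by (simp add: x S_def S1)
    next
      case 2
      then obtain j k where x: "x = (j, k)" and m: "(k, j) \<in> S2" by auto
      have m': "\<beta> < real k" "real k \<le> M" "1 \<le> j" "real j \<le> g (real k)" using m by (simp_all add: S2)
      have "1 \<le> k" using m' \<beta>0 by (cases k) auto
      moreover have "real j \<le> L" using grange[of "real k"] m' by simp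
      ultimately show ?thesis using m' le_iff[of "real j" "real k"] by (simp add: x S_def)
    next
      case 3
      then obtain j k where x: "x = (j, k)" and m: "(j, k) \<in> S3" by (cases x) auto
      then have m': "1 \<le> j" "1 \<le> k" "real j \<le> \<alpha>" "real k \<le> \<beta>" by (simp_all add: S3)
      have "real k \<le> f (real j)" using f_le[of \<alpha> "real j"] m' \<alpha> \<alpha>0 by simp
      then show ?thesis using m' \<alpha>0 by (simp add: x S_def)
    qed
  qed
  moreover have "S1 \<inter> prod.swap ` S2 = {}" using g_less S1 by force
  moreover have "(S1 \<union> prod.swap ` S2) \<inter> S3 = {}" using S1 S2 S3 by fastforce
  moreover have fin: "finite S1" "finite S2" "finite S3" by (auto simp: S1_def S2_def S3_def)
  ultimately have "card S = card S1 + card (prod.swap ` S2) + card S3"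
    by (simp add: card_Un_disjoint)
  also have "card (prod.swap ` S2) = card S2" by (intro card_image) simp
  finally have card: "real (card S) = real (card S1) + real (card S2) + real (card S3)" by simp
  have "real (card S1) = (\<Sum>n\<in>{\<lfloor>\<alpha>\<rfloor><..\<lfloor>L\<rfloor>}. real_of_int \<lfloor>f (of_int n)\<rfloor>)"
    unfolding S1_def using sum_nat_floor_interval[of \<alpha> L f] \<alpha>0 frange by (simp add: card_SigmaI)
  moreover have "real (card S2) = (\<Sum>n\<in>{\<lfloor>\<beta>\<rfloor><..\<lfloor>M\<rfloor>}. real_of_int \<lfloor>g (of_int n)\<rfloor>)"
    unfolding S2_def using sum_nat_floor_interval[of \<beta> M g] \<beta>0 grange by (simp add: card_SigmaI)
  moreover have "real (card S3) = real_of_int \<lfloor>\<alpha>\<rfloor> * real_of_int \<lfloor>\<beta>\<rfloor>"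
    unfolding S3_def using \<alpha>0 \<beta>0 by (simp add: card_cartesian_product)
  moreover have "lattice_count f L 1 1 = card S" by (simp add: lattice_count_def S_def)
  ultimately show ?thesis using card by simp
qed

text \<open>Writing \<open>x = frac \<alpha>\<close> and \<open>y = frac \<beta>\<close>, the boundary terms of the two Euler summations
  combine with the rectangle count to \<open>x * y - (x + y) / 2 + (frac L + frac M) / 2\<close>.\<close>

lemma boundary_terms_bound:
  fixes \<alpha> \<beta> L M :: real
  shows "\<bar>(sawtooth \<alpha> * \<beta> - (real_of_int \<lfloor>L\<rfloor> - real_of_int \<lfloor>\<alpha>\<rfloor>) / 2)
     + (sawtooth \<beta> * \<alpha> - (real_of_int \<lfloor>M\<rfloor> - real_of_int \<lfloor>\<beta>\<rfloor>) / 2)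
     + real_of_int \<lfloor>\<alpha>\<rfloor> * real_of_int \<lfloor>\<beta>\<rfloor> - \<alpha> * \<beta> + (L + M) / 2\<bar> \<le> 1"
proof -
  define x y where "x = frac \<alpha>" and "y = frac \<beta>"
  have fr: "real_of_int \<lfloor>z\<rfloor> = z - frac z" for z :: real by (simp add: frac_def)
  have xy: "0 \<le> x" "x < 1" "0 \<le> y" "y < 1" by (auto simp: x_def y_def frac_lt_1)
  have "(sawtooth \<alpha> * \<beta> - (real_of_int \<lfloor>L\<rfloor> - real_of_int \<lfloor>\<alpha>\<rfloor>) / 2)
     + (sawtooth \<beta> * \<alpha> - (real_of_int \<lfloor>M\<rfloor> - real_of_int \<lfloor>\<beta>\<rfloor>) / 2)
     + real_of_int \<lfloor>\<alpha>\<rfloor> * real_of_int \<lfloor>\<beta>\<rfloor> - \<alpha> * \<beta> + (L + M) / 2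
     = x * y - (x + y) / 2 + (frac L + frac M) / 2"
    unfolding sawtooth_def fr x_def y_def by (simp add: field_simps)
  moreover have "\<bar>x * y - (x + y) / 2 + (frac L + frac M) / 2\<bar> \<le> 1"
  proof -
    \<comment> \<open>These inequalities put \<open>x * y - (x + y) / 2\<close> between -1/2 and 0,
      while the half sum of the other two fractional parts is between 0 and 1.\<close>
    have "x * y \<le> x * 1" "x * y \<le> 1 * y" using xy by (intro mult_left_mono mult_right_mono; simp)+
    moreover have "0 \<le> (1 - x) * (1 - y)" "0 \<le> x * y" using xy by (intro mult_nonneg_nonneg; simp)+
    moreover have "0 \<le> frac L" "frac L < 1" "0 \<le> frac M" "frac M < 1" by (auto simp: frac_lt_1)
    ultimately show ?thesis using xy unfolding abs_le_iff add_divide_distrib by linarith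
  qed
  ultimately show ?thesis by (simp only:)
qed

text \<open>Both parts reduce to this estimate. The range \<open>\<delta> < L - \<alpha>\<close>
  contains the one given by \<open>\<lfloor>L\<rfloor>\<close> as well as the one given by
  \<open>L / 2\<close>, and it is preserved under scaling.\<close>

lemma lattice_count_unit_bound:
  fixes f f' f'' g g' g'' :: "real \<Rightarrow> real" and a b :: "nat \<Rightarrow> real"
  assumes L: "L > 0" and M: "M > 0"
    and ff: "f \<in> {0..L} \<rightarrow> {0..M}" and f0: "f 0 = M" and fL: "f L = 0"
    and cf: "continuous_on {0..L} f" and anti: "strict_antimono_on {0..L} f"
    and gg: "g \<in> {0..M} \<rightarrow> {0..L}"
    and gf: "\<forall>x\<in>{0..L}. g (f x) = x" and fg: "\<forall>y\<in>{0..M}. f (g y) = y"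
    and \<alpha>\<beta>: "(\<alpha>, \<beta>) \<in> graph_curve f L" and \<alpha>: "\<alpha> > 0" and \<beta>: "\<beta> > 0"
    and C2f: "C2_on_with {\<alpha>..<L} f f' f''" and signf: "\<forall>x\<in>{\<alpha>..<L}. f' x < 0 \<and> f'' x > 0"
    and C2g: "C2_on_with {\<beta>..<M} g g' g''" and signg: "\<forall>y\<in>{\<beta>..<M}. g' y < 0 \<and> g'' y > 0"
    and Pa: "partition_of a m \<alpha> L" and mf: "\<forall>i<m. monotonic_on {a i<..<a (Suc i)} f''"
    and Pb: "partition_of b n \<beta> M" and mg: "\<forall>i<n. monotonic_on {b i<..<b (Suc i)} g''"
    and \<delta>: "0 < \<delta>" "\<delta> < L - \<alpha>" and \<epsilon>: "0 < \<epsilon>" "\<epsilon> < M - \<beta>"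
  shows "\<bar>real (lattice_count f L 1 1) - area_under f L + (L + M) / 2\<bar>
        \<le> 6 * (integral {\<alpha>..<L} (\<lambda>x. f'' x powr (1/3)) + integral {\<beta>..<M} (\<lambda>y. g'' y powr (1/3)))
          + 175 * (1 / sqrt (f'' (L - \<delta>)) + 1 / sqrt (g'' (M - \<epsilon>)))
          + 525 * ((\<Sum>i<m. 1 / sqrt (f'' (a i))) + (\<Sum>i<n. 1 / sqrt (g'' (b i))))
          + 1/4 * ((\<Sum>i<m. \<bar>f' (a i)\<bar>) + (\<Sum>i<n. \<bar>g' (b i)\<bar>))
          + 1/2 * (\<delta> + \<epsilon>) + 3 * (real m + real n) + 5 + L / M + M / L"
proof -
  have \<alpha>L: "\<alpha> \<in> {0..L}" "f \<alpha> = \<beta>" "\<alpha> < L" and \<beta>M: "\<beta> < M" using \<alpha>\<beta> \<delta> \<epsilon> by (auto simp: graph_curve_def)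
  have g\<beta>: "g \<beta> = \<alpha>" and gM: "g M = 0" using gf \<alpha>L L f0 by (metis atLeastAtMost_iff order_refl less_imp_le)+
  have image: "f ` {0..L} = {0..M}"
  proof
    show "{0..M} \<subseteq> f ` {0..L}"
    proof
      fix y assume "y \<in> {0..M}"
      then have "y = f (g y)" "g y \<in> {0..L}" using fg gg by auto
      then show "y \<in> f ` {0..L}" by blast
    qed
  qed (use ff in auto)
  \<comment> \<open>The inverse of a continuous injection on a compact interval is continuous; the
    image is all of \<open>{0..M}\<close> because \<open>f\<close> inverts \<open>g\<close>
    there.\<close>
  have cg: "continuous_on {0..M} g"
    using continuous_on_inv[OF cf compact_Icc gf] unfolding image .
  have cf\<alpha>: "continuous_on {\<alpha>..L} f" using \<alpha> by (intro continuous_on_subset[OF cf]) auto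
  have cg\<beta>: "continuous_on {\<beta>..M} g" using \<beta> by (intro continuous_on_subset[OF cg]) auto
  have inner: "0 < g y \<and> g y < L" if "\<beta> < y" "y < M" for y
  proof -
    have "g y \<in> {0..L}" "f (g y) = y" using gg fg that \<beta> by (auto simp: Pi_iff)
    moreover have "g y \<noteq> 0" "g y \<noteq> L" using \<open>f (g y) = y\<close> f0 fL that \<beta> by auto
    ultimately show ?thesis by simp
  qed
  have first: "\<bar>h' l\<bar> \<le> (\<Sum>i<k. \<bar>h' (p i)\<bar>)" "0 < k"
    if "partition_of p k l u" "l < u" for p k l u and h' :: "real \<Rightarrow> real"
  proof -
    have p: "p 0 = l" "p k = u" using that(1) by (auto simp: partition_of_def)
    show k: "0 < k" using p that(2) by (cases k) auto
    have "(\<Sum>i\<in>{0}. \<bar>h' (p i)\<bar>) \<le> (\<Sum>i<k. \<bar>h' (p i)\<bar>)" using k by (intro sum_mono2) auto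
    then show "\<bar>h' l\<bar> \<le> (\<Sum>i<k. \<bar>h' (p i)\<bar>)" using p by simp
  qed
  have area1: "integral {0..\<alpha>} f = \<alpha> * \<beta> + integral {\<beta>..M} g"
    by (rule area_split_by_inverse[OF cf cg\<beta> \<alpha> _ \<beta>M g\<beta> gM _ C2g _ inner]) (use \<alpha>L gg fg \<beta> signg in auto)
  have area2: "area_under f L = integral {0..\<alpha>} f + integral {\<alpha>..L} f"
    using Henstock_Kurzweil_Integration.integral_combine[of 0 \<alpha> L f] \<alpha>L integrable_continuous_real[OF cf]
    by (simp add: area_under_def)
  note count = lattice_count_decompose[OF ff gg anti fg \<alpha>L(1,2)]
  note boundary = boundary_terms_bound[of \<alpha> \<beta> L M]
  have sum_f: "\<bar>(\<Sum>n\<in>{\<lfloor>\<alpha>\<rfloor><..\<lfloor>L\<rfloor>}. real_of_int \<lfloor>f (of_int n)\<rfloor>)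
       - (integral {\<alpha>..L} f + sawtooth \<alpha> * f \<alpha> - (real_of_int \<lfloor>L\<rfloor> - real_of_int \<lfloor>\<alpha>\<rfloor>) / 2)\<bar>
     \<le> 6 * integral {\<alpha>..<L} (\<lambda>x. f'' x powr (1/3)) + 50 / sqrt (f'' (L - \<delta>))
       + 100 * (\<Sum>i<m. 1 / sqrt (f'' (a i))) + real m / 2 + (\<delta> + 1) / 2 + \<bar>f' \<alpha>\<bar> / 8"
    by (rule floor_sum_bound[OF C2f _ cf\<alpha> fL Pa _ \<delta>]) (use signf mf in auto)
  have sum_g: "\<bar>(\<Sum>n\<in>{\<lfloor>\<beta>\<rfloor><..\<lfloor>M\<rfloor>}. real_of_int \<lfloor>g (of_int n)\<rfloor>)
       - (integral {\<beta>..M} g + sawtooth \<beta> * g \<beta> - (real_of_int \<lfloor>M\<rfloor> - real_of_int \<lfloor>\<beta>\<rfloor>) / 2)\<bar>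
     \<le> 6 * integral {\<beta>..<M} (\<lambda>y. g'' y powr (1/3)) + 50 / sqrt (g'' (M - \<epsilon>))
       + 100 * (\<Sum>i<n. 1 / sqrt (g'' (b i))) + real n / 2 + (\<epsilon> + 1) / 2 + \<bar>g' \<beta>\<bar> / 8"
    by (rule floor_sum_bound[OF C2g _ cg\<beta> gM Pb _ \<epsilon>]) (use signg mg in auto)
  have ends: "50 / sqrt (f'' (L - \<delta>)) \<le> 175 * (1 / sqrt (f'' (L - \<delta>)))"
    "50 / sqrt (g'' (M - \<epsilon>)) \<le> 175 * (1 / sqrt (g'' (M - \<epsilon>)))"
    using signf[rule_format, of "L - \<delta>"] signg[rule_format, of "M - \<epsilon>"] \<delta> \<epsilon> by (simp_all add: divide_right_mono)
  note slopes = first(1)[OF Pa \<alpha>L(3), of f'] first(1)[OF Pb \<beta>M, of g']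
  have pos_f: "0 \<le> (\<Sum>i<m. 1 / sqrt (f'' (a i)))"
  proof (intro sum_nonneg)
    fix i assume "i \<in> {..<m}"
    then have "\<alpha> \<le> a i" "a i < L"
      using partition_of_less[OF Pa, of 0 i] partition_of_less[OF Pa, of i m] Pa by (cases "i = 0"; force simp: partition_of_def)+
    then show "0 \<le> 1 / sqrt (f'' (a i))" using signf[rule_format, of "a i"] by simp
  qed
  have pos_g: "0 \<le> (\<Sum>i<n. 1 / sqrt (g'' (b i)))"
  proof (intro sum_nonneg)
    fix i assume "i \<in> {..<n}"
    then have "\<beta> \<le> b i" "b i < M"
      using partition_of_less[OF Pb, of 0 i] partition_of_less[OF Pb, of i n] Pb by (cases "i = 0"; force simp: partition_of_def)+
    then show "0 \<le> 1 / sqrt (g'' (b i))" using signg[rule_format, of "b i"] by simp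
  qed
  have ratio: "0 \<le> L / M" "0 \<le> M / L" using L M by auto
  have combine: "\<bar>N - A + T\<bar> \<le> E1 + E2 + 1"
    if "I0 = P + Ig" "A = I0 + If" "N = S1 + S2 + R" "\<bar>(b1 - h1) + (b2 - h2) + R - P + T\<bar> \<le> 1"
      "\<bar>S1 - (If + b1 - h1)\<bar> \<le> E1" "\<bar>S2 - (Ig + b2 - h2)\<bar> \<le> E2"
    for N A T E1 E2 I0 P Ig If S1 S2 R b1 h1 b2 h2 :: real
    using that by (simp add: abs_le_iff)
  \<comment> \<open>The arithmetic is isolated with integrals and roots as plain variables. The
    slope \<open>\<bar>f' \<alpha>\<bar>\<close> is the term \<open>i = 0\<close> of its sum, and
    the constants \<open>(\<delta> + 1) / 2\<close>, \<open>(\<epsilon> + 1) / 2\<close> and the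
    boundary 1 fit into \<open>1/2 * (\<delta> + \<epsilon>) + 5\<close>.\<close>
  have relax: "6 * i1 + x1 + 100 * s1 + real m / 2 + (\<delta> + 1) / 2 + c1 / 8
      + (6 * i2 + x2 + 100 * s2 + real n / 2 + (\<epsilon> + 1) / 2 + c2 / 8) + 1
    \<le> 6 * (i1 + i2) + 175 * (y1 + y2) + 525 * (s1 + s2) + 1/4 * (d1 + d2) + 1/2 * (\<delta> + \<epsilon>)
      + 3 * (real m + real n) + 5 + q1 + q2"
    if "x1 \<le> 175 * y1" "x2 \<le> 175 * y2" "0 \<le> s1" "0 \<le> s2" "c1 \<le> d1" "c2 \<le> d2" "0 \<le> c1" "0 \<le> c2" "0 \<le> q1" "0 \<le> q2"
    for i1 i2 x1 x2 y1 y2 s1 s2 c1 c2 d1 d2 q1 q2 :: real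
    using that of_nat_0_le_iff[of m, where 'a = real] of_nat_0_le_iff[of n, where 'a = real]
    by (simp add: field_simps)
  show ?thesis
    using combine[OF area1 area2 count boundary sum_f[unfolded \<alpha>L(2)] sum_g[unfolded g\<beta>]]
      relax[OF ends pos_f pos_g slopes abs_ge_zero abs_ge_zero ratio]
    by (rule order_trans)
qed

subsection \<open>Scaling\<close>

text \<open>Derivatives are taken within the half-open interval and are one-sided at its left end,
  so the chain rule needs the exact image of the scaled domain.\<close>

lemma scaled_half_open_image: "0 < \<rho> \<Longrightarrow> (\<lambda>x. x / \<rho>) ` {\<rho> * c..<\<rho> * d} = {c..<d::real}"
  by (auto simp: field_simps intro!: image_eqI[where x = "\<rho> * _"])

lemma C2_on_with_scale:
  fixes \<rho> A :: real
  assumes C2: "C2_on_with {c..<d} f f' f''" and \<rho>: "0 < \<rho>"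
  shows "C2_on_with {\<rho> * c..<\<rho> * d} (\<lambda>x. A * f (x / \<rho>)) (\<lambda>x. A / \<rho> * f' (x / \<rho>)) (\<lambda>x. A / \<rho>\<^sup>2 * f'' (x / \<rho>))"
proof -
  let ?S = "{\<rho> * c..<\<rho> * d}"
  have in_S: "x / \<rho> \<in> {c..<d}" if "x \<in> ?S" for x using that \<rho> by (auto simp: field_simps)
  have chain: "((\<lambda>x. B * h (x / \<rho>)) has_real_derivative B / \<rho> * h' (x / \<rho>)) (at x within ?S)"
    if x: "x \<in> ?S" and h: "\<forall>x\<in>{c..<d}. (h has_real_derivative h' x) (at x within {c..<d})" for h h' B x
  proof -
    have "(h has_real_derivative h' (x / \<rho>)) (at (x / \<rho>) within (\<lambda>x. x / \<rho>) ` ?S)"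
      using h in_S[OF x] unfolding scaled_half_open_image[OF \<rho>] by blast
    moreover have "((\<lambda>x. x / \<rho>) has_real_derivative 1 / \<rho>) (at x within ?S)"
      using \<rho> by (auto intro!: derivative_eq_intros)
    ultimately have "(h \<circ> (\<lambda>x. x / \<rho>) has_real_derivative h' (x / \<rho>) * (1 / \<rho>)) (at x within ?S)"
      by (rule DERIV_image_chain)
    from DERIV_cmult[OF this, of B] show ?thesis by (simp add: o_def)
  qed
  have "A / \<rho>\<^sup>2 = A / \<rho> / \<rho>" by (simp add: power2_eq_square)
  then show ?thesis
    using C2 chain[of _ f f' A] chain[of _ f' f'' "A / \<rho>"] in_S unfolding C2_on_with_def
    by (auto intro!: continuous_intros continuous_on_compose2[of "{c..<d}" f'' ?S "\<lambda>x. x / \<rho>"] simp: \<rho> less_imp_neq[OF \<rho>, symmetric])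
qed

lemma has_integral_half_open_iff:
  fixes h :: "real \<Rightarrow> real"
  shows "(h has_integral i) {c..<d} \<longleftrightarrow> (h has_integral i) {c..d}"
  by (rule has_integral_spike_set_eq) (auto intro: negligible_subset[of "{d}"])

lemma integral_scale_half_open:
  fixes h :: "real \<Rightarrow> real"
  assumes h: "h integrable_on {c..<d}" and \<rho>: "0 < \<rho>"
  shows "integral {\<rho> * c..<\<rho> * d} (\<lambda>x. h (x / \<rho>)) = \<rho> * integral {c..<d} h"
proof -
  have "(h has_integral integral {c..<d} h) {c..d}"
    using h has_integral_half_open_iff by (blast intro: integrable_integral)
  from has_integral_stretch_real[OF this, of "1 / \<rho>"] \<rho>
  have "((\<lambda>x. h (x / \<rho>)) has_integral \<rho> * integral {c..<d} h) ((\<lambda>x. x * \<rho>) ` {c..d})"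
    by simp
  also have "(\<lambda>x. x * \<rho>) ` {c..d} = {\<rho> * c..\<rho> * d}"
    using \<rho> by (auto simp: field_simps intro!: image_eqI[where x = "_ / \<rho>"])
  finally show ?thesis by (intro integral_unique) (simp add: has_integral_half_open_iff)
qed

text \<open>The integral is affine arc length, which scales with the cube root of the determinant.
  Here that is \<open>A * \<rho> = r^2\<close>, and as it is symmetric in the two factors, the same
  lemma serves \<open>f\<close> and, with them exchanged, \<open>g\<close>.\<close>

lemma cube_root_integral_scale:
  fixes f'' :: "real \<Rightarrow> real"
  assumes int: "(\<lambda>x. f'' x powr (1/3)) integrable_on {c..<d}" and pos: "\<forall>x\<in>{c..<d}. 0 < f'' x"
    and \<rho>: "0 < \<rho>" and A: "0 < A" and r: "0 < r" "A * \<rho> = r\<^sup>2"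
  shows "integral {\<rho> * c..<\<rho> * d} (\<lambda>x. (A / \<rho>\<^sup>2 * f'' (x / \<rho>)) powr (1/3))
    = r powr (2/3) * integral {c..<d} (\<lambda>x. f'' x powr (1/3))"
proof -
  define K where "K = (A / \<rho>\<^sup>2) powr (1/3)"
  have "integral {\<rho> * c..<\<rho> * d} (\<lambda>x. (A / \<rho>\<^sup>2 * f'' (x / \<rho>)) powr (1/3))
     = integral {\<rho> * c..<\<rho> * d} (\<lambda>x. K * f'' (x / \<rho>) powr (1/3))"
  proof (rule integral_cong)
    fix x assume "x \<in> {\<rho> * c..<\<rho> * d}"
    then have "x / \<rho> \<in> {c..<d}" using \<rho> by (auto simp: field_simps)
    then have "0 < f'' (x / \<rho>)" using pos by blast
    then show "(A / \<rho>\<^sup>2 * f'' (x / \<rho>)) powr (1/3) = K * f'' (x / \<rho>) powr (1/3)"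
      using A unfolding K_def by (subst powr_mult) auto
  qed
  also have "\<dots> = K * (\<rho> * integral {c..<d} (\<lambda>x. f'' x powr (1/3)))"
    using integral_scale_half_open[OF int \<rho>] by simp
  also have "K * \<rho> = r powr (2/3)"
  proof -
    have "A / \<rho>\<^sup>2 = r\<^sup>2 / \<rho> ^ 3"
      using \<rho> r(2) by (simp add: field_simps power2_eq_square power3_eq_cube)
    then have "K = (r\<^sup>2) powr (1/3) / (\<rho> ^ 3) powr (1/3)"
      unfolding K_def using \<rho> by (simp add: powr_divide)
    moreover have "(\<rho> ^ 3) powr (1/3) = \<rho>" using powr_powr[of \<rho> 3 "1/3"] \<rho> by simp
    moreover have "(r\<^sup>2) powr (1/3) = r powr (2/3)" using powr_powr[of r 2 "1/3"] r by simp
    ultimately show ?thesis using \<rho> by simp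
  qed
  then have "K * (\<rho> * integral {c..<d} (\<lambda>x. f'' x powr (1/3))) = r powr (2/3) * integral {c..<d} (\<lambda>x. f'' x powr (1/3))"
    by (simp add: mult.assoc[symmetric])
  finally show ?thesis .
qed

lemma partition_of_scale: "partition_of p k c d \<Longrightarrow> 0 < \<rho> \<Longrightarrow> partition_of (\<lambda>i. \<rho> * p i) k (\<rho> * c) (\<rho> * d)"
  by (simp add: partition_of_def)

lemma monotonic_on_scale:
  fixes h :: "real \<Rightarrow> real"
  assumes "monotonic_on {c<..<d} h" "0 < \<rho>" "0 < K"
  shows "monotonic_on {\<rho> * c<..<\<rho> * d} (\<lambda>x. K * h (x / \<rho>))"
  using assms unfolding monotonic_on_def monotone_on_def
  by (auto simp: field_simps divide_right_mono)

text \<open>The scaled second derivatives carry the factors \<open>s^3 / r\<close> for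
  \<open>f\<close> and \<open>1 / (r * s^3)\<close> for \<open>g\<close>; these are the reciprocals
  of their square roots.\<close>

lemma half_powers_eq_sqrt:
  fixes r s :: real
  assumes "0 < r" "0 < s"
  shows "r powr (1/2) * s powr (-3/2) = sqrt (r / s ^ 3)" "r powr (1/2) * s powr (3/2) = sqrt (r * s ^ 3)"
proof -
  have "sqrt (s ^ 3) = s powr (3/2)" using powr_powr[of s 3 "1/2"] assms by (simp add: powr_half_sqrt)
  moreover have "s powr (-3/2) = 1 / s powr (3/2)" using powr_minus_divide[of s "3/2"] by simp
  ultimately show "r powr (1/2) * s powr (-3/2) = sqrt (r / s ^ 3)" "r powr (1/2) * s powr (3/2) = sqrt (r * s ^ 3)"
    using assms by (simp_all add: powr_half_sqrt real_sqrt_divide real_sqrt_mult)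
qed

lemma lattice_count_scale:
  assumes "0 < r" "0 < s"
  shows "lattice_count f L r s = lattice_count (\<lambda>x. (r * s) * f (x / (r / s))) ((r / s) * L) 1 1"
proof -
  have "real j * s / r = real j / (r / s)" "real j * s / r \<le> L \<longleftrightarrow> real j \<le> (r / s) * L" for j
    using assms by (simp_all add: field_simps)
  then show ?thesis unfolding lattice_count_def by simp
qed

lemma area_under_scale:
  assumes f: "continuous_on {0..L} f" and \<rho>: "0 < \<rho>" and A: "A * \<rho> = r\<^sup>2"
  shows "area_under (\<lambda>x. A * f (x / \<rho>)) (\<rho> * L) = r\<^sup>2 * area_under f L"
proof -
  have int: "f integrable_on {0..<L}"
    using integrable_continuous_real[OF f] has_integral_half_open_iff by (auto simp: integrable_on_def)
  have half: "integral {c..<d} h = integral {c..d} h" for h :: "real \<Rightarrow> real" and c d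
    unfolding integral_def integrable_on_def has_integral_half_open_iff ..
  have "integral {0..<\<rho> * L} (\<lambda>x. f (x / \<rho>)) = \<rho> * integral {0..<L} f"
    using integral_scale_half_open[OF int \<rho>] by simp
  then show ?thesis unfolding area_under_def half A[symmetric] by simp
qed

lemma lattice_count_scaled_bound:
  fixes f f' f'' g g' g'' :: "real \<Rightarrow> real" and a b :: "nat \<Rightarrow> real"
  assumes L: "L > 0" and M: "M > 0"
    and ff: "f \<in> {0..L} \<rightarrow> {0..M}" and f0: "f 0 = M" and fL: "f L = 0"
    and cf: "continuous_on {0..L} f" and anti: "strict_antimono_on {0..L} f"
    and gg: "g \<in> {0..M} \<rightarrow> {0..L}"
    and gf: "\<forall>x\<in>{0..L}. g (f x) = x" and fg: "\<forall>y\<in>{0..M}. f (g y) = y"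
    and \<alpha>\<beta>: "(\<alpha>, \<beta>) \<in> graph_curve f L" and \<alpha>: "\<alpha> > 0" and \<beta>: "\<beta> > 0"
    and C2f: "C2_on_with {\<alpha>..<L} f f' f''" and signf: "\<forall>x\<in>{\<alpha>..<L}. f' x < 0 \<and> f'' x > 0"
    and C2g: "C2_on_with {\<beta>..<M} g g' g''" and signg: "\<forall>y\<in>{\<beta>..<M}. g' y < 0 \<and> g'' y > 0"
    and Pa: "partition_of a m \<alpha> L" and mf: "\<forall>i<m. monotonic_on {a i<..<a (Suc i)} f''"
    and Pb: "partition_of b n \<beta> M" and mg: "\<forall>i<n. monotonic_on {b i<..<b (Suc i)} g''"
    and \<delta>: "0 < \<delta>" "\<delta> < L - \<alpha>" and \<epsilon>: "0 < \<epsilon>" "\<epsilon> < M - \<beta>"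
    and r: "0 < r" and s: "0 < s"
  shows "\<bar>real (lattice_count f L r s) - r^2 * area_under f L + r * (inverse s * L + s * M) / 2\<bar>
          \<le> 6 * r powr (2/3)
                * (integral {\<alpha>..<L} (\<lambda>x. f'' x powr (1/3)) + integral {\<beta>..<M} (\<lambda>y. g'' y powr (1/3)))
            + 175 * r powr (1/2)
                * (s powr (-3/2) / sqrt (f'' (L - \<delta>)) + s powr (3/2) / sqrt (g'' (M - \<epsilon>)))
            + 525 * r powr (1/2)
                * ((\<Sum>i<m. s powr (-3/2) / sqrt (f'' (a i))) + (\<Sum>i<n. s powr (3/2) / sqrt (g'' (b i))))
            + 1/4 * ((\<Sum>i<m. s powr 2 * \<bar>f' (a i)\<bar>) + (\<Sum>i<n. s powr (-2) * \<bar>g' (b i)\<bar>))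
            + 1/2 * r * (inverse s * \<delta> + s * \<epsilon>) + 3 * (real m + real n) + 5
            + s powr (-2) * (L / M) + s powr 2 * (M / L)"
proof -
  \<comment> \<open>The scaled curve is the image of the original under stretching \<open>x\<close>
    by \<open>\<rho>\<close> and \<open>y\<close> by \<open>A\<close>. Slopes of \<open>f\<close>
    are multiplied by \<open>A / \<rho> = s^2\<close> and those of \<open>g\<close> by the inverse,
    areas by \<open>r^2\<close>.\<close>
  define \<rho> A where "\<rho> = r / s" and "A = r * s"
  have \<rho>: "0 < \<rho>" and A: "0 < A" and A\<rho>: "A * \<rho> = r\<^sup>2" "\<rho> * A = r\<^sup>2"
    using r s by (simp_all add: \<rho>_def A_def power2_eq_square)
  define F F' F'' where "F = (\<lambda>x. A * f (x / \<rho>))" and "F' = (\<lambda>x. A / \<rho> * f' (x / \<rho>))"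
    and "F'' = (\<lambda>x. A / \<rho>\<^sup>2 * f'' (x / \<rho>))"
  define G G' G'' where "G = (\<lambda>y. \<rho> * g (y / A))" and "G' = (\<lambda>y. \<rho> / A * g' (y / A))"
    and "G'' = (\<lambda>y. \<rho> / A\<^sup>2 * g'' (y / A))"
  have dom: "x / \<rho> \<in> {0..L}" if "x \<in> {0..\<rho> * L}" for x using that \<rho> by (auto simp: field_simps)
  have domA: "y / A \<in> {0..M}" if "y \<in> {0..A * M}" for y using that A by (auto simp: field_simps)
  have ffx: "0 \<le> f x \<and> f x \<le> M" if "x \<in> {0..L}" for x using ff that by auto
  have ggx: "0 \<le> g y \<and> g y \<le> L" if "y \<in> {0..M}" for y using gg that by auto
  \<comment> \<open>The estimate is applied with \<open>\<rho> * \<delta>\<close> and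
    \<open>A * \<epsilon>\<close>, so that the scaled cut points are the images of
    \<open>L - \<delta>\<close> and \<open>M - \<epsilon>\<close>.\<close>
  have bound: "\<bar>real (lattice_count F (\<rho> * L) 1 1) - area_under F (\<rho> * L) + (\<rho> * L + A * M) / 2\<bar>
        \<le> 6 * (integral {\<rho> * \<alpha>..<\<rho> * L} (\<lambda>x. F'' x powr (1/3)) + integral {A * \<beta>..<A * M} (\<lambda>y. G'' y powr (1/3)))
          + 175 * (1 / sqrt (F'' (\<rho> * L - \<rho> * \<delta>)) + 1 / sqrt (G'' (A * M - A * \<epsilon>)))
          + 525 * ((\<Sum>i<m. 1 / sqrt (F'' (\<rho> * a i))) + (\<Sum>i<n. 1 / sqrt (G'' (A * b i))))
          + 1/4 * ((\<Sum>i<m. \<bar>F' (\<rho> * a i)\<bar>) + (\<Sum>i<n. \<bar>G' (A * b i)\<bar>))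
          + 1/2 * (\<rho> * \<delta> + A * \<epsilon>) + 3 * (real m + real n) + 5 + \<rho> * L / (A * M) + A * M / (\<rho> * L)"
  proof (rule lattice_count_unit_bound[where g = G])
    show "F \<in> {0..\<rho> * L} \<rightarrow> {0..A * M}" unfolding F_def
      using ffx[OF dom] A by (auto simp: Pi_iff intro!: mult_left_mono)
    show "G \<in> {0..A * M} \<rightarrow> {0..\<rho> * L}" unfolding G_def
      using ggx[OF domA] \<rho> by (auto simp: Pi_iff intro!: mult_left_mono)
    show "continuous_on {0..\<rho> * L} F" unfolding F_def
      using dom \<rho> by (intro continuous_intros continuous_on_compose2[OF cf]) auto
    show "strict_antimono_on {0..\<rho> * L} F"
    proof (rule monotone_onI)
      fix x y assume xy: "x \<in> {0..\<rho> * L}" "y \<in> {0..\<rho> * L}" "x < y"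
      have "f (y / \<rho>) < f (x / \<rho>)"
        using anti dom[OF xy(1)] dom[OF xy(2)] xy(3) \<rho> by (simp add: monotone_on_def divide_strict_right_mono)
      then show "F y < F x" using A by (simp add: F_def)
    qed
    show "\<forall>x\<in>{0..\<rho> * L}. G (F x) = x" using gf dom A \<rho> by (simp add: F_def G_def)
    show "\<forall>y\<in>{0..A * M}. F (G y) = y" using fg domA A \<rho> by (simp add: F_def G_def)
    show "(\<rho> * \<alpha>, A * \<beta>) \<in> graph_curve F (\<rho> * L)"
      using \<alpha>\<beta> \<rho> by (auto simp: graph_curve_def F_def)
    show "C2_on_with {\<rho> * \<alpha>..<\<rho> * L} F F' F''" unfolding F_def F'_def F''_def
      by (rule C2_on_with_scale[OF C2f \<rho>])
    show "C2_on_with {A * \<beta>..<A * M} G G' G''" unfolding G_def G'_def G''_def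
      by (rule C2_on_with_scale[OF C2g A])
    show "\<forall>x\<in>{\<rho> * \<alpha>..<\<rho> * L}. F' x < 0 \<and> F'' x > 0"
    proof
      fix x assume "x \<in> {\<rho> * \<alpha>..<\<rho> * L}"
      then have "x / \<rho> \<in> {\<alpha>..<L}" using \<rho> by (auto simp: field_simps)
      then have "f' (x / \<rho>) < 0" "f'' (x / \<rho>) > 0" using signf by auto
      then show "F' x < 0 \<and> F'' x > 0" using A \<rho> by (simp add: F'_def F''_def mult_pos_neg divide_neg_pos)
    qed
    show "\<forall>y\<in>{A * \<beta>..<A * M}. G' y < 0 \<and> G'' y > 0"
    proof
      fix y assume "y \<in> {A * \<beta>..<A * M}"
      then have "y / A \<in> {\<beta>..<M}" using A by (auto simp: field_simps)
      then have "g' (y / A) < 0" "g'' (y / A) > 0" using signg by auto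
      then show "G' y < 0 \<and> G'' y > 0" using A \<rho> by (simp add: G'_def G''_def mult_pos_neg divide_neg_pos)
    qed
    show "\<forall>i<m. monotonic_on {\<rho> * a i<..<\<rho> * a (Suc i)} F''"
      unfolding F''_def using mf A \<rho> by (intro allI impI monotonic_on_scale) auto
    show "\<forall>i<n. monotonic_on {A * b i<..<A * b (Suc i)} G''"
      unfolding G''_def using mg A \<rho> by (intro allI impI monotonic_on_scale) auto
    show "\<rho> * \<delta> < \<rho> * L - \<rho> * \<alpha>" "A * \<epsilon> < A * M - A * \<beta>"
      using mult_strict_left_mono[OF \<delta>(2) \<rho>] mult_strict_left_mono[OF \<epsilon>(2) A] by (simp_all add: right_diff_distrib)
  qed (use L M \<alpha> \<beta> \<delta> \<epsilon> \<rho> A f0 fL Pa Pb in \<open>auto simp: F_def partition_of_scale\<close>)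
  have int: "integral {\<rho> * \<alpha>..<\<rho> * L} (\<lambda>x. F'' x powr (1/3)) = r powr (2/3) * integral {\<alpha>..<L} (\<lambda>x. f'' x powr (1/3))"
    "integral {A * \<beta>..<A * M} (\<lambda>y. G'' y powr (1/3)) = r powr (2/3) * integral {\<beta>..<M} (\<lambda>y. g'' y powr (1/3))"
    unfolding F''_def G''_def
    by (rule cube_root_integral_scale; use integrable_cube_root_second_derivative[OF C2f] integrable_cube_root_second_derivative[OF C2g]
        signf signg \<rho> A A\<rho> r in blast)+
  have "A / \<rho>\<^sup>2 = inverse (r / s ^ 3)" "\<rho> / A\<^sup>2 = inverse (r * s ^ 3)"
    using r s by (simp_all add: A_def \<rho>_def field_simps power2_eq_square power3_eq_cube)
  moreover have cancel: "\<rho> * x / \<rho> = x" "A * x / A = x" for x using \<rho> A by simp_all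
  ultimately have root: "1 / sqrt (F'' (\<rho> * x)) = r powr (1/2) * (s powr (-3/2) / sqrt (f'' x))"
    "1 / sqrt (G'' (A * x)) = r powr (1/2) * (s powr (3/2) / sqrt (g'' x))" for x
    unfolding times_divide_eq_right half_powers_eq_sqrt[OF r s] F''_def G''_def cancel
    by (simp_all add: real_sqrt_mult real_sqrt_inverse divide_inverse)
  have "A / \<rho> = s\<^sup>2" "\<rho> / A = inverse (s\<^sup>2)" "s powr 2 = s\<^sup>2" "s powr (-2) = inverse (s\<^sup>2)"
    using r s by (simp_all add: A_def \<rho>_def field_simps power2_eq_square powr_minus)
  then have slope: "\<bar>F' (\<rho> * x)\<bar> = s powr 2 * \<bar>f' x\<bar>" "\<bar>G' (A * x)\<bar> = s powr (-2) * \<bar>g' x\<bar>"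
    and ratio: "\<rho> * L / (A * M) = s powr (-2) * (L / M)" "A * M / (\<rho> * L) = s powr 2 * (M / L)" for x
    using \<rho> A by (simp_all add: F'_def G'_def abs_mult flip: times_divide_times_eq)
  have count: "lattice_count F (\<rho> * L) 1 1 = lattice_count f L r s"
    unfolding F_def \<rho>_def A_def by (rule lattice_count_scale[OF r s, symmetric])
  have area: "area_under F (\<rho> * L) = r\<^sup>2 * area_under f L"
    unfolding F_def by (rule area_under_scale[OF cf \<rho> A\<rho>(1)])
  have "\<rho> * L + A * M = r * (inverse s * L + s * M)" "\<rho> * \<delta> + A * \<epsilon> = r * (inverse s * \<delta> + s * \<epsilon>)"
    by (simp_all add: A_def \<rho>_def divide_inverse algebra_simps)
  note eqs = this int slope ratio count area root
  show ?thesis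
    using bound unfolding right_diff_distrib[symmetric] eqs sum_distrib_left[symmetric] distrib_left[symmetric]
    by (simp only: mult.assoc)
qed

theorem proposition6:
  fixes L M \<alpha> \<beta> :: real
    and f f' f'' g g' g'' :: "real \<Rightarrow> real"
    and a b :: "nat \<Rightarrow> real"
    and m n :: nat
  assumes "L > 0" and "M > 0"
    and "f \<in> {0..L} \<rightarrow> {0..M}" and "f 0 = M" and "f L = 0"
    and "continuous_on {0..L} f" and "convex_on {0..L} f" and "strict_antimono_on {0..L} f"
    and "g \<in> {0..M} \<rightarrow> {0..L}"
    and "\<forall>x\<in>{0..L}. g (f x) = x" and "\<forall>y\<in>{0..M}. f (g y) = y"
    and "(\<alpha>, \<beta>) \<in> graph_curve f L" and "\<alpha> > 0" and "\<beta> > 0"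
    and "C2_on_with {\<alpha>..<L} f f' f''" and "\<forall>x\<in>{\<alpha>..<L}. f' x < 0 \<and> f'' x > 0"
    and "C2_on_with {\<beta>..<M} g g' g''" and "\<forall>y\<in>{\<beta>..<M}. g' y < 0 \<and> g'' y > 0"
    and "partition_of a m \<alpha> L" and "\<forall>i<m. monotonic_on {a i<..<a (Suc i)} f''"
    and "partition_of b n \<beta> M" and "\<forall>i<n. monotonic_on {b i<..<b (Suc i)} g''"
  shows
    "((\<forall>j k :: int. (real_of_int j, real_of_int k) \<notin> graph_curve f L) \<and>
      \<alpha> < of_int \<lfloor>L\<rfloor> \<and> \<beta> < of_int \<lfloor>M\<rfloor> \<longrightarrow>
      (\<forall>\<delta> \<epsilon> :: real. 0 < \<delta> \<and> \<delta> < of_int \<lfloor>L\<rfloor> - \<alpha> \<and> 0 < \<epsilon> \<and> \<epsilon> < of_int \<lfloor>M\<rfloor> - \<beta> \<longrightarrow>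
        \<bar>real (lattice_count f L 1 1) - area_under f L + (L + M) / 2\<bar>
        \<le> 6 * (integral {\<alpha>..<L} (\<lambda>x. f'' x powr (1/3)) + integral {\<beta>..<M} (\<lambda>y. g'' y powr (1/3)))
          + 175 * (1 / sqrt (f'' (L - \<delta>)) + 1 / sqrt (g'' (M - \<epsilon>)))
          + 525 * ((\<Sum>i<m. 1 / sqrt (f'' (a i))) + (\<Sum>i<n. 1 / sqrt (g'' (b i))))
          + 1/4 * ((\<Sum>i<m. \<bar>f' (a i)\<bar>) + (\<Sum>i<n. \<bar>g' (b i)\<bar>))
          + 1/2 * (\<delta> + \<epsilon>) + 3 * (real m + real n) + 5 + L / M + M / L))
     \<and>
     (\<alpha> < L / 2 \<and> \<beta> < M / 2 \<longrightarrow>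
      (\<forall>\<delta> \<epsilon> :: real \<Rightarrow> real.
        (\<forall>t>0. 0 < \<delta> t \<and> \<delta> t < L / 2 - \<alpha>) \<and> (\<forall>t>0. 0 < \<epsilon> t \<and> \<epsilon> t < M / 2 - \<beta>) \<longrightarrow>
        (\<forall>r s :: real. r > 0 \<and> s > 0 \<and> r * inverse s * L \<ge> 1 \<and> r * s * M \<ge> 1 \<longrightarrow>
          \<bar>real (lattice_count f L r s) - r^2 * area_under f L + r * (inverse s * L + s * M) / 2\<bar>
          \<le> 6 * r powr (2/3)
                * (integral {\<alpha>..<L} (\<lambda>x. f'' x powr (1/3)) + integral {\<beta>..<M} (\<lambda>y. g'' y powr (1/3)))
            + 175 * r powr (1/2)
                * (s powr (-3/2) / sqrt (f'' (L - \<delta> r)) + s powr (3/2) / sqrt (g'' (M - \<epsilon> r)))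
            + 525 * r powr (1/2)
                * ((\<Sum>i<m. s powr (-3/2) / sqrt (f'' (a i))) + (\<Sum>i<n. s powr (3/2) / sqrt (g'' (b i))))
            + 1/4 * ((\<Sum>i<m. s powr 2 * \<bar>f' (a i)\<bar>) + (\<Sum>i<n. s powr (-2) * \<bar>g' (b i)\<bar>))
            + 1/2 * r * (inverse s * \<delta> r + s * \<epsilon> r) + 3 * (real m + real n) + 5
            + s powr (-2) * (L / M) + s powr 2 * (M / L))))"
proof (intro conjI impI allI)
  fix \<delta> \<epsilon> :: real
  assume int: "(\<forall>j k :: int. (real_of_int j, real_of_int k) \<notin> graph_curve f L) \<and>
      \<alpha> < of_int \<lfloor>L\<rfloor> \<and> \<beta> < of_int \<lfloor>M\<rfloor>"
    and "0 < \<delta> \<and> \<delta> < of_int \<lfloor>L\<rfloor> - \<alpha> \<and> 0 < \<epsilon> \<and> \<epsilon> < of_int \<lfloor>M\<rfloor> - \<beta>"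
  then have \<delta>: "0 < \<delta>" "\<delta> < L - \<alpha>" and \<epsilon>: "0 < \<epsilon>" "\<epsilon> < M - \<beta>" by linarith+
  show "\<bar>real (lattice_count f L 1 1) - area_under f L + (L + M) / 2\<bar>
        \<le> 6 * (integral {\<alpha>..<L} (\<lambda>x. f'' x powr (1/3)) + integral {\<beta>..<M} (\<lambda>y. g'' y powr (1/3)))
          + 175 * (1 / sqrt (f'' (L - \<delta>)) + 1 / sqrt (g'' (M - \<epsilon>)))
          + 525 * ((\<Sum>i<m. 1 / sqrt (f'' (a i))) + (\<Sum>i<n. 1 / sqrt (g'' (b i))))
          + 1/4 * ((\<Sum>i<m. \<bar>f' (a i)\<bar>) + (\<Sum>i<n. \<bar>g' (b i)\<bar>))
          + 1/2 * (\<delta> + \<epsilon>) + 3 * (real m + real n) + 5 + L / M + M / L"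
    by (rule lattice_count_unit_bound[OF assms(1-6) assms(8-22) \<delta> \<epsilon>])
next
  fix \<delta> \<epsilon> :: "real \<Rightarrow> real" and r s :: real
  assume half: "\<alpha> < L / 2 \<and> \<beta> < M / 2"
    and range: "(\<forall>t>0. 0 < \<delta> t \<and> \<delta> t < L / 2 - \<alpha>) \<and> (\<forall>t>0. 0 < \<epsilon> t \<and> \<epsilon> t < M / 2 - \<beta>)"
    and rs: "r > 0 \<and> s > 0 \<and> r * inverse s * L \<ge> 1 \<and> r * s * M \<ge> 1"
  then have \<delta>: "0 < \<delta> r" "\<delta> r < L - \<alpha>" and \<epsilon>: "0 < \<epsilon> r" "\<epsilon> r < M - \<beta>" and r: "0 < r" and s: "0 < s"
    using assms(1,2) by (auto simp: field_simps dest!: spec[of _ r])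
  show "\<bar>real (lattice_count f L r s) - r^2 * area_under f L + r * (inverse s * L + s * M) / 2\<bar>
          \<le> 6 * r powr (2/3)
                * (integral {\<alpha>..<L} (\<lambda>x. f'' x powr (1/3)) + integral {\<beta>..<M} (\<lambda>y. g'' y powr (1/3)))
            + 175 * r powr (1/2)
                * (s powr (-3/2) / sqrt (f'' (L - \<delta> r)) + s powr (3/2) / sqrt (g'' (M - \<epsilon> r)))
            + 525 * r powr (1/2)
                * ((\<Sum>i<m. s powr (-3/2) / sqrt (f'' (a i))) + (\<Sum>i<n. s powr (3/2) / sqrt (g'' (b i))))
            + 1/4 * ((\<Sum>i<m. s powr 2 * \<bar>f' (a i)\<bar>) + (\<Sum>i<n. s powr (-2) * \<bar>g' (b i)\<bar>))
            + 1/2 * r * (inverse s * \<delta> r + s * \<epsilon> r) + 3 * (real m + real n) + 5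
            + s powr (-2) * (L / M) + s powr 2 * (M / L)"
    by (rule lattice_count_scaled_bound[OF assms(1-6) assms(8-22) \<delta> \<epsilon> r s])
qed

end
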